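(* Let $0\le\theta<\pi/2$, $A,B\in\mathcal S_\theta\subseteq\mathbb M_n$, let $\sigma$ be an operator mean and $\sigma_1,\sigma_2$ operator means with $\sigma^*\le\sigma_1,\sigma_2\le\sigma$, and let $0<m\le M$, $K=\frac{(M+m)^2}{4mM}$. (i) If $0<mI\le\Re A,\ \Re B\le MI$, then $|\det(A\sigma_1B)|\le\sec^{3n}\theta\,K^n\,|\det(A\sigma_2B)|$. (ii) If $0<mI\le\Re(A^{-1}),\ \Re(B^{-1})\le MI$, then $|\det(A\sigma_1B)|\le\sec^{5n}\theta\,K^n\,|\det(A\sigma_2B)|$. (iii) If $v\in[0,1]$, $\sigma$ is an operator mean with $!_v\le\sigma\le\nabla_v$, and $0<mI\le\Re A,\ \Re B\le MI$, then $|\det(A\nabla_vB)|\le\sec^{n}\theta\,K^n\,|\det(A\sigma B)|$.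
   Context: $\Re X=\frac{X+X^*}{2}$; for Hermitian $X,Y$, $X\le Y$ means $Y-X$ is positive semidefinite. $\mathcal S_\theta$ ($0\le\theta<\pi/2$) is the set of $A\in\mathbb M_n$ whose numerical range lies in $\{z:\Re z>0,\ |\Im z|\le(\Re z)\tan\theta\}$. An operator mean $\sigma$ has an operator monotone representing function $g:(0,\infty)\to(0,\infty)$, $g(1)=1$, and $A\sigma B=A^{1/2}g(A^{-1/2}BA^{-1/2})A^{1/2}$ (also used for accretive $A,B$ via principal square roots and holomorphic functional calculus). The adjoint $\sigma^*$ has representing function $g(t^{-1})^{-1}$. $A\nabla_vB=vA+(1-v)B$, $A!_vB=(vA^{-1}+(1-v)B^{-1})^{-1}$. For means with representing functions $g_1,g_2$, $\tau_1\le\tau_2$ means $g_1\le g_2$ on $(0,\infty)$. *)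

theory Defs
  imports "HOL-Complex_Analysis.Complex_Analysis"
          "Jordan_Normal_Form.Schur_Decomposition"
          "Jordan_Normal_Form.Gauss_Jordan_Elimination"
begin

definition mat_Re :: "complex mat \<Rightarrow> complex mat" where
  "mat_Re X = (1/2 :: complex) \<cdot>\<^sub>m (X + mat_adjoint X)"

definition hermitian_mat :: "nat \<Rightarrow> complex mat \<Rightarrow> bool" where
  "hermitian_mat n X \<longleftrightarrow> X \<in> carrier_mat n n \<and> mat_adjoint X = X"

text \<open>x^* X x, with x \<bullet>c y = sum of x_i * cnj y_i.\<close>
definition qform :: "complex mat \<Rightarrow> complex vec \<Rightarrow> complex" where
  "qform X x = (X *\<^sub>v x) \<bullet>c x"

definition psd_mat :: "nat \<Rightarrow> complex mat \<Rightarrow> bool" where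
  "psd_mat n X \<longleftrightarrow> hermitian_mat n X \<and> (\<forall>x \<in> carrier_vec n. 0 \<le> Re (qform X x))"

definition pd_mat :: "nat \<Rightarrow> complex mat \<Rightarrow> bool" where
  "pd_mat n X \<longleftrightarrow> hermitian_mat n X \<and>
     (\<forall>x \<in> carrier_vec n. x \<noteq> 0\<^sub>v n \<longrightarrow> 0 < Re (qform X x))"

definition loewner_le :: "nat \<Rightarrow> complex mat \<Rightarrow> complex mat \<Rightarrow> bool" where
  "loewner_le n X Y \<longleftrightarrow> hermitian_mat n X \<and> hermitian_mat n Y \<and> psd_mat n (Y - X)"

definition herm_calc :: "nat \<Rightarrow> (real \<Rightarrow> real) \<Rightarrow> complex mat \<Rightarrow> complex mat" where
  "herm_calc n g X = (SOME F. \<exists>U d. U \<in> carrier_mat n n \<and> U * mat_adjoint U = 1\<^sub>m n \<and>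
      (\<forall>i<n. 0 < d i) \<and>
      X = U * mat_diag n (\<lambda>i. complex_of_real (d i)) * mat_adjoint U \<and>
      F = U * mat_diag n (\<lambda>i. complex_of_real (g (d i))) * mat_adjoint U)"

definition operator_monotone :: "(real \<Rightarrow> real) \<Rightarrow> bool" where
  "operator_monotone g \<longleftrightarrow> (\<forall>k X Y. pd_mat k X \<and> pd_mat k Y \<and> loewner_le k X Y \<longrightarrow>
      loewner_le k (herm_calc k g X) (herm_calc k g Y))"

text \<open>Representing function of an operator mean.\<close>
definition op_mean_fun :: "(real \<Rightarrow> real) \<Rightarrow> bool" where
  "op_mean_fun g \<longleftrightarrow> operator_monotone g \<and> (\<forall>t>0. 0 < g t) \<and> g 1 = 1"

definition sector_mat :: "nat \<Rightarrow> real \<Rightarrow> complex mat \<Rightarrow> bool" where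
  "sector_mat n \<theta> X \<longleftrightarrow> X \<in> carrier_mat n n \<and>
     (\<forall>x \<in> carrier_vec n. x \<bullet>c x = 1 \<longrightarrow>
        0 < Re (qform X x) \<and> \<bar>Im (qform X x)\<bar> \<le> Re (qform X x) * tan \<theta>)"

definition minv :: "complex mat \<Rightarrow> complex mat" where
  "minv X = the (mat_inverse X)"

definition eigvals :: "complex mat \<Rightarrow> complex set" where
  "eigvals T = {z. det (z \<cdot>\<^sub>m 1\<^sub>m (dim_row T) - T) = 0}"

text \<open>Holomorphic (Riesz--Dunford) functional calculus:
  f(T) = (1/(2 pi i)) \<ointment>_\<gamma> f(z) (zI - T)^{-1} dz, with \<gamma> a closed path in the open set S
  (where f is holomorphic) winding once around every eigenvalue of T and zero times around
  every point outside S.\<close>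
definition hol_calc :: "complex set \<Rightarrow> (complex \<Rightarrow> complex) \<Rightarrow> complex mat \<Rightarrow> complex mat" where
  "hol_calc S f T = (let n = dim_row T;
      \<gamma> = (SOME \<gamma>. valid_path \<gamma> \<and> pathfinish \<gamma> = pathstart \<gamma> \<and>
             path_image \<gamma> \<subseteq> S - eigvals T \<and>
             (\<forall>z \<in> eigvals T. winding_number \<gamma> z = 1) \<and>
             (\<forall>w. w \<notin> S \<longrightarrow> winding_number \<gamma> w = 0))
    in Matrix.mat n n (\<lambda>(i,j). contour_integral \<gamma>
          (\<lambda>z. f z * minv (z \<cdot>\<^sub>m 1\<^sub>m n - T) $$ (i,j)) / (2 * of_real pi * \<i>)))"

abbreviation slit_plane :: "complex set" where
  "slit_plane \<equiv> - \<real>\<^sub>\<le>\<^sub>0"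

definition hol_ext :: "(real \<Rightarrow> real) \<Rightarrow> complex \<Rightarrow> complex" where
  "hol_ext g = (SOME G. G holomorphic_on slit_plane \<and>
      (\<forall>x>0. G (complex_of_real x) = complex_of_real (g x)))"

definition msqrt :: "complex mat \<Rightarrow> complex mat" where
  "msqrt A = hol_calc slit_plane csqrt A"

definition mean_app :: "(real \<Rightarrow> real) \<Rightarrow> complex mat \<Rightarrow> complex mat \<Rightarrow> complex mat" where
  "mean_app g A B = (let R = msqrt A; Ri = minv R in
      R * hol_calc slit_plane (hol_ext g) (Ri * B * Ri) * R)"

end

theory Submission
  imports Defs "HOL-Real_Asymp.Real_Asymp"
begin

text \<open>By Loewner's theorem an operator mean function is a limit, locally uniformly on the slit plane, of
  convex combinations of the functions \<open>z / (s z + 1 - s)\<close>, which represent the weighted harmonic means.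
  For these, and hence for every operator mean, the variational characterization of the harmonic mean
  together with a simultaneous diagonalization \<open>Re A = S S\<^sup>*\<close>, \<open>Re B = S D S\<^sup>*\<close> gives
  \<open>S g(D) S\<^sup>* \<le> Re (A \<sigma> B) \<le> sec\<^sup>2 \<theta> S g(D) S\<^sup>*\<close>, and \<open>A \<sigma> B\<close> is again sectorial. A sectorial \<open>X\<close> satisfies
  \<open>det (Re X) \<le> \<bar>det X\<bar> \<le> sec\<^sup>n \<theta> det (Re X)\<close>, so only the products of \<open>g(d\<^sub>i)\<close> remain to be compared. Here
  \<open>g t + t g (1/t) \<le> 1 + t\<close> yields \<open>g t g (1/t) \<le> (1 + t)\<^sup>2 / (4 t)\<close>, which is at most \<open>K\<close> because the
  pencil eigenvalues lie in \<open>[m/M, M/m]\<close>. In part (ii) the real parts lie between \<open>cos\<^sup>2 \<theta> / M\<close> and \<open>1/m\<close>,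
  which costs another factor \<open>sec\<^sup>2 \<theta>\<close> in \<open>K\<close>.

  The approximation in Loewner's theorem is obtained by duality: interlacing spectra make divided
  differences of \<open>r\<^sup>2 g\<close> nonnegative, polynomials that are nonnegative on a half-line are sums of squares
  with weights, hence \<open>g\<close> cannot be separated on a finite grid from the convex hull; Montel's theorem
  then provides the limit.\<close>

unbundle no fps_syntax
unbundle no vec_syntax

section \<open>Adjoints and quadratic forms\<close>

text \<open>The hypotheses on g speak about Hermitian matrices only, while \<open>mean_app\<close>
  evaluates a holomorphic function, itself picked by choice, at a non-Hermitian matrix along a path
  that is also picked by choice. Two devices bridge this gap. Every inequality used for a general
  mean is affine in the representing function and survives locally uniform limits
  (\<open>affine_cont\<close>), so it is checked only for weighted harmonic means, where the mean is
  the inverse of a sum of inverses and no calculus remains. The laws of the calculus itself are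
  proved for every admissible path by removing eigenvalues one at a time, so no path is ever
  deformed into another. In the Loewner part the grids have an odd number 2m+1 of nodes. Divided
  differences need an even number, and the node added to reach it is pushed to 0 or to infinity;
  this yields the two generators \<open>h^2\<close> and \<open>-x h^2\<close> of the nonnegative
  polynomials on the half-line (-\<infinity>, 0], which is where the poles of the harmonic functions
  lie.\<close>

lemma adj_dim [simp]: "dim_row (mat_adjoint A) = dim_col A" "dim_col (mat_adjoint A) = dim_row A"
  by (simp_all add: mat_adjoint_def)

lemma adj_index [simp]:
  "i < dim_col A \<Longrightarrow> j < dim_row A \<Longrightarrow> mat_adjoint (A::complex mat) $$ (i,j) = cnj (A $$ (j,i))"
  by (simp add: mat_adjoint_def mat_of_rows_def)

lemma adj_carrier [simp]: "A \<in> carrier_mat n m \<Longrightarrow> mat_adjoint A \<in> carrier_mat m n"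
  by (intro carrier_matI) auto

lemma adj_adj [simp]: "mat_adjoint (mat_adjoint (A::complex mat)) = A"
  by (rule eq_matI) auto

lemma adj_mult:
  assumes "(A::complex mat) \<in> carrier_mat n m" "B \<in> carrier_mat m k"
  shows "mat_adjoint (A * B) = mat_adjoint B * mat_adjoint A"
  using assms by (intro eq_matI) (auto simp: scalar_prod_def intro!: sum.cong)

lemma adj_add:
  assumes "(A::complex mat) \<in> carrier_mat n m" "B \<in> carrier_mat n m"
  shows "mat_adjoint (A + B) = mat_adjoint A + mat_adjoint B"
  using assms by (intro eq_matI) auto

lemma adj_minus:
  assumes "(A::complex mat) \<in> carrier_mat n m" "B \<in> carrier_mat n m"
  shows "mat_adjoint (A - B) = mat_adjoint A - mat_adjoint B"
  using assms by (intro eq_matI) auto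

lemma adj_smult: "mat_adjoint (c \<cdot>\<^sub>m (A::complex mat)) = cnj c \<cdot>\<^sub>m mat_adjoint A"
  by (intro eq_matI) auto

lemma adj_diag: "mat_adjoint (mat_diag n d) = mat_diag n (\<lambda>i. cnj (d i))"
  by (intro eq_matI) (auto simp: mat_diag_def)

lemma adj_one [simp]: "mat_adjoint (1\<^sub>m n) = (1\<^sub>m n :: complex mat)"
  by (intro eq_matI) auto

lemma cscalar_sum: "dim_vec y = n \<Longrightarrow> (x::complex vec) \<bullet>c y = (\<Sum>i<n. x $ i * cnj (y $ i))"
  by (auto simp: scalar_prod_def intro!: sum.cong)

lemma cscalar_adj:
  assumes "(A::complex mat) \<in> carrier_mat n m" "x \<in> carrier_vec m" "y \<in> carrier_vec n"
  shows "(A *\<^sub>v x) \<bullet>c y = x \<bullet>c (mat_adjoint A *\<^sub>v y)"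
proof -
  have "(A *\<^sub>v x) \<bullet>c y = (\<Sum>i<n. \<Sum>j<m. A $$ (i,j) * x $ j * cnj (y $ i))"
    using assms by (subst cscalar_sum[of _ n])
      (auto simp: scalar_prod_def sum_distrib_right atLeast0LessThan intro!: sum.cong)
  also have "\<dots> = (\<Sum>j<m. \<Sum>i<n. A $$ (i,j) * x $ j * cnj (y $ i))"
    by (rule sum.swap)
  also have "\<dots> = x \<bullet>c (mat_adjoint A *\<^sub>v y)"
    using assms by (subst cscalar_sum[of _ m])
      (auto simp: scalar_prod_def sum_distrib_left atLeast0LessThan intro!: sum.cong)
  finally show ?thesis .
qed

lemma cscalar_swap:
  assumes "(x::complex vec) \<in> carrier_vec n" "y \<in> carrier_vec n"
  shows "y \<bullet>c x = cnj (x \<bullet>c y)"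
  using assms by (subst (1 2) cscalar_sum[of _ n]) (auto simp: ac_simps)

lemma cscalar_add:
  assumes "(x::complex vec) \<in> carrier_vec n" "y \<in> carrier_vec n" "z \<in> carrier_vec n"
  shows "(x + y) \<bullet>c z = x \<bullet>c z + y \<bullet>c z" "z \<bullet>c (x + y) = z \<bullet>c x + z \<bullet>c y"
    "(x - y) \<bullet>c z = x \<bullet>c z - y \<bullet>c z" "z \<bullet>c (x - y) = z \<bullet>c x - z \<bullet>c y"
  using assms by (auto simp: cscalar_sum[of _ n] algebra_simps sum.distrib sum_subtractf)

lemma cscalar_smult:
  assumes "(x::complex vec) \<in> carrier_vec n" "y \<in> carrier_vec n"
  shows "(c \<cdot>\<^sub>v x) \<bullet>c y = c * (x \<bullet>c y)" "x \<bullet>c (c \<cdot>\<^sub>v y) = cnj c * (x \<bullet>c y)"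
  using assms by (auto simp: cscalar_sum[of _ n] algebra_simps sum_distrib_left)

lemma cscalar_self:
  assumes "(x::complex vec) \<in> carrier_vec n"
  shows "x \<bullet>c x = complex_of_real (\<Sum>i<n. (cmod (x $ i))\<^sup>2)"
  using assms by (auto simp: cscalar_sum[of _ n] complex_norm_square simp flip: of_real_power)

lemma cscalar_self_nonneg:
  assumes "(x::complex vec) \<in> carrier_vec n"
  shows "0 \<le> Re (x \<bullet>c x)" "Im (x \<bullet>c x) = 0"
  unfolding cscalar_self[OF assms] Re_complex_of_real Im_complex_of_real by (auto intro!: sum_nonneg)

lemma cscalar_self_pos:
  assumes "(x::complex vec) \<in> carrier_vec n" "x \<noteq> 0\<^sub>v n"
  shows "0 < Re (x \<bullet>c x)"
proof -
  obtain i where "i < n" "x $ i \<noteq> 0" using assms by (metis eq_vecI carrier_vecD index_zero_vec)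
  then have "0 < (\<Sum>i<n. (cmod (x $ i))\<^sup>2)"
    by (intro sum_pos2[of _ i]) auto
  then show ?thesis unfolding cscalar_self[OF assms(1)] by simp
qed

lemma qform_cong:
  assumes "S \<in> carrier_mat n m" "X \<in> carrier_mat m m" "x \<in> carrier_vec n"
  shows "qform (S * X * mat_adjoint S) x = qform X (mat_adjoint S *\<^sub>v x)"
proof -
  have [simp]: "mat_adjoint S \<in> carrier_mat m n" using assms by simp
  have [simp]: "mat_adjoint S *\<^sub>v x \<in> carrier_vec m"
    by (rule mult_mat_vec_carrier[of _ m n]) (use assms in simp_all)
  have "(S * X * mat_adjoint S) *\<^sub>v x = (S * X) *\<^sub>v (mat_adjoint S *\<^sub>v x)"
    by (rule assoc_mult_mat_vec[of _ n m _ n]) (use assms in auto)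
  also have "\<dots> = S *\<^sub>v (X *\<^sub>v (mat_adjoint S *\<^sub>v x))"
    by (rule assoc_mult_mat_vec[of _ n m _ m]) (use assms in auto)
  finally have "(S * X * mat_adjoint S) *\<^sub>v x = S *\<^sub>v (X *\<^sub>v (mat_adjoint S *\<^sub>v x))" .
  then show ?thesis
    unfolding qform_def using assms
    by (simp add: cscalar_adj[of S n m])
qed

lemma qform_add:
  assumes "X \<in> carrier_mat n n" "Y \<in> carrier_mat n n" "x \<in> carrier_vec n"
  shows "qform (X + Y) x = qform X x + qform Y x"
  using assms unfolding qform_def
  by (simp add: add_mult_distrib_mat_vec[of _ n n] cscalar_add[of _ n])

lemma qform_minus:
  assumes "X \<in> carrier_mat n n" "Y \<in> carrier_mat n n" "x \<in> carrier_vec n"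
  shows "qform (X - Y) x = qform X x - qform Y x"
  using assms unfolding qform_def
  by (simp add: minus_mult_distrib_mat_vec[of _ n n] cscalar_add[of _ n])

lemma qform_smult:
  assumes "X \<in> carrier_mat n n" "x \<in> carrier_vec n"
  shows "qform (c \<cdot>\<^sub>m X) x = c * qform X x"
proof -
  have "(c \<cdot>\<^sub>m X) *\<^sub>v x = c \<cdot>\<^sub>v (X *\<^sub>v x)"
    using assms by (intro eq_vecI) (auto simp: scalar_prod_def sum_distrib_left ac_simps)
  then show ?thesis using assms unfolding qform_def by (simp add: cscalar_smult[of _ n])
qed

lemma qform_adj:
  assumes "X \<in> carrier_mat n n" "x \<in> carrier_vec n"
  shows "qform (mat_adjoint X) x = cnj (qform X x)"
  using assms unfolding qform_def
  by (subst cscalar_adj[of _ n n]) (auto intro!: cscalar_swap)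

lemma qform_one: "x \<in> carrier_vec n \<Longrightarrow> qform (1\<^sub>m n) x = x \<bullet>c x"
  by (simp add: qform_def)

lemma qform_diag:
  assumes "x \<in> carrier_vec n"
  shows "qform (mat_diag n d) x = (\<Sum>i<n. d i * complex_of_real ((cmod (x $ i))\<^sup>2))"
proof -
  have "(mat_diag n d *\<^sub>v x) $ i = d i * x $ i" if "i < n" for i
    using assms that
    by (auto simp: mat_diag_def scalar_prod_def if_distrib if_distribR cong: if_cong)
  then show ?thesis using assms unfolding qform_def
    by (auto simp: cscalar_sum[of _ n] complex_norm_square mult.assoc simp del: of_real_power)
qed

lemma qform_mat_Re:
  assumes "X \<in> carrier_mat n n" "x \<in> carrier_vec n"
  shows "qform (mat_Re X) x = complex_of_real (Re (qform X x))"
  using assms unfolding mat_Re_def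
  by (simp add: qform_smult[of _ n] qform_add[of _ n] qform_adj[of _ n] complex_add_cnj)

lemma hermitian_mat_Re: "X \<in> carrier_mat n n \<Longrightarrow> hermitian_mat n (mat_Re X)"
  unfolding hermitian_mat_def mat_Re_def
  by (auto simp: adj_smult adj_add[of _ n n] comm_add_mat[of _ n n])

lemma mult_carrier_sq [simp]:
  "A \<in> carrier_mat n n \<Longrightarrow> B \<in> carrier_mat n n \<Longrightarrow> A * B \<in> carrier_mat n n"
  by simp

lemma hermitian_cong:
  assumes "S \<in> carrier_mat n m" "hermitian_mat m X"
  shows "hermitian_mat n (S * X * mat_adjoint S)"
proof -
  have X: "X \<in> carrier_mat m m" "mat_adjoint X = X" using assms unfolding hermitian_mat_def by auto
  have "mat_adjoint (S * X * mat_adjoint S) = S * mat_adjoint (S * X)"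
    by (subst adj_mult[of _ n m _ n]) (use assms X in auto)
  also have "mat_adjoint (S * X) = X * mat_adjoint S"
    by (subst adj_mult[of _ n m _ m]) (use assms X in auto)
  also have "S * (X * mat_adjoint S) = S * X * mat_adjoint S"
    by (subst assoc_mult_mat[of _ n m _ m _ n]) (use assms X in auto)
  finally show ?thesis using assms X unfolding hermitian_mat_def by auto
qed

section \<open>Eigenvectors and their completion to unitary matrices\<close>

lemma unit_eigenvector:
  assumes "(X::complex mat) \<in> carrier_mat n n" "0 < n"
  obtains v e where "v \<in> carrier_vec n" "v \<noteq> 0\<^sub>v n" "X *\<^sub>v v = e \<cdot>\<^sub>v v"
proof -
  have "degree (char_poly X) = n" using degree_monic_char_poly[OF assms(1)] by simp
  then obtain e where "poly (char_poly X) e = 0"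
    using fundamental_theorem_of_algebra_alt[of "char_poly X"] assms(2)
    by (metis degree_pCons_0 less_not_refl3)
  then have "eigenvalue X e" using eigenvalue_root_char_poly[OF assms(1)] by simp
  then obtain v where "eigenvector X v e" unfolding eigenvalue_def by auto
  then show ?thesis using that assms unfolding eigenvector_def by auto
qed

text \<open>Gram-Schmidt keeps the head of the completed basis and yields an orthogonal list, whose
  members are then divided by their norms. A multiple of v suffices because eigenvectors may be
  rescaled.\<close>

lemma unitary_with_first_column:
  assumes "(v::complex vec) \<in> carrier_vec n" "v \<noteq> 0\<^sub>v n"
  obtains W c where "W \<in> carrier_mat n n" "mat_adjoint W * W = 1\<^sub>m n" "W * mat_adjoint W = 1\<^sub>m n"
    "col W 0 = c \<cdot>\<^sub>v v"
proof -
  interpret cof_vec_space n "TYPE(complex)" .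
  define b where "b = basis_completion v"
  define ws where "ws = gram_schmidt n b"
  from basis_completion[OF assms, folded b_def]
  have dist_b: "distinct b" and indep: "\<not> lin_dep (set b)" and b: "set b \<subseteq> carrier_vec n"
    and hdb: "hd b = v" and len_b: "length b = n" by auto
  have n: "n \<noteq> 0" using assms by auto
  from hdb len_b n obtain vs where bv: "b = v # vs" by (cases b) auto
  from gram_schmidt_result[OF b dist_b indep refl, folded ws_def]
  have ws: "set ws \<subseteq> carrier_vec n" "corthogonal ws" "length ws = n" by (auto simp: len_b)
  from gram_schmidt_hd[OF assms(1), of vs, folded bv] have hdws: "hd ws = v" unfolding ws_def .
  define c where "c w = complex_of_real (1 / sqrt (Re (w \<bullet>c w)))" for w :: "complex vec"
  define W where "W = mat_of_cols n (map (\<lambda>w. c w \<cdot>\<^sub>v w) ws)"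
  have W: "W \<in> carrier_mat n n" using ws unfolding W_def by auto
  have wsi: "ws ! i \<in> carrier_vec n" if "i < n" for i using ws that by auto
  have colW: "col W i = c (ws ! i) \<cdot>\<^sub>v (ws ! i)" if "i < n" for i
    using that ws wsi[OF that] unfolding W_def by (subst col_mat_of_cols) auto
  have orth: "(ws ! i \<bullet>c ws ! j = 0) = (i \<noteq> j)" if "i < n" "j < n" for i j
    using corthogonalD[OF ws(2)] ws(3) that by auto
  have "mat_adjoint W * W = 1\<^sub>m n"
  proof (rule eq_matI)
    fix i j assume "i < dim_row (1\<^sub>m n :: complex mat)" "j < dim_col (1\<^sub>m n :: complex mat)"
    then have ij: "i < n" "j < n" by auto
    have "(mat_adjoint W * W) $$ (i,j) = col W j \<bullet>c col W i"
      using W ij by (auto simp: scalar_prod_def intro!: sum.cong)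
    also have "\<dots> = c (ws ! j) * cnj (c (ws ! i)) * (ws ! j \<bullet>c ws ! i)"
      using ij wsi by (simp add: colW cscalar_smult[of _ n])
    also have "\<dots> = (1\<^sub>m n) $$ (i,j)"
    proof (cases "i = j")
      case True
      have im: "ws ! i \<bullet>c ws ! i = complex_of_real (Re (ws ! i \<bullet>c ws ! i))"
        using cscalar_self_nonneg[OF wsi[OF ij(1)]] by (simp add: complex_eq_iff)
      have "ws ! i \<bullet>c ws ! i \<noteq> 0" using orth[OF ij(1) ij(1)] by auto
      then have "Re (ws ! i \<bullet>c ws ! i) > 0"
        using cscalar_self_nonneg[OF wsi[OF ij(1)]] by (simp add: complex_eq_iff less_le)
      then have "1 / sqrt (Re (ws ! i \<bullet>c ws ! i)) * (1 / sqrt (Re (ws ! i \<bullet>c ws ! i))) * Re (ws ! i \<bullet>c ws ! i) = 1"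
        by (simp only: times_divide_times_eq real_sqrt_mult_self abs_of_pos mult_1 times_divide_eq_left) auto
      then have "c (ws ! i) * cnj (c (ws ! i)) * complex_of_real (Re (ws ! i \<bullet>c ws ! i)) = 1"
        unfolding c_def complex_cnj_complex_of_real of_real_mult[symmetric] by (simp only: of_real_1)
      then show ?thesis using True ij im by (metis index_one_mat(1))
    next
      case False then show ?thesis using orth[OF ij(2) ij(1)] ij by auto
    qed
    finally show "(mat_adjoint W * W) $$ (i,j) = (1\<^sub>m n) $$ (i,j)" .
  qed (use W in auto)
  moreover then have "W * mat_adjoint W = 1\<^sub>m n"
    using mat_mult_left_right_inverse[OF _ W] W by simp
  moreover have "col W 0 = c v \<cdot>\<^sub>v v" using colW[of 0] n hdws ws by (cases ws) auto
  ultimately show ?thesis using that W by blast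
qed

section \<open>Spectral theorem and simultaneous diagonalization\<close>

lemma mat_diag_cong: "(\<And>i. i < n \<Longrightarrow> f i = g i) \<Longrightarrow> mat_diag n f = mat_diag n g"
  by (auto simp: mat_diag_def intro!: cong_mat)

lemma diag_cong_index:
  assumes "(A::complex mat) \<in> carrier_mat n m" "i < n" "j < n"
  shows "(A * mat_diag m f * mat_adjoint A) $$ (i,j) = (\<Sum>k<m. A $$ (i,k) * f k * cnj (A $$ (j,k)))"
  using assms by (auto simp: mat_diag_mult_right[of _ n] scalar_prod_def atLeast0LessThan intro!: sum.cong)

definition unitary :: "nat \<Rightarrow> complex mat \<Rightarrow> bool" where
  "unitary n U \<longleftrightarrow> U \<in> carrier_mat n n \<and> U * mat_adjoint U = 1\<^sub>m n \<and> mat_adjoint U * U = 1\<^sub>m n"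

lemma unitaryI:
  assumes "U \<in> carrier_mat n n" "mat_adjoint U * U = 1\<^sub>m n"
  shows "unitary n U"
  using assms mat_mult_left_right_inverse[of "mat_adjoint U" n U] unfolding unitary_def by simp

lemma unitary_mult:
  assumes "unitary n U" "unitary n V"
  shows "unitary n (U * V)"
proof (rule unitaryI)
  have c: "U \<in> carrier_mat n n" "V \<in> carrier_mat n n" using assms unfolding unitary_def by auto
  then show "U * V \<in> carrier_mat n n" by simp
  have "mat_adjoint (U * V) * (U * V) = mat_adjoint V * (mat_adjoint U * U) * V"
    using c by (simp add: adj_mult[of _ n n _ n] assoc_mult_mat[of _ n n _ n _ n])
  then show "mat_adjoint (U * V) * (U * V) = 1\<^sub>m n"
    using assms c unfolding unitary_def by simp
qed

text \<open>Deflation: conjugation by a unitary with an eigenvector as first column clears that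
  column below the diagonal; Hermitian symmetry clears the first row as well and makes the
  eigenvalue real. The remaining block is smaller by one.\<close>

lemma hermitian_spectral:
  assumes "hermitian_mat n X"
  shows "\<exists>U d. unitary n U \<and> X = U * mat_diag n (\<lambda>i. complex_of_real (d i)) * mat_adjoint U"
  using assms
proof (induction n arbitrary: X)
  case 0
  then have "X \<in> carrier_mat 0 0" unfolding hermitian_mat_def by auto
  then have "X = 1\<^sub>m 0 * mat_diag 0 (\<lambda>i. complex_of_real (d i)) * mat_adjoint (1\<^sub>m 0)" for d
    by (intro eq_matI) auto
  moreover have "unitary 0 (1\<^sub>m 0)" by (rule unitaryI) auto
  ultimately show ?case by blast
next
  case (Suc n)
  let ?N = "Suc n"
  have X: "X \<in> carrier_mat ?N ?N" "mat_adjoint X = X" using Suc.prems unfolding hermitian_mat_def by auto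
  obtain v e where v: "v \<in> carrier_vec ?N" "v \<noteq> 0\<^sub>v ?N" "X *\<^sub>v v = e \<cdot>\<^sub>v v"
    using unit_eigenvector[OF X(1)] by auto
  obtain W c where W: "W \<in> carrier_mat ?N ?N" "mat_adjoint W * W = 1\<^sub>m ?N"
      "W * mat_adjoint W = 1\<^sub>m ?N" "col W 0 = c \<cdot>\<^sub>v v"
    using unitary_with_first_column[OF v(1,2)] by metis
  have aW: "mat_adjoint W \<in> carrier_mat ?N ?N" using W by simp
  define Y where "Y = mat_adjoint W * X * W"
  have Y: "Y \<in> carrier_mat ?N ?N" unfolding Y_def using W X aW by simp
  have hY: "mat_adjoint Y = Y"
    using hermitian_cong[OF aW, of X] Suc.prems W unfolding Y_def hermitian_mat_def by auto
  have XY: "X = W * Y * mat_adjoint W"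
  proof -
    have "W * Y * mat_adjoint W = (W * mat_adjoint W) * X * (W * mat_adjoint W)"
      unfolding Y_def using W(1) aW X(1) by (simp add: assoc_mult_mat[of _ ?N ?N _ ?N _ ?N])
    then show ?thesis using W X by simp
  qed
  have W0: "col W 0 \<in> carrier_vec ?N" using col_dim[of W 0] W(1) by simp
  have Xc: "X *\<^sub>v col W 0 = e \<cdot>\<^sub>v col W 0"
    using v X unfolding W(4) by (simp add: mult_mat_vec smult_smult_assoc ac_simps)
  have Y0: "Y $$ (i, 0) = (if i = 0 then e else 0)" if "i < ?N" for i
  proof -
    have "col Y 0 = (mat_adjoint W * X) *\<^sub>v col W 0"
      unfolding Y_def by (rule col_mult2[of _ ?N ?N _ ?N]) (use W(1) aW X(1) in auto)
    also have "\<dots> = mat_adjoint W *\<^sub>v (X *\<^sub>v col W 0)"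
      by (rule assoc_mult_mat_vec[of _ ?N ?N _ ?N]) (use W(1) aW X(1) W0 in auto)
    also have "\<dots> = e \<cdot>\<^sub>v (mat_adjoint W *\<^sub>v col W 0)"
      unfolding Xc using aW W0 by (rule mult_mat_vec)
    also have "mat_adjoint W *\<^sub>v col W 0 = col (mat_adjoint W * W) 0"
      using W(1) aW by (simp add: col_mult2[of _ ?N ?N _ ?N])
    finally have "col Y 0 = e \<cdot>\<^sub>v col (1\<^sub>m ?N) 0" unfolding W(2) .
    then have "col Y 0 $ i = (e \<cdot>\<^sub>v col (1\<^sub>m ?N) 0) $ i" by simp
    then show ?thesis using that Y by (simp split: if_splits)
  qed
  have Y0': "Y $$ (0, i) = (if i = 0 then e else 0)" if "i < ?N" for i
  proof -
    have "Y $$ (0,i) = cnj (Y $$ (i,0))"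
      using adj_index[of 0 Y i] that Y hY by (metis carrier_matD zero_less_Suc)
    moreover have "Y $$ (0,0) = cnj (Y $$ (0,0))"
      using adj_index[of 0 Y 0] Y hY by (metis carrier_matD zero_less_Suc)
    ultimately show ?thesis using Y0[OF that] Y0[of 0] by (auto split: if_splits)
  qed
  have e: "e = complex_of_real (Re e)"
    using Y0[of 0] adj_index[of 0 Y 0] Y hY
    by (metis Reals_cnj_iff carrier_matD of_real_Re zero_less_Suc)
  define Z where "Z = Matrix.mat n n (\<lambda>(i,j). Y $$ (Suc i, Suc j))"
  have "hermitian_mat n Z"
    unfolding hermitian_mat_def
  proof
    show "mat_adjoint Z = Z"
    proof (rule eq_matI)
      fix i j assume "i < dim_row Z" "j < dim_col Z"
      then have "i < n" "j < n" unfolding Z_def by auto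
      then show "mat_adjoint Z $$ (i,j) = Z $$ (i,j)"
        using adj_index[of "Suc i" Y "Suc j"] Y hY unfolding Z_def by simp
    qed (auto simp: Z_def)
  qed (auto simp: Z_def)
  then obtain V d where V: "unitary n V" and Z: "Z = V * mat_diag n (\<lambda>i. complex_of_real (d i)) * mat_adjoint V"
    using Suc.IH by blast
  have Vc: "V \<in> carrier_mat n n" using V unfolding unitary_def by auto
  \<comment> \<open>\<open>V'\<close> is the block sum of 1 and V.\<close>
  define V' where "V' = Matrix.mat ?N ?N (\<lambda>(i,j). if i = 0 \<or> j = 0 then (if i = j then 1 else 0) else V $$ (i-1,j-1))"
  define d' where "d' i = (if i = 0 then Re e else d (i-1))" for i
  have V': "V' \<in> carrier_mat ?N ?N" unfolding V'_def by simp
  \<comment> \<open>f stays arbitrary because the formula serves twice: with \<open>d'\<close> for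
    the diagonalization and with the constant 1 for the unitarity of \<open>V'\<close>.\<close>
  have idx: "(V' * mat_diag ?N f * mat_adjoint V') $$ (i,j) =
      (if i = 0 \<or> j = 0 then (if i = j then f 0 else 0) else (V * mat_diag n (\<lambda>i. f (Suc i)) * mat_adjoint V) $$ (i-1,j-1))"
    if "i < ?N" "j < ?N" for i j f
  proof -
    have "(V' * mat_diag ?N f * mat_adjoint V') $$ (i,j) = (\<Sum>k<Suc n. V' $$ (i,k) * f k * cnj (V' $$ (j,k)))"
      by (rule diag_cong_index[OF V' that])
    also have "\<dots> = V' $$ (i,0) * f 0 * cnj (V' $$ (j,0)) + (\<Sum>k<n. V' $$ (i,Suc k) * f (Suc k) * cnj (V' $$ (j,Suc k)))"
      by (simp only: sum.lessThan_Suc_shift)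
    also have "\<dots> = (if i = 0 \<or> j = 0 then (if i = j then f 0 else 0) else
        (\<Sum>k<n. V $$ (i-1,k) * f (Suc k) * cnj (V $$ (j-1,k))))"
      using that unfolding V'_def by auto
    finally have A: "(V' * mat_diag ?N f * mat_adjoint V') $$ (i,j) = \<dots>" .
    have "(\<Sum>k<n. V $$ (i-1,k) * f (Suc k) * cnj (V $$ (j-1,k))) =
        (V * mat_diag n (\<lambda>i. f (Suc i)) * mat_adjoint V) $$ (i-1,j-1)" if "\<not> (i = 0 \<or> j = 0)"
      using that \<open>i < ?N\<close> \<open>j < ?N\<close> by (subst diag_cong_index[OF Vc]) auto
    then show ?thesis unfolding A by auto
  qed
  have YV: "Y = V' * mat_diag ?N (\<lambda>i. complex_of_real (d' i)) * mat_adjoint V'"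
  proof (rule eq_matI)
    fix i j assume "i < dim_row (V' * mat_diag ?N (\<lambda>i. complex_of_real (d' i)) * mat_adjoint V')"
      "j < dim_col (V' * mat_diag ?N (\<lambda>i. complex_of_real (d' i)) * mat_adjoint V')"
    then have ij: "i < ?N" "j < ?N" using V' by auto
    show "Y $$ (i,j) = (V' * mat_diag ?N (\<lambda>i. complex_of_real (d' i)) * mat_adjoint V') $$ (i,j)"
    proof (cases "i = 0 \<or> j = 0")
      case True then show ?thesis using idx[OF ij] Y0[OF ij(1)] Y0'[OF ij(2)] e ij by (auto simp: d'_def)
    next
      case False
      then have "Y $$ (i,j) = Z $$ (i-1,j-1)" using ij unfolding Z_def by auto
      then show ?thesis using idx[OF ij] False unfolding Z by (simp add: d'_def)
    qed
  qed (use Y V' in auto)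
  have "V' * mat_adjoint V' = 1\<^sub>m ?N"
  proof -
    have "V' * mat_adjoint V' = V' * mat_diag ?N (\<lambda>i. 1) * mat_adjoint V'" using V' by simp
    also have "\<dots> = 1\<^sub>m ?N"
    proof (rule eq_matI)
      fix i j assume "i < dim_row (1\<^sub>m ?N :: complex mat)" "j < dim_col (1\<^sub>m ?N :: complex mat)"
      then have ij: "i < ?N" "j < ?N" by auto
      have "V * mat_diag n (\<lambda>i. 1) * mat_adjoint V = 1\<^sub>m n" using V unfolding unitary_def by auto
      then show "(V' * mat_diag ?N (\<lambda>i. 1) * mat_adjoint V') $$ (i,j) = 1\<^sub>m ?N $$ (i,j)"
        using idx[OF ij, of "\<lambda>_. 1"] ij by auto
    qed (use V' in auto)
    finally show ?thesis .
  qed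
  then have UV': "unitary ?N V'"
    using V' mat_mult_left_right_inverse[of V' ?N "mat_adjoint V'"] unfolding unitary_def by simp
  have "unitary ?N (W * V')" using W UV' by (intro unitary_mult) (auto simp: unitary_def)
  moreover have "X = (W * V') * mat_diag ?N (\<lambda>i. complex_of_real (d' i)) * mat_adjoint (W * V')"
    unfolding XY YV using W(1) V' aW
    by (simp add: adj_mult[of _ ?N ?N _ ?N] assoc_mult_mat[of _ ?N ?N _ ?N _ ?N])
  ultimately show ?case by blast
qed

text \<open>At column i of U the form of X takes the value \<open>d i\<close>.\<close>

lemma pd_diag_pos:
  assumes "pd_mat n X" "unitary n U" "X = U * mat_diag n (\<lambda>i. complex_of_real (d i)) * mat_adjoint U" "i < n"
  shows "0 < d i"
proof -
  have U: "U \<in> carrier_mat n n" using assms(2) unfolding unitary_def by auto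
  have u: "mat_adjoint U *\<^sub>v col U i = unit_vec n i"
    using assms U unfolding unitary_def
    by (metis adj_carrier col_mult2 col_one)
  have "col U i \<noteq> 0\<^sub>v n"
  proof
    assume "col U i = 0\<^sub>v n"
    moreover have "mat_adjoint U *\<^sub>v 0\<^sub>v n = 0\<^sub>v n" using U by (intro eq_vecI) auto
    ultimately have "unit_vec n i = (0\<^sub>v n :: complex vec)" using u by simp
    then show False using assms(4) by simp
  qed
  then have "0 < Re (qform X (col U i))"
    using assms(1) U unfolding pd_mat_def by auto
  also have "qform X (col U i) = qform (mat_diag n (\<lambda>i. complex_of_real (d i))) (unit_vec n i)"
    unfolding assms(3) using U by (subst qform_cong[of _ n n]) (auto simp: u)
  also have "\<dots> = complex_of_real (d i)"
  proof -
    have "\<dots> = (\<Sum>k<n. if k = i then complex_of_real (d i) else 0)"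
      unfolding qform_diag[OF unit_vec_carrier] by (intro sum.cong) (auto simp: unit_vec_def)
    then show ?thesis using assms(4) by simp
  qed
  finally show ?thesis by simp
qed

text \<open>Congruence by a square root of P turns P into the identity, and a unitary that
  diagonalizes the transformed Q leaves that identity alone. The inverse T is returned too, since
  its adjoint supplies test vectors later.\<close>

lemma simultaneous_diagonalization:
  assumes "pd_mat n P" "hermitian_mat n Q"
  obtains S T d where "S \<in> carrier_mat n n" "T \<in> carrier_mat n n" "S * T = 1\<^sub>m n" "T * S = 1\<^sub>m n"
    "P = S * mat_adjoint S" "Q = S * mat_diag n (\<lambda>i. complex_of_real (d i)) * mat_adjoint S"
proof -
  note as = assoc_mult_mat[of _ n n _ n _ n]
  obtain U p where U: "unitary n U" and P: "P = U * mat_diag n (\<lambda>i. complex_of_real (p i)) * mat_adjoint U"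
    using hermitian_spectral assms(1) unfolding pd_mat_def by blast
  have Uc: "U \<in> carrier_mat n n" and UU: "U * mat_adjoint U = 1\<^sub>m n" "mat_adjoint U * U = 1\<^sub>m n"
    using U unfolding unitary_def by auto
  have p: "0 < p i" if "i < n" for i using pd_diag_pos[OF assms(1) U P that] .
  define D where "D = mat_diag n (\<lambda>i. complex_of_real (sqrt (p i)))"
  define E where "E = mat_diag n (\<lambda>i. complex_of_real (1 / sqrt (p i)))"
  have Dc: "D \<in> carrier_mat n n" "E \<in> carrier_mat n n" unfolding D_def E_def by auto
  have adjs: "mat_adjoint D = D" "mat_adjoint E = E" unfolding D_def E_def by (simp_all add: adj_diag)
  have DE: "D * E = 1\<^sub>m n" "E * D = 1\<^sub>m n" "D * D = mat_diag n (\<lambda>i. complex_of_real (p i))"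
    unfolding D_def E_def mat_diag_diag mat_diag_one[symmetric]
    by (auto intro!: mat_diag_cong simp del: mat_diag_one simp flip: of_real_mult dest!: p)
  define S0 where "S0 = U * D"
  define T0 where "T0 = E * mat_adjoint U"
  have c0: "S0 \<in> carrier_mat n n" "T0 \<in> carrier_mat n n" unfolding S0_def T0_def using Uc Dc by auto
  have "S0 * T0 = U * (D * E) * mat_adjoint U"
    unfolding S0_def T0_def using Uc Dc by (simp add: as)
  then have ST0: "S0 * T0 = 1\<^sub>m n" using DE UU Uc by simp
  then have TS0: "T0 * S0 = 1\<^sub>m n" using mat_mult_left_right_inverse c0 by blast
  have P0: "P = S0 * mat_adjoint S0"
    unfolding P DE(3)[symmetric] S0_def using Uc Dc by (simp add: as adj_mult[of _ n n _ n] adjs)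
  have "hermitian_mat n (T0 * Q * mat_adjoint T0)" using hermitian_cong[OF c0(2) assms(2)] .
  then obtain V d where V: "unitary n V"
      and Q: "T0 * Q * mat_adjoint T0 = V * mat_diag n (\<lambda>i. complex_of_real (d i)) * mat_adjoint V"
    using hermitian_spectral by blast
  have Vc: "V \<in> carrier_mat n n" and VV: "V * mat_adjoint V = 1\<^sub>m n" "mat_adjoint V * V = 1\<^sub>m n"
    using V unfolding unitary_def by auto
  have Qc: "Q \<in> carrier_mat n n" using assms(2) unfolding hermitian_mat_def by auto
  let ?S = "S0 * V" and ?T = "mat_adjoint V * T0"
  have "?S * ?T = S0 * (V * mat_adjoint V) * T0" using c0 Vc by (simp add: as)
  then have ST: "?S * ?T = 1\<^sub>m n" using VV ST0 c0 by simp
  have PS: "P = ?S * mat_adjoint ?S"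
  proof -
    have "?S * mat_adjoint ?S = S0 * (V * mat_adjoint V) * mat_adjoint S0"
      using c0 Vc by (simp add: as adj_mult[of _ n n _ n])
    then show ?thesis using VV c0 P0 by simp
  qed
  have aST: "mat_adjoint T0 * mat_adjoint S0 = 1\<^sub>m n"
    using ST0 c0 adj_mult[of S0 n n T0 n] by simp
  have "?S * mat_diag n (\<lambda>i. complex_of_real (d i)) * mat_adjoint ?S =
      S0 * (V * mat_diag n (\<lambda>i. complex_of_real (d i)) * mat_adjoint V) * mat_adjoint S0"
    using c0 Vc by (simp add: as adj_mult[of _ n n _ n])
  also have "\<dots> = (S0 * T0) * Q * (mat_adjoint T0 * mat_adjoint S0)"
    unfolding Q[symmetric] using c0 Qc by (simp add: as)
  finally have QS: "Q = ?S * mat_diag n (\<lambda>i. complex_of_real (d i)) * mat_adjoint ?S"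
    using ST0 aST Qc by simp
  have TS: "?T * ?S = 1\<^sub>m n" using mat_mult_left_right_inverse[OF _ _ ST] c0 Vc by simp
  show ?thesis by (rule that[OF _ _ ST TS PS QS]) (use c0 Vc in auto)
qed

section \<open>Interlacing spectra\<close>

text \<open>\<open>herm_calc\<close> selects some diagonalization, so the point is independence of
  it. For two of them \<open>W = mat_adjoint V * U\<close> intertwines diag d with diag e, that is,
  W_ij (d_j - e_i) = 0. Where W_ij is nonzero the eigenvalues agree, so W intertwines g(d) with g(e)
  as well.\<close>

lemma herm_calc_eq:
  assumes U: "unitary n U" and d: "\<And>i. i < n \<Longrightarrow> 0 < d i"
    and X: "X = U * mat_diag n (\<lambda>i. complex_of_real (d i)) * mat_adjoint U"
  shows "herm_calc n g X = U * mat_diag n (\<lambda>i. complex_of_real (g (d i))) * mat_adjoint U"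
proof -
  note as = assoc_mult_mat[of _ n n _ n _ n]
  have Uc: "U \<in> carrier_mat n n" "U * mat_adjoint U = 1\<^sub>m n" "mat_adjoint U * U = 1\<^sub>m n"
    using U unfolding unitary_def by auto
  define Q where "Q F \<longleftrightarrow> (\<exists>U d. U \<in> carrier_mat n n \<and> U * mat_adjoint U = 1\<^sub>m n \<and>
      (\<forall>i<n. 0 < d i) \<and> X = U * mat_diag n (\<lambda>i. complex_of_real (d i)) * mat_adjoint U \<and>
      F = U * mat_diag n (\<lambda>i. complex_of_real (g (d i))) * mat_adjoint U)" for F
  have "Q (herm_calc n g X)"
  proof -
    have "Q (U * mat_diag n (\<lambda>i. complex_of_real (g (d i))) * mat_adjoint U)"
      unfolding Q_def using Uc d X by blast
    then show ?thesis unfolding herm_calc_def Q_def by (rule someI)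
  qed
  then obtain V e where V: "V \<in> carrier_mat n n" "V * mat_adjoint V = 1\<^sub>m n"
    and XV: "X = V * mat_diag n (\<lambda>i. complex_of_real (e i)) * mat_adjoint V"
    and F: "herm_calc n g X = V * mat_diag n (\<lambda>i. complex_of_real (g (e i))) * mat_adjoint V"
    unfolding Q_def by auto
  have V': "mat_adjoint V * V = 1\<^sub>m n" using mat_mult_left_right_inverse[OF V(1) _ V(2)] V(1) by simp
  define W where "W = mat_adjoint V * U"
  have Wc: "W \<in> carrier_mat n n" unfolding W_def using V Uc by simp
  have "W * mat_diag n (\<lambda>i. complex_of_real (d i)) = mat_adjoint V * X * U"
  proof -
    have "mat_adjoint V * X * U = mat_adjoint V * (U * mat_diag n (\<lambda>i. complex_of_real (d i))) * (mat_adjoint U * U)"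
      unfolding X using Uc(1) V(1) by (simp add: as)
    then show ?thesis unfolding W_def using Uc V(1) by (simp add: as right_mult_one_mat[of _ n n])
  qed
  also have "\<dots> = mat_diag n (\<lambda>i. complex_of_real (e i)) * W"
  proof -
    have "mat_adjoint V * X * U = (mat_adjoint V * V) * mat_diag n (\<lambda>i. complex_of_real (e i)) * (mat_adjoint V * U)"
      unfolding XV using Uc(1) V(1) by (simp add: as)
    then show ?thesis unfolding W_def using V' Uc(1) V(1) by (simp add: as left_mult_one_mat[of _ n n])
  qed
  finally have eq: "W * mat_diag n (\<lambda>i. complex_of_real (d i)) = mat_diag n (\<lambda>i. complex_of_real (e i)) * W" .
  have "W * mat_diag n (\<lambda>i. complex_of_real (g (d i))) = mat_diag n (\<lambda>i. complex_of_real (g (e i))) * W"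
  proof (rule eq_matI)
    fix i j assume "i < dim_row (mat_diag n (\<lambda>i. complex_of_real (g (e i))) * W)"
      "j < dim_col (mat_diag n (\<lambda>i. complex_of_real (g (e i))) * W)"
    then have ij: "i < n" "j < n" using Wc by (auto simp: mat_diag_def)
    have "W $$ (i,j) * d j = e i * W $$ (i,j)"
      using arg_cong[OF eq, of "\<lambda>M. M $$ (i,j)"] ij Wc
      by (simp add: mat_diag_mult_left[OF Wc] mat_diag_mult_right[OF Wc])
    then have "W $$ (i,j) = 0 \<or> d j = e i" by (simp add: mult.commute)
    then show "(W * mat_diag n (\<lambda>i. complex_of_real (g (d i)))) $$ (i,j) =
        (mat_diag n (\<lambda>i. complex_of_real (g (e i))) * W) $$ (i,j)"
      using ij by (auto simp: mat_diag_mult_left[OF Wc] mat_diag_mult_right[OF Wc])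
  qed (use Wc in \<open>auto simp: mat_diag_def\<close>)
  then have "V * (W * mat_diag n (\<lambda>i. complex_of_real (g (d i)))) * mat_adjoint U
      = V * (mat_diag n (\<lambda>i. complex_of_real (g (e i))) * W) * mat_adjoint U" by simp
  also have "\<dots> = V * mat_diag n (\<lambda>i. complex_of_real (g (e i))) * mat_adjoint V * (U * mat_adjoint U)"
    unfolding W_def using V(1) Uc(1) by (simp add: as)
  also have "\<dots> = herm_calc n g X" unfolding F using V(1) Uc by simp
  also have "V * (W * mat_diag n (\<lambda>i. complex_of_real (g (d i)))) * mat_adjoint U
      = (V * mat_adjoint V) * (U * mat_diag n (\<lambda>i. complex_of_real (g (d i))) * mat_adjoint U)"
    unfolding W_def using V(1) Uc(1) by (simp add: as)
  finally show ?thesis using V Uc(1) by simp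
qed

lemma hermitian_diag: "hermitian_mat n (mat_diag n (\<lambda>i. complex_of_real (d i)))"
  unfolding hermitian_mat_def by (simp add: adj_diag)

lemma pd_unitary_diag:
  assumes U: "unitary n U" and d: "\<And>i. i < n \<Longrightarrow> 0 < d i"
  shows "pd_mat n (U * mat_diag n (\<lambda>i. complex_of_real (d i)) * mat_adjoint U)"
  unfolding pd_mat_def
proof (intro conjI ballI impI)
  have Uc: "U \<in> carrier_mat n n" "U * mat_adjoint U = 1\<^sub>m n"
    using U unfolding unitary_def by auto
  show "hermitian_mat n (U * mat_diag n (\<lambda>i. complex_of_real (d i)) * mat_adjoint U)"
    by (rule hermitian_cong[OF Uc(1) hermitian_diag])
  fix x :: "complex vec" assume x: "x \<in> carrier_vec n" "x \<noteq> 0\<^sub>v n"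
  define y where "y = mat_adjoint U *\<^sub>v x"
  have y: "y \<in> carrier_vec n" unfolding y_def by (rule mult_mat_vec_carrier[of _ n n]) (use Uc x in auto)
  have "U *\<^sub>v y = (U * mat_adjoint U) *\<^sub>v x"
    unfolding y_def by (rule assoc_mult_mat_vec[symmetric, of _ n n _ n]) (use Uc x in auto)
  then have Uy: "U *\<^sub>v y = x" using Uc x by simp
  have "U *\<^sub>v 0\<^sub>v n = 0\<^sub>v n" using Uc by (intro eq_vecI) auto
  then have "y \<noteq> 0\<^sub>v n" using Uy x by auto
  then obtain i where i: "i < n" "y $ i \<noteq> 0" using y by (metis eq_vecI carrier_vecD index_zero_vec)
  have "0 < (\<Sum>i<n. d i * (cmod (y $ i))\<^sup>2)"
    using i d by (intro sum_pos2[of _ i]) (auto intro!: mult_nonneg_nonneg less_imp_le[OF d])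
  also have "\<dots> = Re (qform (U * mat_diag n (\<lambda>i. complex_of_real (d i)) * mat_adjoint U) x)"
    using Uc x by (subst qform_cong[of _ n n]) (auto simp: qform_diag[OF y] simp flip: y_def)
  finally show "0 < Re (qform (U * mat_diag n (\<lambda>i. complex_of_real (d i)) * mat_adjoint U) x)" .
qed

section \<open>Partial fractions over interlacing nodes\<close>

text \<open>Lagrange interpolation divided by the nodal polynomial. The degree condition is stated
  by coefficients so that n = 0 forces r = 0.\<close>

lemma lagrange_partial_fractions:
  fixes x :: "nat \<Rightarrow> real"
  assumes inj: "inj_on x {..<n}" and deg: "\<And>k. k \<ge> n \<Longrightarrow> coeff r k = 0"
    and z: "\<And>i. i < n \<Longrightarrow> z \<noteq> x i"
  shows "(\<Sum>i<n. poly r (x i) / ((\<Prod>j\<in>{..<n}-{i}. x i - x j) * (z - x i))) = poly r z / (\<Prod>i<n. z - x i)"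
proof (cases "n = 0")
  case True
  then have "r = 0" using deg by (intro poly_eqI) auto
  then show ?thesis using True by simp
next
  case False
  have dr: "degree r < n" using deg False by (metis gr0I leading_coeff_0_iff degree_0 leI)
  define q where "q i = (\<Prod>j\<in>{..<n}-{i}. x i - x j)" for i
  define L where "L = (\<Sum>i<n. Polynomial.smult (poly r (x i) / q i) (\<Prod>j\<in>{..<n}-{i}. [:- x j, 1:]))"
  have q0: "q i \<noteq> 0" if "i < n" for i
    using inj that unfolding q_def inj_on_def by auto
  have "degree L \<le> n - 1"
    unfolding L_def
  proof (intro degree_sum_le)
    fix i assume "i \<in> {..<n}"
    then have "degree (\<Prod>j\<in>{..<n}-{i}. [:- x j, 1:]) \<le> n - 1"
      using degree_prod_sum_le[of "{..<n}-{i}" "\<lambda>j. [:- x j, 1:]"] by (simp add: card_Diff_singleton)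
    then show "degree (Polynomial.smult (poly r (x i) / q i) (\<Prod>j\<in>{..<n}-{i}. [:- x j, 1:])) \<le> n - 1"
      using degree_smult_le order_trans by blast
  qed simp
  then have dL: "degree L < n" using False by simp
  have "L = r"
  proof (rule poly_eqI_degree[of "x ` {..<n}"])
    fix u assume "u \<in> x ` {..<n}"
    then obtain k where k: "k < n" "u = x k" by auto
    have "poly L u = (\<Sum>i<n. poly r (x i) / q i * (\<Prod>j\<in>{..<n}-{i}. x k - x j))"
      unfolding L_def k by (simp add: poly_sum poly_prod)
    also have "\<dots> = (\<Sum>i<n. if i = k then poly r (x k) else 0)"
    proof (rule sum.cong)
      fix i assume i: "i \<in> {..<n}"
      show "poly r (x i) / q i * (\<Prod>j\<in>{..<n}-{i}. x k - x j) = (if i = k then poly r (x k) else 0)"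
      proof (cases "i = k")
        case True then show ?thesis using q0[of k] k unfolding q_def by simp
      next
        case False
        then have "(\<Prod>j\<in>{..<n}-{i}. x k - x j) = 0" using k by (intro prod_zero) auto
        then show ?thesis using False by simp
      qed
    qed simp
    also have "\<dots> = poly r u" using k by simp
    finally show "poly L u = poly r u" .
  qed (use dL dr inj in \<open>auto simp: card_image\<close>)
  have "poly r (x i) / (q i * (z - x i)) = (poly r (x i) / q i * (\<Prod>j\<in>{..<n}-{i}. z - x j)) / (\<Prod>i<n. z - x i)"
    if i: "i < n" for i
  proof -
    have "(\<Prod>j<n. z - x j) = (z - x i) * (\<Prod>j\<in>{..<n}-{i}. z - x j)"
      using i by (simp add: prod.remove[of _ i])
    moreover have "(\<Prod>j\<in>{..<n}-{i}. z - x j) \<noteq> 0" using z by auto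
    ultimately show ?thesis by simp
  qed
  then have "(\<Sum>i<n. poly r (x i) / (q i * (z - x i)))
      = (\<Sum>i<n. (poly r (x i) / q i * (\<Prod>j\<in>{..<n}-{i}. z - x j)) / (\<Prod>i<n. z - x i))"
    by (intro sum.cong) auto
  also have "\<dots> = poly L z / (\<Prod>i<n. z - x i)"
    unfolding L_def by (simp add: poly_sum poly_prod sum_divide_distrib)
  finally show ?thesis unfolding \<open>L = r\<close> q_def .
qed

lemma coeff_prod_monic:
  "coeff (\<Prod>i<n. [:- x i, 1 :: real:]) n = 1" "k > n \<Longrightarrow> coeff (\<Prod>i<n. [:- x i, 1:]) k = 0"
proof -
  have d: "degree (\<Prod>i<n. [:- x i, 1 :: real:]) = n"
    by (simp add: degree_prod_eq_sum_degree)
  have "lead_coeff (\<Prod>i<n. [:- x i, 1 :: real:]) = 1"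
    by (simp add: lead_coeff_prod)
  then show "coeff (\<Prod>i<n. [:- x i, 1 :: real:]) n = 1" by (simp only: d)
  show "k > n \<Longrightarrow> coeff (\<Prod>i<n. [:- x i, 1:]) k = 0" using d by (intro coeff_eq_0) simp
qed

text \<open>The extremal rank-one perturbation with prescribed interlacing spectra: with
  \<open>a\<^sub>i = -P(x\<^sub>i)/Q'(x\<^sub>i)\<close> and \<open>b\<^sub>j = Q(y\<^sub>j)/P'(y\<^sub>j)\<close>, where \<open>P, Q\<close> are the monic polynomials with
  roots \<open>y\<close> and \<open>x\<close>, the Cauchy matrix \<open>sqrt (a\<^sub>i b\<^sub>j) / (y\<^sub>j - x\<^sub>i)\<close> is orthogonal and diagonalizes
  \<open>diag x + sqrt a (sqrt a)\<^sup>T\<close>, whose spectrum is \<open>y\<close>.\<close>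
lemma operator_monotone_interlacing:
  fixes x y :: "nat \<Rightarrow> real"
  assumes g: "operator_monotone g"
    and pos: "\<And>i. i < n \<Longrightarrow> 0 < x i"
    and xy: "\<And>i j. i \<le> j \<Longrightarrow> j < n \<Longrightarrow> x i < y j"
    and yx: "\<And>i j. i < j \<Longrightarrow> j < n \<Longrightarrow> y i < x j"
    and deg: "\<And>k. k \<ge> n \<Longrightarrow> coeff r k = 0"
  defines "P' \<equiv> \<lambda>j. \<Prod>l\<in>{..<n}-{j}. y j - y l" and "Q' \<equiv> \<lambda>i. \<Prod>l\<in>{..<n}-{i}. x i - x l"
    and "P \<equiv> \<lambda>i. \<Prod>j<n. x i - y j" and "Q \<equiv> \<lambda>j. \<Prod>i<n. y j - x i"
  shows "0 \<le> (\<Sum>i<n. (poly r (x i))\<^sup>2 * g (x i) / (P i * Q' i)) + (\<Sum>j<n. (poly r (y j))\<^sup>2 * g (y j) / (Q j * P' j))"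
proof -
  have xx: "x i < x j" if "i < j" "j < n" for i j using xy[of i i] yx[of i j] that by force
  have yy: "y i < y j" if "i < j" "j < n" for i j using xy[of j j] yx[of i j] that by force
  have injx: "inj_on x {..<n}" using xx by (intro linorder_inj_onI) (force, auto)
  have injy: "inj_on y {..<n}" using yy by (intro linorder_inj_onI) (force, auto)
  have ne: "x i \<noteq> y j" if "i < n" "j < n" for i j using xy[of i j] yx[of j i] that by (cases "i \<le> j") auto
  define a where "a i = - P i / Q' i" for i
  define b where "b j = Q j / P' j" for j
  \<comment> \<open>Factor i pairs off as y_i - x_i > 0. For every other l, interlacing puts x_l and
    y_l on the same side of x_i, so the remaining quotients are positive.\<close>
  have a: "0 < a i" if i: "i < n" for i
  proof -
    have "P i = (x i - y i) * (\<Prod>l\<in>{..<n}-{i}. x i - y l)"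
      unfolding P_def using i by (simp add: prod.remove[of _ i])
    then have "a i = (y i - x i) * (\<Prod>l\<in>{..<n}-{i}. (x i - y l) / (x i - x l))"
      unfolding a_def Q'_def prod_dividef times_divide_eq_right minus_divide_left[symmetric]
      by (metis minus_diff_eq minus_divide_left mult_minus_left)
    moreover have "0 < (x i - y l) / (x i - x l)" if "l \<in> {..<n}-{i}" for l
      using that i xx[of l i] xx[of i l] xy[of i l] yx[of l i]
      by (cases "l < i") (simp_all add: zero_less_divide_iff)
    ultimately show ?thesis using xy[of i i] i by (auto intro!: mult_pos_pos prod_pos)
  qed
  have b: "0 < b j" if j: "j < n" for j
  proof -
    have "Q j = (y j - x j) * (\<Prod>l\<in>{..<n}-{j}. y j - x l)"
      unfolding Q_def using j by (simp add: prod.remove[of _ j])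
    then have "b j = (y j - x j) * (\<Prod>l\<in>{..<n}-{j}. (y j - x l) / (y j - y l))"
      unfolding b_def P'_def prod_dividef by simp
    moreover have "0 < (y j - x l) / (y j - y l)" if "l \<in> {..<n}-{j}" for l
      using that j yy[of l j] yy[of j l] xy[of l j] yx[of j l]
      by (cases "l < j") (simp_all add: zero_less_divide_iff)
    ultimately show ?thesis using xy[of j j] j by (auto intro!: mult_pos_pos prod_pos)
  qed
  have Q'0: "Q' i \<noteq> 0" if "i < n" for i using injx that unfolding Q'_def inj_on_def by auto
  have P'0: "P' i \<noteq> 0" if "i < n" for i using injy that unfolding P'_def inj_on_def by auto
  have Q0: "Q j \<noteq> 0" if "j < n" for j using ne that unfolding Q_def by (fastforce dest: sym)
  have P0: "P j \<noteq> 0" if "j < n" for j using ne that unfolding P_def by auto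
  have lagx: "(\<Sum>i<n. poly s (x i) / (Q' i * (y j - x i))) = poly s (y j) / Q j"
    if "j < n" "\<And>k. k \<ge> n \<Longrightarrow> coeff s k = 0" for s j
    unfolding Q'_def Q_def using lagrange_partial_fractions[OF injx that(2)] ne that(1) by force
  have lagy: "(\<Sum>j<n. poly s (y j) / (P' j * (x i - y j))) = poly s (x i) / P i"
    if "i < n" "\<And>k. k \<ge> n \<Longrightarrow> coeff s k = 0" for s i
    unfolding P'_def P_def using lagrange_partial_fractions[OF injy that(2)] ne that(1) by force
  define u where "u i j = sqrt (a i * b j) / (y j - x i)" for i j
  have orth: "(\<Sum>i<n. u i j * u i l) = (if j = l then 1 else 0)" if j: "j < n" and l: "l < n" for j l
  proof -
    \<comment> \<open>The nodal polynomial of y without its factor at \<open>y j\<close>. Its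
      partial fractions over the x nodes, evaluated at \<open>y l\<close>, give the inner product of
      columns j and l, and s vanishes at every \<open>y l\<close> with l different from j.\<close>
    define s where "s = (\<Prod>k\<in>{..<n}-{j}. [:- y k, 1:])"
    have ds: "coeff s k = 0" if "k \<ge> n" for k
    proof (rule coeff_eq_0)
      have "degree s \<le> n - 1" unfolding s_def
        using degree_prod_sum_le[of "{..<n}-{j}" "\<lambda>j. [:- y j, 1:]"] j by (simp add: card_Diff_singleton)
      then show "degree s < k" using that j by simp
    qed
    have sx: "a i = poly s (x i) * (y j - x i) / Q' i" for i
    proof -
      have "P i = (x i - y j) * poly s (x i)"
        unfolding P_def s_def poly_prod using j by (simp add: prod.remove[of _ j])
      then have "- P i = poly s (x i) * (y j - x i)" by (simp add: algebra_simps)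
      then show ?thesis unfolding a_def by simp
    qed
    have "(\<Sum>i<n. u i j * u i l) = (\<Sum>i<n. sqrt (b j * b l) * (poly s (x i) / (Q' i * (y l - x i))))"
    proof (rule sum.cong)
      fix i assume "i \<in> {..<n}"
      then have i: "i < n" by simp
      have "u i j * u i l = a i * sqrt (b j * b l) / ((y j - x i) * (y l - x i))"
        unfolding u_def using a[OF i] b[OF j] b[OF l] by (simp add: real_sqrt_mult)
      then show "u i j * u i l = sqrt (b j * b l) * (poly s (x i) / (Q' i * (y l - x i)))"
      proof -
        have *: "(p * w / c) * q / (w * v) = q * (p / (c * v))" if "w \<noteq> 0" for p w c q v :: real
          using that by simp
        assume "u i j * u i l = a i * sqrt (b j * b l) / ((y j - x i) * (y l - x i))"
        then show ?thesis unfolding sx using ne[OF i j] by (subst (asm) *) auto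
      qed
    qed simp
    also have "\<dots> = sqrt (b j * b l) * (poly s (y l) / Q l)"
      using lagx[of l s, OF l ds] by (simp only: sum_distrib_left[symmetric])
    also have "\<dots> = (if j = l then 1 else 0)"
    proof (cases "j = l")
      case True
      have 1: "poly s (y l) = P' l" unfolding s_def P'_def True poly_prod by simp
      have 2: "sqrt (b j * b l) = b l" using b[OF l] True by simp
      have "sqrt (b j * b l) * (poly s (y l) / Q l) = b l * (P' l / Q l)" unfolding 1 2 ..
      also have "\<dots> = 1" unfolding b_def using P'0[OF l] Q0[OF l] by simp
      finally show ?thesis unfolding if_P[OF True] .
    next
      case False
      then have "poly s (y l) = 0" unfolding s_def poly_prod using l by (auto intro!: prod_zero)
      then show ?thesis using False by simp
    qed
    finally show ?thesis .
  qed
  define U where "U = Matrix.mat n n (\<lambda>(i,j). complex_of_real (u i j))"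
  have Uc: "U \<in> carrier_mat n n" unfolding U_def by simp
  have U: "unitary n U"
  proof (rule unitaryI[OF Uc], rule eq_matI)
    fix i j assume "i < dim_row (1\<^sub>m n :: complex mat)" "j < dim_col (1\<^sub>m n :: complex mat)"
    then have ij: "i < n" "j < n" by auto
    then have "(mat_adjoint U * U) $$ (i,j) = complex_of_real (\<Sum>k<n. u k i * u k j)"
      using Uc by (auto simp: scalar_prod_def atLeast0LessThan U_def intro!: sum.cong)
    then show "(mat_adjoint U * U) $$ (i,j) = 1\<^sub>m n $$ (i,j)" using orth[OF ij] ij by simp
  qed (use Uc in auto)
  have orth': "(\<Sum>j<n. u i j * u k j) = (if i = k then 1 else 0)" if "i < n" "k < n" for i k
  proof -
    have "(U * mat_adjoint U) $$ (i,k) = complex_of_real (\<Sum>j<n. u i j * u k j)"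
      using Uc that by (auto simp: scalar_prod_def atLeast0LessThan U_def intro!: sum.cong)
    moreover have "(U * mat_adjoint U) $$ (i,k) = 1\<^sub>m n $$ (i,k)" using U unfolding unitary_def by simp
    ultimately show ?thesis using that by (metis index_one_mat(1) of_real_0 of_real_1 of_real_eq_iff)
  qed
  have bsum: "(\<Sum>j<n. b j / (y j - x i)) = 1" if i: "i < n" for i
  proof -
    \<comment> \<open>The difference of two monic polynomials of degree n has degree below n; it
      takes the values Q at the y nodes and -P at the x nodes.\<close>
    define s where "s = (\<Prod>i<n. [:- x i, 1:]) - (\<Prod>j<n. [:- y j, 1:])"
    have "coeff s k = 0" if "k \<ge> n" for k
      unfolding s_def using that coeff_prod_monic[where n = n] by (cases "k = n") auto
    then have "(\<Sum>j<n. poly s (y j) / (P' j * (x i - y j))) = poly s (x i) / P i"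
      by (rule lagy[OF i])
    moreover have "poly s (y j) = Q j" if "j < n" for j
      unfolding s_def Q_def poly_diff poly_prod using that by (auto intro!: prod_zero)
    moreover have "poly s (x i) = - P i"
      unfolding s_def P_def poly_diff poly_prod using i by (auto intro!: prod_zero)
    ultimately have "(\<Sum>j<n. Q j / (P' j * (x i - y j))) = -1" using P0[OF i] by simp
    moreover have "Q j / (P' j * (x i - y j)) = - (b j / (y j - x i))" for j
      unfolding b_def by (metis divide_divide_eq_left minus_diff_eq minus_divide_right)
    ultimately show ?thesis by (simp add: sum_negf)
  qed
  define X where "X = mat_diag n (\<lambda>i. complex_of_real (x i))"
  define Y where "Y = U * mat_diag n (\<lambda>i. complex_of_real (y i)) * mat_adjoint U"
  have one: "unitary n (1\<^sub>m n)" by (rule unitaryI) auto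
  have X1: "mat_diag n f = 1\<^sub>m n * mat_diag n f * mat_adjoint (1\<^sub>m n)" for f :: "nat \<Rightarrow> complex"
    by (simp add: left_mult_one_mat[of _ n n] right_mult_one_mat[of _ n n])
  have ypos: "0 < y i" if "i < n" for i using pos[OF that] xy[of i i] that by simp
  have pdX: "pd_mat n X" unfolding X_def by (subst X1, rule pd_unitary_diag[OF one pos])
  have pdY: "pd_mat n Y" unfolding Y_def by (rule pd_unitary_diag[OF U ypos])
  have Xc: "X \<in> carrier_mat n n" and Yc: "Y \<in> carrier_mat n n" using pdX pdY unfolding pd_mat_def hermitian_mat_def by auto
  have YX: "(Y - X) $$ (i,k) = complex_of_real (sqrt (a i) * sqrt (a k))" if ik: "i < n" "k < n" for i k
  proof -
    have "Y $$ (i,k) = complex_of_real (\<Sum>j<n. u i j * y j * u k j)"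
      unfolding Y_def diag_cong_index[OF Uc ik] using ik by (auto simp: U_def intro!: sum.cong)
    \<comment> \<open>Splitting \<open>y j\<close> into \<open>(y j - x k) + x k\<close> cancels one
      Cauchy denominator and leaves \<open>bsum\<close>; the rest is orthogonality of the rows of
      U.\<close>
    also have "(\<Sum>j<n. u i j * y j * u k j) = (\<Sum>j<n. u i j * (y j - x k) * u k j) + x k * (\<Sum>j<n. u i j * u k j)"
      by (simp add: algebra_simps sum_subtractf sum_distrib_left)
    also have "(\<Sum>j<n. u i j * (y j - x k) * u k j) = sqrt (a i) * sqrt (a k) * (\<Sum>j<n. b j / (y j - x i))"
      unfolding sum_distrib_left
    proof (rule sum.cong)
      fix j assume "j \<in> {..<n}"
      then show "u i j * (y j - x k) * u k j = sqrt (a i) * sqrt (a k) * (b j / (y j - x i))"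
        using ne[of k j] b[of j] ik unfolding u_def by (simp add: real_sqrt_mult)
    qed simp
    finally show ?thesis using ik Yc Xc bsum orth' unfolding X_def by (simp add: mat_diag_def)
  qed
  have "loewner_le n X Y"
    unfolding loewner_le_def psd_mat_def
  proof (intro conjI ballI)
    show hX: "hermitian_mat n X" and hY: "hermitian_mat n Y" using pdX pdY unfolding pd_mat_def by auto
    then show "hermitian_mat n (Y - X)"
      unfolding hermitian_mat_def using adj_minus[of Y n n X] by auto
    fix \<xi> :: "complex vec" assume xi: "\<xi> \<in> carrier_vec n"
    define t where "t = (\<Sum>k<n. complex_of_real (sqrt (a k)) * \<xi> $ k)"
    define E where "E = Y - X"
    have E: "E \<in> carrier_mat n n" unfolding E_def using Xc by (rule minus_carrier_mat)
    have "(E *\<^sub>v \<xi>) $ i = complex_of_real (sqrt (a i)) * t" if "i < n" for i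
      using that E xi YX[folded E_def]
      by (auto simp: scalar_prod_def atLeast0LessThan t_def sum_distrib_left mult.assoc intro!: sum.cong)
    then have "qform E \<xi> = (\<Sum>i<n. complex_of_real (sqrt (a i)) * t * cnj (\<xi> $ i))"
      unfolding qform_def using xi E by (subst cscalar_sum[of _ n]) auto
    also have "\<dots> = t * cnj t" unfolding t_def by (simp add: sum_distrib_left sum_distrib_right ac_simps)
    also have "\<dots> = complex_of_real ((cmod t)\<^sup>2)" by (simp only: complex_norm_square)
    finally show "0 \<le> Re (qform (Y - X) \<xi>)" unfolding E_def by simp
  qed
  then have le: "loewner_le n (herm_calc n g X) (herm_calc n g Y)"
    using g pdX pdY unfolding operator_monotone_def by blast
  have gX: "herm_calc n g X = mat_diag n (\<lambda>i. complex_of_real (g (x i)))"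
    unfolding X_def using herm_calc_eq[OF one pos X1, where g = g] by (simp only: X1[symmetric])
  have gY: "herm_calc n g Y = U * mat_diag n (\<lambda>i. complex_of_real (g (y i))) * mat_adjoint U"
    unfolding Y_def by (rule herm_calc_eq[OF U ypos refl])
  \<comment> \<open>The test vector for which partial fractions give component j of U^T e as
    \<open>sqrt (b j) * r (y j) / Q j\<close>. The squares of e and of U^T e then carry exactly the
    weights of the claim.\<close>
  define e where "e i = poly r (x i) / (sqrt (a i) * Q' i)" for i
  define \<xi> where "\<xi> = Matrix.vec n (\<lambda>i. complex_of_real (e i))"
  have xi: "\<xi> \<in> carrier_vec n" unfolding \<xi>_def by simp
  have "0 \<le> Re (qform (herm_calc n g Y - herm_calc n g X) \<xi>)"
    using le xi unfolding loewner_le_def psd_mat_def by auto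
  also have "qform (herm_calc n g Y - herm_calc n g X) \<xi> = qform (herm_calc n g Y) \<xi> - qform (herm_calc n g X) \<xi>"
    using Uc xi unfolding gX gY by (subst qform_minus[of _ n]) auto
  also have "qform (herm_calc n g X) \<xi> = complex_of_real (\<Sum>i<n. g (x i) * (e i)\<^sup>2)"
    unfolding gX qform_diag[OF xi] unfolding \<xi>_def by simp
  also have "qform (herm_calc n g Y) \<xi> = complex_of_real (\<Sum>j<n. g (y j) * (\<Sum>i<n. u i j * e i)\<^sup>2)"
  proof -
    have c: "mat_adjoint U *\<^sub>v \<xi> \<in> carrier_vec n" by (rule mult_mat_vec_carrier[of _ n n]) (use Uc xi in auto)
    define w where "w j = (\<Sum>i<n. u i j * e i)" for j
    have "(mat_adjoint U *\<^sub>v \<xi>) $ j = complex_of_real (w j)" if "j < n" for j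
      using that Uc by (auto simp: w_def scalar_prod_def atLeast0LessThan \<xi>_def U_def intro!: sum.cong)
    then show ?thesis
      unfolding gY using Uc xi by (subst qform_cong[of _ n n]) (auto simp: qform_diag[OF c] simp flip: w_def)
  qed
  finally have main: "0 \<le> (\<Sum>j<n. g (y j) * (\<Sum>i<n. u i j * e i)\<^sup>2) - (\<Sum>i<n. g (x i) * (e i)\<^sup>2)"
    by simp
  have "g (x i) * (e i)\<^sup>2 = - ((poly r (x i))\<^sup>2 * g (x i) / (P i * Q' i))" if i: "i < n" for i
  proof -
    have "(e i)\<^sup>2 = (poly r (x i))\<^sup>2 / (a i * (Q' i)\<^sup>2)"
      unfolding e_def using a[OF i] by (simp add: power_divide power_mult_distrib)
    also have "a i * (Q' i)\<^sup>2 = - (P i * Q' i)" unfolding a_def using Q'0[OF i] by (simp add: power2_eq_square)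
    finally show ?thesis by simp
  qed
  then have 1: "(\<Sum>i<n. g (x i) * (e i)\<^sup>2) = - (\<Sum>i<n. (poly r (x i))\<^sup>2 * g (x i) / (P i * Q' i))"
    by (simp add: sum_negf)
  have "g (y j) * (\<Sum>i<n. u i j * e i)\<^sup>2 = (poly r (y j))\<^sup>2 * g (y j) / (Q j * P' j)" if j: "j < n" for j
  proof -
    have "(\<Sum>i<n. u i j * e i) = (\<Sum>i<n. sqrt (b j) * (poly r (x i) / (Q' i * (y j - x i))))"
    proof (rule sum.cong)
      fix i assume "i \<in> {..<n}"
      then show "u i j * e i = sqrt (b j) * (poly r (x i) / (Q' i * (y j - x i)))"
        using a[of i] unfolding u_def e_def by (simp add: real_sqrt_mult)
    qed simp
    also have "\<dots> = sqrt (b j) * (poly r (y j) / Q j)"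
      using lagx[of j r, OF j deg] by (simp only: sum_distrib_left[symmetric])
    finally have "(\<Sum>i<n. u i j * e i)\<^sup>2 = b j * ((poly r (y j))\<^sup>2 / (Q j)\<^sup>2)"
      using b[OF j] by (simp add: power_mult_distrib power_divide)
    also have "\<dots> = (poly r (y j))\<^sup>2 / (Q j * P' j)"
      unfolding b_def using Q0[OF j] by (simp add: power2_eq_square)
    finally show ?thesis by simp
  qed
  then have 2: "(\<Sum>j<n. g (y j) * (\<Sum>i<n. u i j * e i)\<^sup>2) = (\<Sum>j<n. (poly r (y j))\<^sup>2 * g (y j) / (Q j * P' j))"
    by simp
  show ?thesis using main unfolding 1 2 by simp
qed

section \<open>The dual cone of an operator monotone function\<close>

definition divided_difference :: "real set \<Rightarrow> (real \<Rightarrow> real) \<Rightarrow> real" where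
  "divided_difference F f = (\<Sum>t\<in>F. f t / (\<Prod>u\<in>F-{t}. t - u))"

text \<open>Isolates the contribution of one additional node, which is later moved to 0 or to
  infinity.\<close>

lemma divided_difference_insert:
  assumes "finite F" "e \<notin> F"
  shows "divided_difference (insert e F) f =
    f e / (\<Prod>u\<in>F. e - u) + (\<Sum>t\<in>F. f t / ((t - e) * (\<Prod>u\<in>F-{t}. t - u)))"
proof -
  have "(\<Prod>u\<in>insert e F - {t}. t - u) = (t - e) * (\<Prod>u\<in>F-{t}. t - u)" if "t \<in> F" for t
  proof -
    have "insert e F - {t} = insert e (F - {t})" using that assms by auto
    then show ?thesis using assms by simp
  qed
  moreover have "insert e F - {e} = F" using assms by auto
  ultimately show ?thesis unfolding divided_difference_def using assms by simp
qed

text \<open>After sorting, an even number of nodes interlaces with itself: even positions serve as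
  x, odd positions as y. The product over the other nodes then splits into the two factors of
  \<open>operator_monotone_interlacing\<close>.\<close>

lemma operator_monotone_divided_difference:
  assumes g: "operator_monotone g" and F: "finite F" "F \<subseteq> {0<..}" "card F = 2 * n"
    and deg: "\<And>k. k \<ge> n \<Longrightarrow> coeff r k = 0"
  shows "0 \<le> divided_difference F (\<lambda>t. (poly r t)\<^sup>2 * g t)"
proof -
  define xs where "xs = sorted_list_of_set F"
  have xs: "set xs = F" "length xs = 2 * n" using F unfolding xs_def by auto
  have lt: "xs ! i < xs ! j" if "i < j" "j < 2 * n" for i j
    using that xs(2) strict_sorted_list_of_set[of F] sorted_wrt_nth_less[of "(<)" xs i j] unfolding xs_def by auto
  have inj: "i = j" if "xs ! i = xs ! j" "i < 2 * n" "j < 2 * n" for i j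
    using lt[of i j] lt[of j i] that by (cases i j rule: linorder_cases) auto
  define x y where "x i = xs ! (2 * i)" and "y i = xs ! (2 * i + 1)" for i
  have injx: "inj_on x {..<n}" and injy: "inj_on y {..<n}"
    using inj unfolding x_def y_def by (force intro!: inj_onI)+
  have ne: "x i \<noteq> y j" if "i < n" "j < n" for i j
  proof
    assume "x i = y j"
    then have "2 * i = 2 * j + 1" using that inj[of "2 * i" "2 * j + 1"] unfolding x_def y_def by auto
    then show False by presburger
  qed
  have Fxy: "F = x ` {..<n} \<union> y ` {..<n}"
  proof -
    have "F = (\<lambda>k. xs ! k) ` {..<2*n}" using xs by (auto simp: in_set_conv_nth image_iff)
    also have "{..<2*n} = (\<lambda>i. 2 * i) ` {..<n} \<union> (\<lambda>i. 2 * i + 1) ` {..<n}"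
    proof (intro equalityI subsetI)
      fix k assume "k \<in> {..<2*n}"
      then show "k \<in> (\<lambda>i. 2 * i) ` {..<n} \<union> (\<lambda>i. 2 * i + 1) ` {..<n}"
        by (cases "even k") (auto elim!: evenE oddE)
    qed auto
    finally show ?thesis unfolding x_def y_def by (simp add: image_Un image_image)
  qed
  have disj: "x ` {..<n} \<inter> y ` {..<n} = {}" using ne by auto
  have px: "(\<Prod>u\<in>F-{x i}. x i - u) = (\<Prod>j<n. x i - y j) * (\<Prod>l\<in>{..<n}-{i}. x i - x l)" if "i < n" for i
  proof -
    have "F - {x i} = x ` ({..<n}-{i}) \<union> y ` {..<n}"
      using that ne ne[symmetric] unfolding Fxy by (auto dest: inj_onD[OF injx])
    moreover have "x ` ({..<n}-{i}) \<inter> y ` {..<n} = {}" using disj by auto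
    moreover have "inj_on x ({..<n}-{i})" using injx by (rule inj_on_subset) auto
    ultimately show ?thesis using injy by (simp add: prod.union_disjoint prod.reindex mult.commute)
  qed
  have py: "(\<Prod>u\<in>F-{y i}. y i - u) = (\<Prod>j<n. y i - x j) * (\<Prod>l\<in>{..<n}-{i}. y i - y l)" if "i < n" for i
  proof -
    have "F - {y i} = x ` {..<n} \<union> y ` ({..<n}-{i})"
      using that ne ne[symmetric] unfolding Fxy by (auto dest: inj_onD[OF injy])
    moreover have "x ` {..<n} \<inter> y ` ({..<n}-{i}) = {}" using disj by auto
    moreover have "inj_on y ({..<n}-{i})" using injy by (rule inj_on_subset) auto
    ultimately show ?thesis using injx by (simp add: prod.union_disjoint prod.reindex)
  qed
  have "divided_difference F f = (\<Sum>i<n. f (x i) / (\<Prod>u\<in>F-{x i}. x i - u)) + (\<Sum>i<n. f (y i) / (\<Prod>u\<in>F-{y i}. y i - u))" for f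
  proof -
    have "divided_difference F f = (\<Sum>t\<in>x ` {..<n} \<union> y ` {..<n}. f t / (\<Prod>u\<in>F-{t}. t - u))"
      unfolding divided_difference_def Fxy ..
    then show ?thesis using disj injx injy by (simp add: sum.union_disjoint sum.reindex)
  qed
  then have eq: "divided_difference F (\<lambda>t. (poly r t)\<^sup>2 * g t) =
      (\<Sum>i<n. (poly r (x i))\<^sup>2 * g (x i) / ((\<Prod>j<n. x i - y j) * (\<Prod>l\<in>{..<n}-{i}. x i - x l))) +
      (\<Sum>i<n. (poly r (y i))\<^sup>2 * g (y i) / ((\<Prod>j<n. y i - x j) * (\<Prod>l\<in>{..<n}-{i}. y i - y l)))"
    using px py by simp
  show ?thesis
    unfolding eq
  proof (rule operator_monotone_interlacing[OF g])
    show "0 < x i" if "i < n" for i using that F Fxy by auto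
    show "x i < y j" if "i \<le> j" "j < n" for i j using that lt unfolding x_def y_def by auto
    show "y i < x j" if "i < j" "j < n" for i j using that lt unfolding x_def y_def by auto
  qed (rule deg)
qed

section \<open>Growth of g, and nodes moved to the ends of the half-line\<close>

lemma operator_monotone_mono:
  assumes "operator_monotone g" "0 < s" "s \<le> t"
  shows "g s \<le> g t"
proof (cases "s = t")
  case False
  then have "0 \<le> divided_difference {s,t} (\<lambda>t. (poly 1 t)\<^sup>2 * g t)"
    using assms by (intro operator_monotone_divided_difference[of g "{s,t}" 1]) auto
  also have "\<dots> = (g t - g s) / (t - s)"
    using False assms unfolding divided_difference_def
    by (simp add: insert_Diff_if divide_simps) (simp add: algebra_simps)
  finally show ?thesis using False assms by (simp add: zero_le_divide_iff)
qed simp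

text \<open>A growth bound for the node that moves to infinity. The polynomial x - 2t removes the
  unknown value at 2t, the node 1/2 contributes with a known sign and is dropped, and g 1 = 1
  normalizes the rest, which leaves t g(t) \<le> (2t - 1)^2.\<close>

lemma op_mean_fun_linear_bound:
  assumes "op_mean_fun g" "2 \<le> t"
  shows "g t \<le> 4 * t"
proof -
  have g: "operator_monotone g" and pos: "\<And>t. 0 < t \<Longrightarrow> 0 < g t" and g1: "g 1 = 1"
    using assms unfolding op_mean_fun_def by auto
  let ?f = "\<lambda>x. (poly [:- 2 * t, 1:] x)\<^sup>2 * g x"
  have c: "card {1/2, 1, t, 2 * t} = 4" using assms(2) by (subst card_insert_disjoint; simp)+
  have "0 \<le> divided_difference {1/2, 1, t, 2 * t} ?f"
    using assms c by (intro operator_monotone_divided_difference[OF g, where n = 2])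
      (auto simp: coeff_pCons split: nat.splits)
  also have "\<dots> = ?f (1/2) / ((1/2 - 1) * ((1/2 - t) * (1/2 - 2 * t))) + ?f 1 / ((1 - 1/2) * ((1 - t) * (1 - 2 * t)))
     + ?f t / ((t - 1/2) * ((t - 1) * (t - 2 * t))) + 0"
    using assms(2) unfolding divided_difference_def
    by (simp add: insert_Diff_if)
  finally have "0 \<le> ?f (1/2) / ((1/2 - 1) * ((1/2 - t) * (1/2 - 2 * t))) + ?f 1 / ((1 - 1/2) * ((1 - t) * (1 - 2 * t)))
     + ?f t / ((t - 1/2) * ((t - 1) * (t - 2 * t)))" by simp
  moreover have "?f (1/2) / ((1/2 - 1) * ((1/2 - t) * (1/2 - 2 * t))) \<le> 0"
  proof (rule divide_nonneg_nonpos)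
    show "0 \<le> ?f (1/2)" using pos[of "1/2"] by simp
    show "(1/2 - 1) * ((1/2 - t) * (1/2 - 2 * t)) \<le> 0"
      using assms(2) by (intro mult_nonpos_nonneg mult_nonpos_nonpos) auto
  qed
  ultimately have "0 \<le> (1 - 2 * t)\<^sup>2 / ((1 - 1/2) * ((1 - t) * (1 - 2 * t))) + (t - 2 * t)\<^sup>2 * g t / ((t - 1/2) * ((t - 1) * (t - 2 * t)))"
    by (simp add: g1)
  also have "(1 - 2 * t)\<^sup>2 / ((1 - 1/2) * ((1 - t) * (1 - 2 * t))) = (2 * (2 * t - 1)) / (t - 1)"
    using assms(2) by (simp add: divide_simps power2_eq_square) (simp add: algebra_simps)
  also have "(t - 2 * t)\<^sup>2 * g t / ((t - 1/2) * ((t - 1) * (t - 2 * t))) = - (t * g t / (t - 1/2)) / (t - 1)"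
    using assms(2) by (simp add: divide_simps power2_eq_square)
  finally have "0 \<le> (2 * (2 * t - 1) - t * g t / (t - 1/2)) / (t - 1)" by (simp add: diff_divide_distrib)
  then have "t * g t / (t - 1/2) \<le> 2 * (2 * t - 1)" using assms(2) by (simp add: zero_le_divide_iff)
  then have "t * g t \<le> 2 * (2 * t - 1) * (t - 1/2)" using assms(2) by (simp add: divide_le_eq)
  also have "\<dots> \<le> t * (4 * t)" using assms(2) by (simp add: algebra_simps)
  finally show ?thesis using assms(2) by simp
qed

lemma prod_neg_odd:
  assumes "odd (card F)" "\<And>u. u \<in> F \<Longrightarrow> e < (u::real)"
  shows "(\<Prod>u\<in>F. e - u) < 0"
proof -
  have fin: "finite F" using assms(1) card.infinite by fastforce
  have "(\<Prod>u\<in>F. e - u) = (\<Prod>u\<in>F. (-1) * (u - e))" by simp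
  also have "\<dots> = - (\<Prod>u\<in>F. u - e)" using assms(1) by (simp only: prod.distrib prod_constant) simp
  finally show ?thesis using assms(2) by (simp add: prod_pos)
qed

lemma op_mean_fun_square:
  assumes g: "op_mean_fun g" and F: "finite F" "F \<subseteq> {0<..}" "card F = 2 * m + 1"
    and deg: "\<And>k. k \<ge> m + 1 \<Longrightarrow> coeff h k = 0"
  shows "0 \<le> (\<Sum>t\<in>F. (poly h t)\<^sup>2 * g t / (t * (\<Prod>u\<in>F-{t}. t - u)))"
proof -
  have om: "operator_monotone g" and pos: "\<And>t. 0 < t \<Longrightarrow> 0 < g t"
    using g unfolding op_mean_fun_def by auto
  define S where "S e = (\<Sum>t\<in>F. (poly h t)\<^sup>2 * g t / ((t - e) * (\<Prod>u\<in>F-{t}. t - u)))" for e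
  have ne: "F \<noteq> {}" using F by auto
  have S: "0 \<le> S e" if e: "0 < e" "e < Min F" for e
  proof -
    have lt: "e < u" if "u \<in> F" for u using e that F ne by (meson Min_gr_iff)
    then have nin: "e \<notin> F" by blast
    have "0 \<le> divided_difference (insert e F) (\<lambda>t. (poly h t)\<^sup>2 * g t)"
      using F e nin deg by (intro operator_monotone_divided_difference[OF om, where n = "m + 1"]) auto
    also have "\<dots> = (poly h e)\<^sup>2 * g e / (\<Prod>u\<in>F. e - u) + S e"
      unfolding S_def by (rule divided_difference_insert[OF F(1) nin])
    also have "(poly h e)\<^sup>2 * g e / (\<Prod>u\<in>F. e - u) \<le> 0"
      using prod_neg_odd[of F e] F(3) lt pos[OF e(1)]
      by (intro divide_nonneg_nonpos) auto
    finally show ?thesis by simp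
  qed
  have "(S \<longlongrightarrow> S 0) (at_right 0)"
    unfolding S_def using F by (intro tendsto_intros) (auto simp: prod_zero_iff)
  moreover have "eventually (\<lambda>e. 0 \<le> S e) (at_right 0)"
    using S F ne unfolding eventually_at_right_field by (intro exI[of _ "Min F"]) auto
  ultimately have "0 \<le> S 0" by (intro tendsto_lowerbound[of S "S 0" "at_right 0" 0]) auto
  then show ?thesis unfolding S_def by simp
qed

text \<open>Here the additional node T tends to infinity. Its own term is nonnegative and has to be
  shown to vanish: after multiplication by T it is at most 4 T^2 h(T)^2 over a polynomial of degree
  2m+1, and degree h < m makes this tend to 0. The factor T/(t - T) tends to -1, which reverses the
  inequality.\<close>

lemma op_mean_fun_neg_square:
  assumes g: "op_mean_fun g" and F: "finite F" "F \<subseteq> {0<..}" "card F = 2 * m + 1"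
    and deg: "degree h < m"
  shows "(\<Sum>t\<in>F. (poly h t)\<^sup>2 * g t / (\<Prod>u\<in>F-{t}. t - u)) \<le> 0"
proof -
  have om: "operator_monotone g" and pos: "\<And>t. 0 < t \<Longrightarrow> 0 < g t"
    using g unfolding op_mean_fun_def by auto
  define a where "a t = (poly h t)\<^sup>2 * g t / (\<Prod>u\<in>F-{t}. t - u)" for t
  define p where "p = [:0,0,4:] * h\<^sup>2"
  define q where "q = (\<Prod>u\<in>F. [:-u, 1:])"
  have "degree q = 2 * m + 1" unfolding q_def using F by (simp add: degree_prod_eq_sum_degree)
  moreover have "degree p \<le> 2 * m"
  proof -
    have "degree p \<le> 2 + degree (h\<^sup>2)" unfolding p_def
      using degree_mult_le[of "[:0,0,4:]" "h\<^sup>2"] by simp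
    also have "degree (h\<^sup>2) \<le> degree h * 2" by (rule degree_power_le)
    finally show ?thesis using deg by linarith
  qed
  ultimately have "((\<lambda>t. poly p t / poly q t) \<longlongrightarrow> 0) at_infinity"
    by (intro poly_divide_tendsto_0_at_infinity) simp
  then have lim1: "((\<lambda>t. poly p t / poly q t) \<longlongrightarrow> 0) at_top"
    by (rule filterlim_mono) (auto simp: at_top_le_at_infinity)
  have lim2: "((\<lambda>T. \<Sum>t\<in>F. a t * (T / (t - T))) \<longlongrightarrow> (\<Sum>t\<in>F. a t * (-1))) at_top"
  proof (intro tendsto_sum tendsto_mult tendsto_const)
    fix t :: real
    show "((\<lambda>T. T / (t - T)) \<longlongrightarrow> -1) at_top" by real_asymp
  qed
  have ev: "eventually (\<lambda>T. 0 \<le> poly p T / poly q T + (\<Sum>t\<in>F. a t * (T / (t - T)))) at_top"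
    using eventually_gt_at_top[of "Max F"] eventually_gt_at_top[of 2]
  proof eventually_elim
    case (elim T)
    have lt: "u < T" if "u \<in> F" for u using elim(1) that F by (meson Max_ge order_le_less_trans)
    then have nin: "T \<notin> F" by blast
    have qT: "poly q T = (\<Prod>u\<in>F. T - u)" unfolding q_def by (simp add: poly_prod)
    have qpos: "0 < (\<Prod>u\<in>F. T - u)" using lt by (intro prod_pos) auto
    have "0 \<le> T * divided_difference (insert T F) (\<lambda>t. (poly h t)\<^sup>2 * g t)"
      using F elim nin deg
      by (intro mult_nonneg_nonneg operator_monotone_divided_difference[OF om, where n = "m + 1"])
         (auto intro!: coeff_eq_0)
    also have "\<dots> = T * (poly h T)\<^sup>2 * g T / (\<Prod>u\<in>F. T - u) + (\<Sum>t\<in>F. a t * (T / (t - T)))"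
      unfolding divided_difference_insert[OF F(1) nin] distrib_left sum_distrib_left a_def
      by (intro arg_cong2[of _ _ _ _ "(+)"] sum.cong) (auto simp: mult_ac)
    also have "T * (poly h T)\<^sup>2 * g T / (\<Prod>u\<in>F. T - u) \<le> poly p T / poly q T"
    proof -
      have "T * (poly h T)\<^sup>2 * g T \<le> T * (poly h T)\<^sup>2 * (4 * T)"
        using elim op_mean_fun_linear_bound[OF g, of T] by (intro mult_left_mono) auto
      also have "\<dots> = poly p T" unfolding p_def by (simp add: power2_eq_square)
      finally show ?thesis unfolding qT using qpos by (intro divide_right_mono) auto
    qed
    finally show ?case by simp
  qed
  have "0 \<le> 0 + (\<Sum>t\<in>F. a t * (-1))"
    by (rule tendsto_lowerbound[OF tendsto_add[OF lim1 lim2] ev]) simp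
  then show ?thesis unfolding a_def by (simp add: sum_negf)
qed

section \<open>Nonnegative polynomials on the nonpositive half-line\<close>

text \<open>The truncated quadratic module of (-\<infinity>, 0], generated by 1 and -x. The bound d
  is imposed on each summand, because the lemmas on moved nodes restrict the degree of each single
  h.\<close>

inductive halfline_sos :: "nat \<Rightarrow> real poly \<Rightarrow> bool" where
  sq: "2 * degree h \<le> d \<Longrightarrow> halfline_sos d (h\<^sup>2)"
| neg: "2 * degree h + 1 \<le> d \<Longrightarrow> halfline_sos d ([:0, -1:] * h\<^sup>2)"
| add: "halfline_sos d p \<Longrightarrow> halfline_sos d q \<Longrightarrow> halfline_sos d (p + q)"

lemma degree_lin_mult_le: "degree ([:a, b:] * (h::real poly)) \<le> Suc (degree h)"
  using degree_mult_le[of "[:a, b:]" h] by (simp split: if_splits)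

text \<open>(a - x) h^2 = a h^2 + (-x) h^2, and (a - x)(-x) h^2 = a (-x) h^2 + (x h)^2; the square
  root of a is absorbed into h.\<close>

lemma halfline_sos_linear:
  assumes "halfline_sos d p" "0 \<le> a"
  shows "halfline_sos (d + 1) ([:a, -1:] * p)"
  using assms(1)
proof (induction rule: halfline_sos.induct)
  case (sq h d)
  have "[:a, -1:] * h\<^sup>2 = (Polynomial.smult (sqrt a) h)\<^sup>2 + [:0, -1:] * h\<^sup>2"
    using assms(2) by (simp add: power2_eq_square flip: smult_add_left)
  moreover have "2 * degree (Polynomial.smult (sqrt a) h) \<le> d + 1"
    using sq degree_smult_le[of "sqrt a" h] by linarith
  moreover have "2 * degree h + 1 \<le> d + 1" using sq by linarith
  ultimately show ?case by (metis halfline_sos.intros)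
next
  case (neg h d)
  have "[:a, -1:] * ([:0, -1:] * h\<^sup>2) = [:0, -1:] * (Polynomial.smult (sqrt a) h)\<^sup>2 + ([:0, 1:] * h)\<^sup>2"
    using assms(2) by (simp add: power2_eq_square algebra_simps)
  moreover have "2 * degree ([:0, 1:] * h) \<le> d + 1"
    using neg degree_lin_mult_le[of 0 1 h] by linarith
  moreover have "2 * degree (Polynomial.smult (sqrt a) h) + 1 \<le> d + 1"
    using neg degree_smult_le[of "sqrt a" h] by linarith
  ultimately show ?case by (metis halfline_sos.intros)
qed (simp add: halfline_sos.add distrib_left)

lemma halfline_sos_square:
  assumes "halfline_sos d p" "degree q \<le> 1"
  shows "halfline_sos (d + 2) (q\<^sup>2 * p)"
  using assms(1)
proof (induction rule: halfline_sos.induct)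
  case (sq h d)
  have "2 * degree (q * h) \<le> d + 2" using sq assms(2) degree_mult_le[of q h] by linarith
  then have "halfline_sos (d + 2) ((q * h)\<^sup>2)" by (rule halfline_sos.sq)
  then show ?case by (simp add: power_mult_distrib)
next
  case (neg h d)
  have "2 * degree (q * h) + 1 \<le> d + 2" using neg assms(2) degree_mult_le[of q h] by linarith
  then have "halfline_sos (d + 2) ([:0, -1:] * (q * h)\<^sup>2)" by (rule halfline_sos.neg)
  then show ?case by (simp only: power_mult_distrib mult_ac)
qed (simp add: halfline_sos.add distrib_left)

text \<open>Recovers nonnegativity at the one point where a linear factor has been divided
  out.\<close>

lemma poly_nonneg_closure:
  fixes p :: "real poly"
  assumes "\<And>t. t \<le> 0 \<Longrightarrow> t \<noteq> a \<Longrightarrow> 0 \<le> poly p t" "a \<le> 0"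
  shows "0 \<le> poly p a"
proof -
  have "(poly p \<longlongrightarrow> poly p a) (at_left a)" by (intro tendsto_intros)
  moreover have "eventually (\<lambda>t. 0 \<le> poly p t) (at_left a)"
    unfolding eventually_at_left_field using assms by (intro exI[of _ "a - 1"]) auto
  ultimately show ?thesis by (intro tendsto_lowerbound[of "poly p" _ "at_left a"]) auto
qed

text \<open>Induction on the degree, splitting off the factor of one complex root. A root a \<ge> 0
  gives a - x, which is nonnegative on the half-line. A root a < 0 would make p change sign unless
  it is multiple, so a square splits off. A nonreal root gives a quadratic that is a sum of two
  squares.\<close>

lemma nonneg_halfline_sos:
  assumes "\<And>t. t \<le> 0 \<Longrightarrow> 0 \<le> poly p t"
  shows "halfline_sos (degree p) p"
  using assms
proof (induction "degree p" arbitrary: p rule: less_induct)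
  case less
  show ?case
  proof (cases "degree p = 0")
    case True
    then obtain c where c: "p = [:c:]" by (metis degree_0_id)
    then have "0 \<le> c" using less.prems[of 0] by simp
    then have "p = [:sqrt c:]\<^sup>2" unfolding c by (simp add: power2_eq_square)
    then show ?thesis using halfline_sos.sq[of "[:sqrt c:]" "degree p"] by simp
  next
    case False
    then have "degree (map_poly complex_of_real p) \<noteq> 0" by (simp add: degree_map_poly)
    then obtain z where z: "poly (map_poly complex_of_real p) z = 0"
      using fundamental_theorem_of_algebra_alt by (metis degree_pCons_0)
    have p0: "p \<noteq> 0" using False by auto
    show ?thesis
    proof (cases "Im z = 0")
      case True
      then obtain a where a: "z = complex_of_real a" by (metis complex_is_Real_iff Reals_cases)
      then have "poly p a = 0" using z by (metis of_real_eq_0_iff of_real_hom.poly_map_poly)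
      then obtain s where s: "p = [:-a, 1:] * s" using poly_eq_0_iff_dvd by (metis dvdE)
      then have s0: "s \<noteq> 0" using p0 by auto
      have ds: "degree p = degree s + 1" unfolding s using s0 by (subst degree_mult_eq) auto
      have ps: "poly p t = (t - a) * poly s t" for t unfolding s by (simp add: algebra_simps)
      show ?thesis
      proof (cases "0 \<le> a")
        case True
        have "0 \<le> poly (- s) t" if "t \<le> 0" "t \<noteq> 0" for t
          using less.prems[OF that(1)] that True unfolding ps by (simp add: zero_le_mult_iff)
        then have "0 \<le> poly (- s) t" if "t \<le> 0" for t
          using poly_nonneg_closure[of 0 "- s"] that by (cases "t = 0") auto
        then have "halfline_sos (degree (- s)) (- s)" using ds by (intro less.hyps) auto
        then have "halfline_sos (degree (- s) + 1) ([:a, -1:] * (- s))" by (rule halfline_sos_linear[OF _ True])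
        moreover have "[:a, -1:] * (- s) = p" unfolding s by simp
        ultimately show ?thesis using ds by simp
      next
        case False
        \<comment> \<open>To the left and to the right of a negative root the cofactor s has
          opposite signs, so it vanishes there and a second factor splits off.\<close>
        have right: "0 \<le> poly s t" if "t \<le> 0" "a < t" for t
          using less.prems[OF that(1)] that unfolding ps by (simp add: zero_le_mult_iff)
        have left: "poly s t \<le> 0" if "t < a" for t
          using less.prems[of t] that False unfolding ps by (simp add: zero_le_mult_iff)
        have "0 \<le> poly s a"
        proof -
          have "(poly s \<longlongrightarrow> poly s a) (at_right a)" by (intro tendsto_intros)
          moreover have "eventually (\<lambda>t. 0 \<le> poly s t) (at_right a)"
            unfolding eventually_at_right_field using right False by (intro exI[of _ 0]) auto
          ultimately show ?thesis by (intro tendsto_lowerbound[of "poly s" _ "at_right a"]) auto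
        qed
        moreover have "poly s a \<le> 0"
        proof -
          have "(poly s \<longlongrightarrow> poly s a) (at_left a)" by (intro tendsto_intros)
          moreover have "eventually (\<lambda>t. poly s t \<le> 0) (at_left a)"
            unfolding eventually_at_left_field using left by (intro exI[of _ "a - 1"]) auto
          ultimately show ?thesis by (intro tendsto_upperbound[of "poly s" _ "at_left a"]) auto
        qed
        ultimately have "poly s a = 0" by simp
        then obtain w where w: "s = [:-a, 1:] * w" using poly_eq_0_iff_dvd by (metis dvdE)
        then have "w \<noteq> 0" using s0 by auto
        then have dw: "degree s = degree w + 1" unfolding w by (subst degree_mult_eq) auto
        have pw: "p = [:-a, 1:]\<^sup>2 * w" unfolding s w by (simp only: power2_eq_square mult.assoc)
        have "0 \<le> poly w t" if "t \<le> 0" "t \<noteq> a" for t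
          using less.prems[OF that(1)] that unfolding pw by (simp add: zero_le_mult_iff)
        then have "0 \<le> poly w t" if "t \<le> 0" for t
          using poly_nonneg_closure[of a w] that False by (cases "t = a") auto
        then have "halfline_sos (degree w) w" using ds dw by (intro less.hyps) auto
        then have "halfline_sos (degree w + 2) ([:-a, 1:]\<^sup>2 * w)" by (rule halfline_sos_square) simp
        then show ?thesis using pw ds dw by simp
      qed
    next
      case False
      define q where "q = [:- Re z, 1:]\<^sup>2 + [:Im z:]\<^sup>2"
      have qc: "q = [:(Re z)\<^sup>2 + (Im z)\<^sup>2, - 2 * Re z, 1:]" unfolding q_def by (simp add: power2_eq_square)
      have qz: "poly (map_poly complex_of_real q) z = 0"
        unfolding qc by (simp add: map_poly_pCons complex_eq_iff power2_eq_square algebra_simps)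
      \<comment> \<open>The remainder is a real polynomial of degree at most 1 that vanishes at the
        nonreal z, hence it is zero and q divides p.\<close>
      define r where "r = p mod q"
      have "degree r < degree q \<or> r = 0" unfolding r_def using degree_mod_less[of q p] qc by auto
      then have "degree r < 2" unfolding qc by auto
      then have "r = [:coeff r 0, coeff r 1:]"
        by (intro poly_eqI) (auto simp: coeff_pCons coeff_eq_0 numeral_2_eq_2 split: nat.splits)
      then obtain r0 r1 where r: "r = [:r0, r1:]" by blast
      have lin: "poly (map_poly complex_of_real [:r0, r1:]) z = complex_of_real r0 + z * complex_of_real r1"
        by (simp add: of_real_hom.map_poly_pCons_hom)
      interpret of_real_poly: map_poly_comm_ring_hom complex_of_real ..
      have "p = q * (p div q) + r" unfolding r_def by simp
      then have "map_poly complex_of_real p = map_poly complex_of_real q * map_poly complex_of_real (p div q) + map_poly complex_of_real r"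
        by (metis of_real_poly.hom_add of_real_poly.hom_mult)
      then have "poly (map_poly complex_of_real r) z = 0" using z qz by simp
      then have "complex_of_real r0 + z * complex_of_real r1 = 0" unfolding r lin .
      then have "r1 = 0" "r0 = 0" using False by (auto simp: complex_eq_iff)
      define s where "s = p div q"
      have qs: "q * s = p" unfolding s_def using \<open>p = q * (p div q) + r\<close> \<open>r1 = 0\<close> \<open>r0 = 0\<close> r by simp
      have s0: "s \<noteq> 0" using qs p0 by auto
      have "degree (q * s) = degree s + 2"
        using s0 qc by (subst degree_mult_eq) auto
      then have dps: "degree p = degree s + 2" unfolding qs .
      have "0 \<le> poly s t" if "t \<le> 0" for t
      proof -
        have "0 < poly q t" unfolding q_def using False by (simp add: sum_power2_gt_zero_iff add_nonneg_pos)
        moreover have "0 \<le> poly q t * poly s t" using less.prems[OF that] unfolding qs[symmetric] by simp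
        ultimately show ?thesis by (simp add: zero_le_mult_iff)
      qed
      then have "halfline_sos (degree s) s" using dps by (intro less.hyps) auto
      then have "halfline_sos (degree s + 2) ([:- Re z, 1:]\<^sup>2 * s)" "halfline_sos (degree s + 2) ([:Im z:]\<^sup>2 * s)"
        by (rule halfline_sos_square, simp)+
      then have "halfline_sos (degree s + 2) ([:- Re z, 1:]\<^sup>2 * s + [:Im z:]\<^sup>2 * s)" by (rule halfline_sos.add)
      also have "[:- Re z, 1:]\<^sup>2 * s + [:Im z:]\<^sup>2 * s = p" unfolding qs[symmetric] q_def by (rule distrib_right[symmetric])
      finally show ?thesis unfolding dps .
    qed
  qed
qed

text \<open>For the second generator the factor -x cancels the weight 1/t, which leaves the sum
  treated in \<open>op_mean_fun_neg_square\<close>.\<close>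

lemma op_mean_fun_halfline_sos:
  assumes g: "op_mean_fun g" and F: "finite F" "F \<subseteq> {0<..}" "card F = 2 * m + 1"
    and p: "halfline_sos d p" "d \<le> 2 * m"
  shows "0 \<le> (\<Sum>t\<in>F. poly p t * g t / (t * (\<Prod>u\<in>F-{t}. t - u)))"
  using p
proof (induction rule: halfline_sos.induct)
  case (sq h d)
  have "coeff h k = 0" if "k \<ge> m + 1" for k using sq that by (intro coeff_eq_0) auto
  then show ?case using op_mean_fun_square[OF g F, of h] by simp
next
  case (neg h d)
  then have "degree h < m" by linarith
  then have "(\<Sum>t\<in>F. (poly h t)\<^sup>2 * g t / (\<Prod>u\<in>F-{t}. t - u)) \<le> 0" by (rule op_mean_fun_neg_square[OF g F])
  moreover have "(\<Sum>t\<in>F. poly ([:0, -1:] * h\<^sup>2) t * g t / (t * (\<Prod>u\<in>F-{t}. t - u)))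
     = (\<Sum>t\<in>F. - ((poly h t)\<^sup>2 * g t / (\<Prod>u\<in>F-{t}. t - u)))"
    using F(2) by (intro sum.cong) (auto simp: field_simps)
  ultimately show ?case by (simp add: sum_negf)
next
  case (add d p q)
  then show ?case by (simp add: distrib_right add_divide_distrib sum.distrib)
qed

text \<open>Clearing denominators turns a nonnegative combination of the functions \<open>t / (s t + 1 - s)\<close>
  into a polynomial that is nonnegative on the negative half-line.\<close>
lemma op_mean_fun_dual_cone:
  assumes g: "op_mean_fun g" and F: "finite F" "F \<subseteq> {0<..}" "card F = 2 * m + 1"
    and c: "\<And>s. 0 \<le> s \<Longrightarrow> s \<le> 1 \<Longrightarrow> 0 \<le> (\<Sum>t\<in>F. c t * (t / (s * t + (1 - s))))"
  shows "0 \<le> (\<Sum>t\<in>F. c t * g t)"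
proof -
  \<comment> \<open>At a node t all summands but one vanish, and p(t) is \<open>c t * t\<close>
    times the product of u - t over the other nodes. The weights of
    \<open>op_mean_fun_halfline_sos\<close> therefore reduce p to c.\<close>
  define p where "p = (\<Sum>t\<in>F. Polynomial.smult (c t * t) (\<Prod>u\<in>F-{t}. [:u, -1:]))"
  have "degree p \<le> 2 * m"
    unfolding p_def
  proof (intro degree_sum_le F(1))
    fix t assume "t \<in> F"
    then have "degree (\<Prod>u\<in>F-{t}. [:u, -1:]) \<le> 2 * m"
      using degree_prod_sum_le[of "F-{t}" "\<lambda>u. [:u, -1:]"] F by (simp add: card_Diff_singleton)
    then show "degree (Polynomial.smult (c t * t) (\<Prod>u\<in>F-{t}. [:u, -1:])) \<le> 2 * m"
      using degree_smult_le order_trans by blast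
  qed
  moreover have "0 \<le> poly p x" if x: "x \<le> 0" for x
  proof -
    have neq: "t - x \<noteq> 0" if "t \<in> F" for t using that F x by auto
    have "poly p x = (\<Sum>t\<in>F. (\<Prod>u\<in>F. u - x) * (c t * (t / (t - x))))"
      unfolding p_def poly_sum
    proof (rule sum.cong)
      fix t assume t: "t \<in> F"
      have "(\<Prod>u\<in>F. u - x) = (t - x) * (\<Prod>u\<in>F-{t}. u - x)" using F t by (simp add: prod.remove)
      then show "poly (Polynomial.smult (c t * t) (\<Prod>u\<in>F-{t}. [:u, -1:])) x = (\<Prod>u\<in>F. u - x) * (c t * (t / (t - x)))"
        using neq[OF t] by (simp add: poly_prod)
    qed simp
    \<comment> \<open>The substitution s = 1/(1 - x) carries x \<le> 0 into [0,1] and t/(s t + 1 -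
      s) into (1 - x) t/(t - x).\<close>
    also have "\<dots> = (\<Prod>u\<in>F. u - x) * (1 / (1 - x) * (\<Sum>t\<in>F. c t * (t / (1 / (1 - x) * t + (1 - 1 / (1 - x))))))"
      unfolding sum_distrib_left
    proof (rule sum.cong)
      fix t assume t: "t \<in> F"
      have "1 - 1 / (1 - x) = - x / (1 - x)" using x by (simp add: divide_simps)
      then have "1 / (1 - x) * t + (1 - 1 / (1 - x)) = (t - x) / (1 - x)" by (simp add: diff_divide_distrib)
      then show "(\<Prod>u\<in>F. u - x) * (c t * (t / (t - x))) =
          (\<Prod>u\<in>F. u - x) * (1 / (1 - x) * (c t * (t / (1 / (1 - x) * t + (1 - 1 / (1 - x))))))"
        using x neq[OF t] by simp
    qed simp
    also have "\<dots> \<ge> 0"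
      using F x by (intro mult_nonneg_nonneg c prod_nonneg) auto
    finally show ?thesis .
  qed
  then have "halfline_sos (degree p) p" by (rule nonneg_halfline_sos)
  ultimately have "0 \<le> (\<Sum>t\<in>F. poly p t * g t / (t * (\<Prod>u\<in>F-{t}. t - u)))"
    by (intro op_mean_fun_halfline_sos[OF g F])
  also have "\<dots> = (\<Sum>t\<in>F. c t * g t)"
  proof (rule sum.cong)
    fix t assume t: "t \<in> F"
    have "poly p t = (\<Sum>s\<in>F. if s = t then c t * t * (\<Prod>u\<in>F-{t}. u - t) else 0)"
      unfolding p_def poly_sum
    proof (rule sum.cong)
      fix s assume s: "s \<in> F"
      show "poly (Polynomial.smult (c s * s) (\<Prod>u\<in>F-{s}. [:u, -1:])) t = (if s = t then c t * t * (\<Prod>u\<in>F-{t}. u - t) else 0)"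
        using s t F by (auto simp: poly_prod intro!: prod_zero)
    qed simp
    also have "\<dots> = c t * t * (\<Prod>u\<in>F-{t}. u - t)" using t F by simp
    also have "(\<Prod>u\<in>F-{t}. u - t) = (\<Prod>u\<in>F-{t}. (-1) * (t - u))" by simp
    \<comment> \<open>F without t has 2m elements, so the signs cancel.\<close>
    also have "\<dots> = (\<Prod>u\<in>F-{t}. t - u)"
      using F t by (simp only: prod.distrib prod_constant) (simp add: card_Diff_singleton)
    finally have "poly p t = c t * t * (\<Prod>u\<in>F-{t}. t - u)" .
    moreover have "(\<Prod>u\<in>F-{t}. t - u) \<noteq> 0" "t \<noteq> 0" using F t by (auto simp: prod_zero_iff)
    ultimately show "poly p t * g t / (t * (\<Prod>u\<in>F-{t}. t - u)) = c t * g t" by simp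
  qed simp
  finally show ?thesis .
qed

section \<open>Holomorphic continuation\<close>

definition harm :: "real \<Rightarrow> complex \<Rightarrow> complex" where
  "harm s z = z / (of_real s * z + of_real (1 - s))"

text \<open>The convex hull generated by binary combinations, so that rule induction proves any
  inequality that is affine in the function.\<close>

inductive harm_comb :: "(complex \<Rightarrow> complex) \<Rightarrow> bool" where
  harm: "0 \<le> s \<Longrightarrow> s \<le> 1 \<Longrightarrow> harm_comb (harm s)"
| comb: "harm_comb f \<Longrightarrow> harm_comb h \<Longrightarrow> 0 \<le> u \<Longrightarrow> u \<le> 1 \<Longrightarrow>
    harm_comb (\<lambda>z. of_real u * f z + of_real (1 - u) * h z)"

text \<open>Stands in for the integral representation in Loewner's theorem: a locally uniform limit
  of convex combinations takes the place of an integral over s against a probability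
  measure.\<close>

definition loewner_fun :: "(complex \<Rightarrow> complex) \<Rightarrow> bool" where
  "loewner_fun G \<longleftrightarrow> G holomorphic_on slit_plane \<and> (\<exists>f. (\<forall>k. harm_comb (f k)) \<and>
    (\<forall>K. compact K \<longrightarrow> K \<subseteq> slit_plane \<longrightarrow> uniform_limit K f G sequentially))"

lemma slit_plane_topology:
  shows open_slit_plane: "open slit_plane" and simply_connected_slit_plane: "simply_connected slit_plane"
    and connected_slit_plane: "connected slit_plane"
proof -
  have eq: "\<real>\<^sub>\<le>\<^sub>0 = complex_of_real ` {..0}"
    by (auto simp: nonpos_Reals_def)
  show "open slit_plane" by (simp add: open_Compl)
  then show sc: "simply_connected slit_plane"
    using starlike_slotted_complex_plane_left[of 0] starlike_imp_simply_connected unfolding eq by blast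
  then show "connected slit_plane" by (rule simply_connected_imp_connected)
qed

lemma of_real_in_slit_plane: "0 < t \<Longrightarrow> complex_of_real t \<in> slit_plane"
  by (simp add: complex_nonpos_Reals_iff)

text \<open>The only possible zero is -(1 - s)/s, which lies on the slit.\<close>

lemma harm_denominator:
  assumes "0 \<le> s" "s \<le> 1" "z \<in> slit_plane"
  shows "of_real s * z + of_real (1 - s) \<noteq> 0"
proof
  assume 0: "of_real s * z + of_real (1 - s) = 0"
  then have s: "s \<noteq> 0" by auto
  have "z = of_real (- (1 - s) / s)"
    using 0 s by (simp add: field_simps eq_neg_iff_add_eq_0)
  then have "z \<in> \<real>\<^sub>\<le>\<^sub>0" using assms s
    by (simp only: nonpos_Reals_of_real_iff) (simp add: divide_le_0_iff)
  then show False using assms(3) by simp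
qed

lemma harm_comb_holomorphic: "harm_comb f \<Longrightarrow> f holomorphic_on slit_plane"
proof (induction rule: harm_comb.induct)
  case (harm s)
  show ?case unfolding harm_def
    using harm_denominator[OF harm] by (intro holomorphic_intros) auto
qed (intro holomorphic_intros)

text \<open>\<open>harm s z\<close> is jointly continuous in s and z, so compactness of [0,1] x K
  bounds it uniformly in s, and convex combinations inherit the bound.\<close>

lemma harm_comb_locally_bounded:
  assumes "compact K" "K \<subseteq> slit_plane"
  shows "\<exists>B. \<forall>f\<in>Collect harm_comb. \<forall>z\<in>K. norm (f z) \<le> B"
proof -
  have "continuous_on ({0..1} \<times> K) (\<lambda>(s, z). harm s z)"
    unfolding harm_def case_prod_unfold
    using harm_denominator assms(2) by (intro continuous_intros) (auto simp: subset_iff)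
  then have "compact ((\<lambda>(s, z). harm s z) ` ({0..1} \<times> K))"
    using assms(1) by (intro compact_continuous_image compact_Times) auto
  then obtain B where B: "\<And>w. w \<in> (\<lambda>(s, z). harm s z) ` ({0..1} \<times> K) \<Longrightarrow> norm w \<le> B"
    using compact_imp_bounded bounded_iff by metis
  have "norm (f z) \<le> B" if "harm_comb f" "z \<in> K" for f z
    using that(1)
  proof (induction rule: harm_comb.induct)
    case (harm s)
    then show ?case using B[of "harm s z"] that(2) by force
  next
    case (comb f h u)
    have "norm (of_real u * f z + of_real (1 - u) * h z) \<le> u * norm (f z) + (1 - u) * norm (h z)"
      by (rule order_trans[OF norm_triangle_ineq]) (use comb(3,4) in \<open>simp add: norm_mult del: of_real_diff\<close>)
    also have "\<dots> \<le> u * B + (1 - u) * B" using comb by (intro add_mono mult_left_mono) auto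
    finally show ?case by (simp add: algebra_simps)
  qed
  then show ?thesis by blast
qed

lemma harm_of_real: "harm s (of_real t) = of_real (t / (s * t + (1 - s)))"
  unfolding harm_def by simp

text \<open>The bound 1 + t is independent of s; it keeps the values on a finite grid bounded, as
  the separation argument requires. The common value at 1 is a normalization shared with g.\<close>

lemma harm_comb_real:
  assumes "harm_comb f" "0 < t"
  shows "f (of_real t) = of_real (Re (f (of_real t)))" "\<bar>Re (f (of_real t))\<bar> \<le> 1 + t" "f 1 = 1"
  using assms(1)
proof (induction rule: harm_comb.induct)
  case (harm s)
  case 1 show ?case unfolding harm_of_real by simp
  case 2
  have "t \<le> (1 + t) * (s * t + (1 - s))"
  proof -
    have "(1 + t) * (s * t + (1 - s)) - t = s * t\<^sup>2 + (1 - s)" by (simp add: algebra_simps power2_eq_square)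
    moreover have "0 \<le> s * t\<^sup>2 + (1 - s)" using harm by simp
    ultimately show ?thesis by simp
  qed
  moreover have "0 < s * t + (1 - s)"
    using harm assms(2) by (cases "s = 0") (auto intro: add_pos_nonneg)
  ultimately have "t / (s * t + (1 - s)) \<le> 1 + t" by (simp add: divide_le_eq)
  then show ?case unfolding harm_of_real using assms(2) \<open>0 < s * t + (1 - s)\<close> by simp
  case 3 show ?case unfolding harm_def by simp
next
  case (comb f h u)
  case 1
  have "of_real u * f (of_real t) + of_real (1 - u) * h (of_real t) =
      complex_of_real (u * Re (f (of_real t)) + (1 - u) * Re (h (of_real t)))"
    using comb(5,8) by (metis of_real_add of_real_mult)
  then show ?case by (metis Re_complex_of_real)
  case 2
  have "\<bar>u * Re (f (of_real t)) + (1 - u) * Re (h (of_real t))\<bar> \<le> u * \<bar>Re (f (of_real t))\<bar> + (1 - u) * \<bar>Re (h (of_real t))\<bar>"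
    using comb(3,4) by (intro order_trans[OF abs_triangle_ineq]) (simp add: abs_mult)
  also have "\<dots> \<le> u * (1 + t) + (1 - u) * (1 + t)"
    using comb by (intro add_mono mult_left_mono) auto
  finally show ?case by (simp add: algebra_simps)
  case 3 show ?case using comb by simp
qed

section \<open>Separation on a finite grid\<close>

text \<open>Separation by minimal distance in the Euclidean space of functions on F. As C is not
  assumed closed, a near-minimizer f0 replaces the nearest point, with c = g - f0: if the inner
  product of c with f - f0 were large, a step of length s from f0 towards f would undercut the
  infimum d.\<close>

lemma approx_or_separate:
  fixes C :: "('a \<Rightarrow> real) set" and g :: "'a \<Rightarrow> real"
  assumes F: "finite F" and ne: "C \<noteq> {}"
    and conv: "\<And>f h u. f \<in> C \<Longrightarrow> h \<in> C \<Longrightarrow> 0 \<le> u \<Longrightarrow> u \<le> 1 \<Longrightarrow> (\<lambda>t. u * f t + (1 - u) * h t) \<in> C"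
    and bdd: "\<And>f t. f \<in> C \<Longrightarrow> t \<in> F \<Longrightarrow> \<bar>f t\<bar> \<le> B t"
    and far: "0 < \<epsilon>" "\<And>f. f \<in> C \<Longrightarrow> \<epsilon> \<le> (\<Sum>t\<in>F. (g t - f t)\<^sup>2)"
  obtains c \<delta> where "0 < \<delta>" "\<And>f. f \<in> C \<Longrightarrow> \<delta> \<le> (\<Sum>t\<in>F. c t * (g t - f t))"
proof -
  define N where "N f = (\<Sum>t\<in>F. (g t - f t)\<^sup>2)" for f
  define d where "d = Inf (N ` C)"
  have bel: "bdd_below (N ` C)" using far(2) unfolding N_def by (intro bdd_belowI2[of _ \<epsilon>]) auto
  have d: "\<epsilon> \<le> d" unfolding d_def using ne far(2) by (intro cInf_greatest) (auto simp: N_def)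
  have dle: "d \<le> N f" if "f \<in> C" for f unfolding d_def using bel that by (intro cInf_lower) auto
  define D where "D = (\<Sum>t\<in>F. (2 * B t)\<^sup>2)"
  have D0: "0 \<le> D" unfolding D_def by (intro sum_nonneg) auto
  \<comment> \<open>Chosen so that the quadratic term s^2 D of the step is at most s d/2. The
    tolerance allowed for f0 is also s d/2, and together they leave the gap d/2.\<close>
  define s where "s = min 1 (d / (2 * (D + 1)))"
  have s: "0 < s" "s \<le> 1" unfolding s_def using d far(1) D0 by auto
  have sD: "s * D \<le> d / 2"
  proof -
    have "s * D \<le> d / (2 * (D + 1)) * D" unfolding s_def using D0 by (intro mult_right_mono) auto
    also have "\<dots> = d / 2 * (D / (D + 1))" by simp
    also have "\<dots> \<le> d / 2 * 1" using D0 d far(1) by (intro mult_left_mono) auto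
    finally show ?thesis by simp
  qed
  obtain f0 where f0: "f0 \<in> C" "N f0 < d + s * d / 2"
  proof -
    have "\<exists>x\<in>N ` C. x < d + s * d / 2"
      using cInf_lessD[of "N ` C" "d + s * d / 2"] ne s d far(1) unfolding d_def[symmetric] by auto
    then show ?thesis using that by auto
  qed
  define c where "c t = g t - f0 t" for t
  have "d / 2 \<le> (\<Sum>t\<in>F. c t * (g t - f t))" if f: "f \<in> C" for f
  proof -
    define e where "e t = f t - f0 t" for t
    define a where "a = (\<Sum>t\<in>F. c t * e t)"
    have "(\<Sum>t\<in>F. (e t)\<^sup>2) \<le> D"
      unfolding D_def
    proof (intro sum_mono)
      fix t assume "t \<in> F"
      then have "\<bar>e t\<bar> \<le> 2 * B t" using bdd[OF f] bdd[OF f0(1)] unfolding e_def by (smt (verit))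
      then show "(e t)\<^sup>2 \<le> (2 * B t)\<^sup>2" by (metis abs_ge_zero power2_abs power_mono)
    qed
    then have e2: "s\<^sup>2 * (\<Sum>t\<in>F. (e t)\<^sup>2) \<le> s\<^sup>2 * D" by (intro mult_left_mono) auto
    have "d \<le> N (\<lambda>t. s * f t + (1 - s) * f0 t)" using conv[OF f f0(1)] s by (intro dle) auto
    also have "\<dots> = N f0 - 2 * s * a + s\<^sup>2 * (\<Sum>t\<in>F. (e t)\<^sup>2)"
    proof -
      have "(g t - (s * f t + (1 - s) * f0 t))\<^sup>2 = (g t - f0 t)\<^sup>2 - 2 * s * (c t * e t) + s\<^sup>2 * (e t)\<^sup>2" for t
        unfolding c_def e_def by (simp add: power2_eq_square algebra_simps)
      then show ?thesis unfolding N_def a_def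
        by (simp add: sum.distrib sum_subtractf sum_distrib_left)
    qed
    also have "\<dots> \<le> d + s * d / 2 - 2 * s * a + s\<^sup>2 * D" using f0(2) e2 by simp
    also have "s\<^sup>2 * D \<le> s * (d / 2)"
      using mult_left_mono[OF sD, of s] s by (simp add: power2_eq_square)
    finally have "s * (2 * a) \<le> s * d" by (simp add: algebra_simps)
    then have a: "a \<le> d / 2" using s by simp
    have "(\<Sum>t\<in>F. c t * (g t - f t)) = N f0 - a"
      unfolding N_def a_def c_def e_def by (simp add: power2_eq_square algebra_simps flip: sum_subtractf)
    then show ?thesis using a dle[OF f0(1)] by simp
  qed
  then show ?thesis using that[of "d / 2" c] d far(1) by auto
qed

text \<open>Separation yields an affine inequality, whereas the dual cone is about linear ones.
  Since g and all harmonic functions equal 1 at t = 1, the constant \<kappa> can be moved into the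
  coefficient of the node 1, which is why the grid has to contain it.\<close>

lemma op_mean_fun_approx:
  assumes g: "op_mean_fun g" and F: "finite F" "F \<subseteq> {0<..}" "card F = 2 * m + 1" "1 \<in> F" and e: "0 < \<epsilon>"
  shows "\<exists>f. harm_comb f \<and> (\<Sum>t\<in>F. (g t - Re (f (of_real t)))\<^sup>2) < \<epsilon>"
proof (rule ccontr)
  assume contr: "\<not> ?thesis"
  define ev where "ev f t = Re (f (complex_of_real t))" for f :: "complex \<Rightarrow> complex" and t
  obtain c \<delta> where d: "0 < \<delta>" and c: "\<And>f. f \<in> ev ` Collect harm_comb \<Longrightarrow> \<delta> \<le> (\<Sum>t\<in>F. c t * (g t - f t))"
  proof (rule approx_or_separate[of F "ev ` Collect harm_comb" "\<lambda>t. 1 + t" \<epsilon> g])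
    show "ev ` Collect harm_comb \<noteq> {}" using harm_comb.harm[of 0] by auto
    show "(\<lambda>t. u * f t + (1 - u) * h t) \<in> ev ` Collect harm_comb"
      if "f \<in> ev ` Collect harm_comb" "h \<in> ev ` Collect harm_comb" "0 \<le> u" "u \<le> 1" for f h u
    proof -
      from that(1,2) obtain f' h' where fh: "f = ev f'" "harm_comb f'" "h = ev h'" "harm_comb h'" by auto
      have "(\<lambda>t. u * f t + (1 - u) * h t) = ev (\<lambda>z. of_real u * f' z + of_real (1 - u) * h' z)"
        unfolding fh ev_def by (simp del: of_real_diff)
      then show ?thesis using harm_comb.comb[OF fh(2,4) that(3,4)] by blast
    qed
    show "\<bar>f t\<bar> \<le> 1 + t" if "f \<in> ev ` Collect harm_comb" "t \<in> F" for f t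
      using that F(2) harm_comb_real(2) unfolding ev_def by auto
    show "\<epsilon> \<le> (\<Sum>t\<in>F. (g t - f t)\<^sup>2)" if "f \<in> ev ` Collect harm_comb" for f
      using that contr unfolding ev_def by (auto simp: not_less)
  qed (use F e in auto)
  have ch: "(\<Sum>t\<in>F. c t * (t / (s * t + (1 - s)))) \<le> (\<Sum>t\<in>F. c t * g t) - \<delta>" if "0 \<le> s" "s \<le> 1" for s
  proof -
    have "\<delta> \<le> (\<Sum>t\<in>F. c t * (g t - ev (harm s) t))" using c harm_comb.harm[OF that] by blast
    then show ?thesis unfolding ev_def harm_of_real by (simp add: right_diff_distrib sum_subtractf)
  qed
  define \<kappa> where "\<kappa> = (\<Sum>t\<in>F. c t * g t) - \<delta>"
  define c' where "c' t = (if t = 1 then \<kappa> else 0) - c t" for t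
  have c': "(\<Sum>t\<in>F. c' t * h t) = \<kappa> * h 1 - (\<Sum>t\<in>F. c t * h t)" for h
  proof -
    have "(\<Sum>t\<in>F. c' t * h t) = (\<Sum>t\<in>F. (if t = 1 then \<kappa> * h 1 else 0) - c t * h t)"
      unfolding c'_def by (intro sum.cong) (auto simp: left_diff_distrib)
    then show ?thesis using F by (simp add: sum_subtractf)
  qed
  have "0 \<le> (\<Sum>t\<in>F. c' t * g t)"
  proof (rule op_mean_fun_dual_cone[OF g F(1-3)])
    fix s :: real assume "0 \<le> s" "s \<le> 1"
    then show "0 \<le> (\<Sum>t\<in>F. c' t * (t / (s * t + (1 - s))))"
      using ch[of s] unfolding c' \<kappa>_def by simp
  qed
  also have "\<dots> = - \<delta>" unfolding c' \<kappa>_def using g unfolding op_mean_fun_def by simp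
  finally show False using d by simp
qed

section \<open>Dyadic grids and the limit function\<close>

text \<open>The number of nodes is odd, as the dual cone demands; with growing k the mesh tends to 0
  and the right end to infinity.\<close>

definition dyadic_grid :: "nat \<Rightarrow> real set" where
  "dyadic_grid k = (\<lambda>j. real (Suc j) / 2 ^ k) ` {..<2 * 4 ^ k + 1}"

lemma dyadic_grid:
  "finite (dyadic_grid k)" "dyadic_grid k \<subseteq> {0<..}" "card (dyadic_grid k) = 2 * 4 ^ k + 1" "1 \<in> dyadic_grid k"
proof -
  show "card (dyadic_grid k) = 2 * 4 ^ k + 1"
    unfolding dyadic_grid_def by (subst card_image) (auto intro!: inj_onI)
  have "(2::nat) ^ k \<le> 4 ^ k" by (intro power_mono) auto
  then have "2 ^ k - 1 < 2 * 4 ^ k + (1::nat)" by linarith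
  moreover have "real (Suc (2 ^ k - 1)) / 2 ^ k = 1" by simp
  ultimately show "1 \<in> dyadic_grid k"
    unfolding dyadic_grid_def by (intro image_eqI[of _ _ "2 ^ k - 1"]) auto
qed (auto simp: dyadic_grid_def)

text \<open>Over the common denominator 2^k the numerator is p 2^(k-q), which is at most 4^k because
  p < 2^k.\<close>

lemma eventually_in_dyadic_grid:
  assumes "0 < p"
  shows "\<forall>k\<ge>p + q. real p / 2 ^ q \<in> dyadic_grid k"
proof (intro allI impI)
  fix k assume k: "p + q \<le> k"
  have "p < 2 ^ k" using k less_exp[of k] by linarith
  moreover have "(2::nat) ^ (k - q) \<le> 2 ^ k" by (intro power_increasing) auto
  ultimately have "p * 2 ^ (k - q) \<le> 2 ^ k * (2 ^ k::nat)" by (intro mult_mono) auto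
  also have "2 ^ k * (2 ^ k::nat) = 4 ^ k" by (simp flip: power_mult_distrib)
  finally have "p * 2 ^ (k - q) - 1 < 2 * 4 ^ k + 1" by linarith
  moreover have "real p / 2 ^ q = real (Suc (p * 2 ^ (k - q) - 1)) / 2 ^ k"
  proof -
    have "(2::real) ^ k = 2 ^ (k - q) * 2 ^ q" using k by (simp flip: power_add)
    then show ?thesis using assms by simp
  qed
  ultimately show "real p / 2 ^ q \<in> dyadic_grid k" unfolding dyadic_grid_def by auto
qed

theorem op_mean_fun_loewner:
  assumes g: "op_mean_fun g"
  obtains G where "loewner_fun G" "\<And>x. 0 < x \<Longrightarrow> G (of_real x) = of_real (g x)"
proof -
  have om: "operator_monotone g" using g unfolding op_mean_fun_def by auto
  \<comment> \<open>The squared errors are summed over the grid, so a total below the square of 2^-k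
    puts every node within 2^-k.\<close>
  have "\<exists>f. harm_comb f \<and> (\<Sum>t\<in>dyadic_grid k. (g t - Re (f (of_real t)))\<^sup>2) < ((1/2) ^ k)\<^sup>2" for k
    by (rule op_mean_fun_approx[OF g dyadic_grid]) simp
  then obtain f where f: "\<And>k. harm_comb (f k)"
    and fg: "\<And>k. (\<Sum>t\<in>dyadic_grid k. (g t - Re (f k (of_real t)))\<^sup>2) < ((1/2) ^ k)\<^sup>2"
    by metis
  have close: "\<bar>g t - Re (f k (of_real t))\<bar> \<le> (1/2) ^ k" if "t \<in> dyadic_grid k" for t k
  proof -
    have "(g t - Re (f k (of_real t)))\<^sup>2 \<le> (\<Sum>t\<in>dyadic_grid k. (g t - Re (f k (of_real t)))\<^sup>2)"
      using that dyadic_grid(1) by (intro member_le_sum) auto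
    then have "(g t - Re (f k (of_real t)))\<^sup>2 \<le> ((1/2) ^ k)\<^sup>2" using fg[of k] by simp
    then show ?thesis by (simp add: abs_le_square_iff[symmetric])
  qed
  obtain G r where G: "G holomorphic_on slit_plane" "strict_mono (r :: nat \<Rightarrow> nat)"
      "\<And>x. x \<in> slit_plane \<Longrightarrow> ((\<lambda>n. f (r n) x) \<longlongrightarrow> G x) sequentially"
      "\<And>K. \<lbrakk>compact K; K \<subseteq> slit_plane\<rbrakk> \<Longrightarrow> uniform_limit K (f \<circ> r) G sequentially"
    using Montel[of slit_plane "Collect harm_comb" f] open_slit_plane harm_comb_holomorphic
      harm_comb_locally_bounded f by (smt (verit) image_subset_iff mem_Collect_eq)
  have lf: "loewner_fun G"
    unfolding loewner_fun_def using G f by (intro conjI exI[of _ "f \<circ> r"]) auto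
  have lim: "(\<lambda>k. f (r k) (of_real x)) \<longlonglongrightarrow> G (of_real x)" if "0 < x" for x
    using G(3)[OF of_real_in_slit_plane[OF that]] .
  have Im0: "Im (G (of_real x)) = 0" if "0 < x" for x
  proof -
    have "(\<lambda>k. Im (f (r k) (of_real x))) \<longlonglongrightarrow> Im (G (of_real x))" by (intro tendsto_intros lim that)
    moreover have "Im (f (r k) (of_real x)) = 0" for k
      using harm_comb_real(1)[OF f that, of "r k"] by (metis Im_complex_of_real)
    ultimately show ?thesis by (simp add: LIMSEQ_const_iff)
  qed
  have dyadic: "Re (G (of_real (real p / 2 ^ q))) = g (real p / 2 ^ q)" if "0 < p" for p q
  proof -
    let ?t = "real p / 2 ^ q"
    have "(\<lambda>k. Re (f (r k) (of_real ?t))) \<longlonglongrightarrow> Re (G (of_real ?t))"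
      using that by (intro tendsto_intros lim) auto
    moreover have "(\<lambda>k. Re (f (r k) (of_real ?t))) \<longlonglongrightarrow> g ?t"
    proof (rule LIMSEQ_I)
      fix e :: real assume "0 < e"
      then obtain N where N: "(1/2::real) ^ N < e" using real_arch_pow_inv[of e "1/2"] by auto
      show "\<exists>no. \<forall>k\<ge>no. norm (Re (f (r k) (of_real ?t)) - g ?t) < e"
      proof (intro exI allI impI)
        fix k assume k: "N + p + q \<le> k"
        have rk: "k \<le> r k" using G(2) by (rule seq_suble)
        have "?t \<in> dyadic_grid (r k)" using eventually_in_dyadic_grid[OF that, of q] k rk by auto
        then have "\<bar>g ?t - Re (f (r k) (of_real ?t))\<bar> \<le> (1/2) ^ (r k)" by (rule close)
        also have "\<dots> \<le> (1/2) ^ N" using k rk by (intro power_decreasing) auto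
        finally show "norm (Re (f (r k) (of_real ?t)) - g ?t) < e" using N by simp
      qed
    qed
    ultimately show ?thesis by (rule LIMSEQ_unique)
  qed
  \<comment> \<open>Continuity of g is not known at this point. Monotonicity squeezes g x between
    dyadic values from below and above, where g agrees with the continuous function G.\<close>
  have Gg: "Re (G (of_real x)) = g x" if x: "0 < x" for x
  proof -
    have cont: "isCont (\<lambda>t. Re (G (of_real t))) x"
    proof -
      have "isCont G (of_real x)"
        using holomorphic_on_imp_continuous_on[OF G(1)] open_slit_plane of_real_in_slit_plane[OF x]
        by (simp add: continuous_on_eq_continuous_at)
      then have "isCont (\<lambda>t. G (of_real t)) x"
        using isCont_o2[of x of_real G] by simp
      then show ?thesis by (rule isCont_Re)
    qed
    define n where "n k = nat \<lfloor>2 ^ k * x\<rfloor>" for k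
    have nr: "real (n k) = of_int \<lfloor>2 ^ k * x\<rfloor>" for k using x unfolding n_def by simp
    have lo: "real (n k) / 2 ^ k \<le> x" for k
      unfolding nr by (simp add: divide_le_eq mult.commute)
    have hi: "x \<le> real (Suc (n k)) / 2 ^ k" for k
    proof -
      have "x * 2 ^ k \<le> real (Suc (n k))" using nr[of k] by (simp add: mult.commute) linarith
      then show ?thesis by (subst le_divide_eq) (auto simp del: of_nat_Suc)
    qed
    have z: "(\<lambda>k. 1 / 2 ^ k :: real) \<longlonglongrightarrow> 0"
      using LIMSEQ_power_zero[of "1/2::real"] by (simp add: power_one_over)
    have hilim: "(\<lambda>k. real (Suc (n k)) / 2 ^ k) \<longlonglongrightarrow> x"
    proof (rule tendsto_sandwich[of "\<lambda>k. x" _ _ "\<lambda>k. x + 1 / 2 ^ k"])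
      show "\<forall>\<^sub>F k in sequentially. real (Suc (n k)) / 2 ^ k \<le> x + 1 / 2 ^ k"
        using lo by (simp add: add_divide_distrib)
      show "(\<lambda>k. x + 1 / 2 ^ k) \<longlonglongrightarrow> x" using tendsto_add[OF tendsto_const z, of x] by simp
    qed (use hi in auto)
    have lolim: "(\<lambda>k. real (n k) / 2 ^ k) \<longlonglongrightarrow> x"
      using tendsto_diff[OF hilim z] by (simp add: diff_divide_distrib[symmetric])
    have "Re (G (of_real x)) \<le> g x"
    proof (rule tendsto_upperbound)
      show "(\<lambda>k. Re (G (of_real (real (n k) / 2 ^ k)))) \<longlonglongrightarrow> Re (G (of_real x))"
        by (rule isCont_tendsto_compose[OF cont lolim])
      have "\<forall>\<^sub>F k in sequentially. 0 < real (n k) / 2 ^ k" using order_tendstoD(1)[OF lolim x] .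
      then show "\<forall>\<^sub>F k in sequentially. Re (G (of_real (real (n k) / 2 ^ k))) \<le> g x"
      proof eventually_elim
        case (elim k)
        then have n: "0 < n k" by (auto simp: zero_less_divide_iff)
        show ?case
          unfolding dyadic[OF n] by (rule operator_monotone_mono[OF om elim lo])
      qed
    qed simp
    moreover have "g x \<le> Re (G (of_real x))"
    proof (rule tendsto_lowerbound)
      show "(\<lambda>k. Re (G (of_real (real (Suc (n k)) / 2 ^ k)))) \<longlonglongrightarrow> Re (G (of_real x))"
        by (rule isCont_tendsto_compose[OF cont hilim])
      have "g x \<le> Re (G (of_real (real (Suc (n k)) / 2 ^ k)))" for k
        unfolding dyadic[OF zero_less_Suc] by (rule operator_monotone_mono[OF om x hi])
      then show "\<forall>\<^sub>F k in sequentially. g x \<le> Re (G (of_real (real (Suc (n k)) / 2 ^ k)))" by simp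
    qed simp
    ultimately show ?thesis by simp
  qed
  show ?thesis
    by (rule that[OF lf]) (use Im0 Gg in \<open>auto simp: complex_eq_iff\<close>)
qed

text \<open>\<open>hol_ext\<close> is a choice among holomorphic extensions. The identity theorem,
  with 1 as a limit point of the positive axis, makes it agree with the Loewner limit on the slit
  plane, so it has the same approximants.\<close>

corollary hol_ext_loewner:
  assumes g: "op_mean_fun g"
  shows "loewner_fun (hol_ext g)" "\<And>x. 0 < x \<Longrightarrow> hol_ext g (of_real x) = of_real (g x)"
proof -
  obtain G where G: "loewner_fun G" "\<And>x. 0 < x \<Longrightarrow> G (of_real x) = of_real (g x)"
    by (rule op_mean_fun_loewner[OF g]) blast
  have Gh: "G holomorphic_on slit_plane" using G(1) unfolding loewner_fun_def by blast
  have "hol_ext g holomorphic_on slit_plane \<and> (\<forall>x>0. hol_ext g (of_real x) = of_real (g x))"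
    unfolding hol_ext_def by (rule someI[of _ G]) (use G Gh in auto)
  then have H: "hol_ext g holomorphic_on slit_plane" and Hg: "\<And>x. 0 < x \<Longrightarrow> hol_ext g (of_real x) = of_real (g x)"
    by auto
  show "\<And>x. 0 < x \<Longrightarrow> hol_ext g (of_real x) = of_real (g x)" by (rule Hg)
  have eq: "hol_ext g z = G z" if "z \<in> slit_plane" for z
  proof -
    have "(1::complex) islimpt of_real ` {0<..}"
      unfolding islimpt_sequential
    proof (intro exI conjI allI)
      fix k show "complex_of_real (1 + 1 / real (Suc k)) \<in> of_real ` {0<..} - {1}"
      proof -
        have "0 < 1 / real (Suc k)" by simp
        then have "1 + 1 / real (Suc k) \<in> {0<..}" "1 + 1 / real (Suc k) \<noteq> 1" by (simp only: greaterThan_iff, linarith)+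
        then show ?thesis by (metis DiffI imageI of_real_eq_1_iff singletonD)
      qed
      have "(\<lambda>k. 1 + 1 / real (Suc k)) \<longlonglongrightarrow> 1 + 0"
        by (intro tendsto_intros LIMSEQ_Suc lim_1_over_n)
      then show "(\<lambda>k. complex_of_real (1 + 1 / real (Suc k))) \<longlonglongrightarrow> 1"
        using tendsto_of_real[of "\<lambda>k. 1 + 1 / real (Suc k)" 1 sequentially, where 'a = complex] by simp
    qed
    then have lp: "(1::complex) islimpt of_real ` {0<..}" .
    have "hol_ext g z - G z = 0"
    proof (rule analytic_continuation[OF _ open_slit_plane connected_slit_plane _ _ lp _ that])
      show "(\<lambda>z. hol_ext g z - G z) holomorphic_on slit_plane" by (rule holomorphic_on_diff[OF H Gh])
      show "complex_of_real ` {0<..} \<subseteq> slit_plane" using of_real_in_slit_plane by blast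
      show "1 \<in> slit_plane" using of_real_in_slit_plane[of 1] by simp
      show "hol_ext g w - G w = 0" if "w \<in> of_real ` {0<..}" for w using that Hg G(2) by auto
    qed
    then show ?thesis by simp
  qed
  obtain f where f: "\<And>k. harm_comb (f k)" "\<And>K. compact K \<Longrightarrow> K \<subseteq> slit_plane \<Longrightarrow> uniform_limit K f G sequentially"
    using G(1) unfolding loewner_fun_def by blast
  have "uniform_limit K f (hol_ext g) sequentially" if "compact K" "K \<subseteq> slit_plane" for K
    using f(2)[OF that] eq that by (subst uniform_limit_cong'[where g = f and i = G]) auto
  then show "loewner_fun (hol_ext g)" unfolding loewner_fun_def using H f(1) by blast
qed

section \<open>Inverses, eigenvalues and contour integrals of poles\<close>

text \<open>\<open>mat_inverse\<close> answers \<open>None\<close> only for non-units, so a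
  one-sided inverse already determines \<open>minv\<close>.\<close>

lemma minv_eq:
  assumes "A \<in> carrier_mat n n" "B \<in> carrier_mat n n" "A * B = 1\<^sub>m n"
  shows "minv A = B"
proof -
  have BA: "B * A = 1\<^sub>m n" using mat_mult_left_right_inverse[OF assms] .
  show ?thesis
  proof (cases "mat_inverse A")
    case None
    have "A \<in> Units (ring_mat TYPE(complex) n ())"
      using assms BA unfolding Units_def by (auto simp: ring_mat_simps intro!: bexI[of _ B])
    then show ?thesis using mat_inverse(1)[OF assms(1) None, of "()"] by simp
  next
    case (Some C)
    then have C: "C * A = 1\<^sub>m n" "C \<in> carrier_mat n n" using mat_inverse(2)[OF assms(1)] by auto
    have "C = C * (A * B)" unfolding assms(3) using C(2) by (rule right_mult_one_mat[symmetric])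
    also have "\<dots> = (C * A) * B" by (rule assoc_mult_mat[OF C(2) assms(1,2), symmetric])
    also have "\<dots> = B" unfolding C(1) using assms(2) by (rule left_mult_one_mat)
    finally show ?thesis using Some unfolding minv_def by simp
  qed
qed

text \<open>The adjugate formula is recorded because it exhibits the entries of the resolvent as
  quotients of determinants.\<close>

lemma minv_inverse:
  assumes A: "A \<in> carrier_mat n n" and d: "det A \<noteq> 0"
  shows "minv A \<in> carrier_mat n n" "A * minv A = 1\<^sub>m n" "minv A * A = 1\<^sub>m n"
    "minv A = (1 / det A) \<cdot>\<^sub>m adj_mat A"
proof -
  let ?B = "(1 / det A) \<cdot>\<^sub>m adj_mat A"
  have B: "?B \<in> carrier_mat n n" using adj_mat(1)[OF A] by simp
  have "A * ?B = (1 / det A) \<cdot>\<^sub>m (A * adj_mat A)"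
    using A adj_mat(1)[OF A] by (rule mult_smult_distrib)
  also have "\<dots> = 1\<^sub>m n" unfolding adj_mat(2)[OF A] using d by (intro eq_matI) auto
  finally have AB: "A * ?B = 1\<^sub>m n" .
  show eq: "minv A = ?B" by (rule minv_eq[OF A B AB])
  show "minv A \<in> carrier_mat n n" "A * minv A = 1\<^sub>m n" "minv A * A = 1\<^sub>m n"
    unfolding eq using B AB mat_mult_left_right_inverse[OF A B AB] by auto
qed

lemma det_nonzero_iff_ker:
  assumes A: "(A::complex mat) \<in> carrier_mat n n"
  shows "det A \<noteq> 0 \<longleftrightarrow> (\<forall>v\<in>carrier_vec n. A *\<^sub>v v = 0\<^sub>v n \<longrightarrow> v = 0\<^sub>v n)"
  using det_0_iff_vec_prod_zero_field[OF A] by blast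

lemma eigvals_iff:
  assumes T: "T \<in> carrier_mat n n"
  shows "z \<in> eigvals T \<longleftrightarrow> (\<exists>v\<in>carrier_vec n. v \<noteq> 0\<^sub>v n \<and> T *\<^sub>v v = z \<cdot>\<^sub>v v)"
proof -
  have c: "z \<cdot>\<^sub>m 1\<^sub>m n - T \<in> carrier_mat n n" using T by (rule minus_carrier_mat)
  have "(z \<cdot>\<^sub>m 1\<^sub>m n - T) *\<^sub>v v = 0\<^sub>v n \<longleftrightarrow> T *\<^sub>v v = z \<cdot>\<^sub>v v" if v: "v \<in> carrier_vec n" for v
  proof -
    have "(z \<cdot>\<^sub>m 1\<^sub>m n - T) *\<^sub>v v = (z \<cdot>\<^sub>m 1\<^sub>m n) *\<^sub>v v - T *\<^sub>v v"
      by (rule minus_mult_distrib_mat_vec[of _ n n]) (use T v in auto)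
    also have "(z \<cdot>\<^sub>m 1\<^sub>m n) *\<^sub>v v = z \<cdot>\<^sub>v v"
      using v by (intro eq_vecI) (auto simp: scalar_prod_def if_distrib if_distribR cong: if_cong)
    finally have eq: "(z \<cdot>\<^sub>m 1\<^sub>m n - T) *\<^sub>v v = z \<cdot>\<^sub>v v - T *\<^sub>v v" .
    have Tv: "T *\<^sub>v v \<in> carrier_vec n" using T v by simp
    show ?thesis unfolding eq
    proof
      assume 0: "z \<cdot>\<^sub>v v - T *\<^sub>v v = 0\<^sub>v n"
      show "T *\<^sub>v v = z \<cdot>\<^sub>v v"
      proof (rule eq_vecI)
        fix i assume "i < dim_vec (z \<cdot>\<^sub>v v)"
        then show "(T *\<^sub>v v) $ i = (z \<cdot>\<^sub>v v) $ i"
          using arg_cong[OF 0, of "\<lambda>w. vec_index w i"] v Tv by (metis carrier_vecD eq_iff_diff_eq_0 index_minus_vec(1) index_smult_vec(2) index_zero_vec(1))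
      qed (use v T in auto)
    next
      assume "T *\<^sub>v v = z \<cdot>\<^sub>v v"
      then show "z \<cdot>\<^sub>v v - T *\<^sub>v v = 0\<^sub>v n" using v by auto
    qed
  qed
  then show ?thesis using T det_0_iff_vec_prod_zero_field[OF c] unfolding eigvals_def by auto
qed

lemma finite_eigvals:
  assumes T: "T \<in> carrier_mat n n"
  shows "finite (eigvals T)"
proof -
  have "eigvals T \<subseteq> {z. poly (char_poly T) z = 0}"
    using T eigvals_iff[OF T] eigenvalue_root_char_poly[OF T] unfolding eigenvalue_def eigenvector_def by auto
  moreover have "char_poly T \<noteq> 0" using degree_monic_char_poly[OF T] by auto
  ultimately show ?thesis using poly_roots_finite finite_subset by blast
qed

section \<open>Cayley-Hamilton as an ordered product\<close>

primrec shift_prod :: "nat \<Rightarrow> complex mat \<Rightarrow> (nat \<Rightarrow> complex) \<Rightarrow> nat \<Rightarrow> complex mat" where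
  "shift_prod n T e 0 = 1\<^sub>m n"
| "shift_prod n T e (Suc m) = shift_prod n T e m * (T - e m \<cdot>\<^sub>m 1\<^sub>m n)"

lemma shift_carrier [simp]: "T \<in> carrier_mat n n \<Longrightarrow> T - c \<cdot>\<^sub>m 1\<^sub>m n \<in> carrier_mat n n"
  by (rule minus_carrier_mat) simp

lemma shift_prod_carrier [simp]: "T \<in> carrier_mat n n \<Longrightarrow> shift_prod n T e m \<in> carrier_mat n n"
  by (induction m) simp_all

text \<open>In triangular Schur form a product of m shifted factors has its first m columns zero,
  and similarity carries this back to T. The product form is kept because the defect argument
  removes one factor T - e at a time.\<close>

lemma cayley_hamilton_eigenvalues:
  assumes T: "T \<in> carrier_mat n n"
  obtains e where "\<And>i. i < n \<Longrightarrow> e i \<in> eigvals T" "shift_prod n T e n = 0\<^sub>m n n"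
proof -
  obtain es where es: "char_poly T = (\<Prod>a\<leftarrow>es. [:- a, 1:])" "length es = n"
    using char_poly_factorized[OF T] by blast
  obtain B P Q where sd: "schur_decomposition T es = (B, P, Q)" by (cases "schur_decomposition T es")
  from schur_decomposition[OF T es(1) sd]
  have sim: "similar_mat_wit T B P Q" and ut: "upper_triangular B" and dg: "diag_mat B = es" by auto
  note w = similar_mat_witD2[OF T sim]
  define e where "e i = es ! i" for i
  have Bii: "B $$ (i,i) = e i" if "i < n" for i
    using dg that w(5) es(2) unfolding e_def diag_mat_def by (auto simp: nth_map)
  have zero: "shift_prod n B e m $$ (i,j) = 0" if "i < n" "j < m" "m \<le> n" for i j m
    using that
  proof (induction m arbitrary: j)
    case (Suc m)
    have "shift_prod n B e (Suc m) $$ (i,j) = (\<Sum>l<n. shift_prod n B e m $$ (i,l) * (B - e m \<cdot>\<^sub>m 1\<^sub>m n) $$ (l,j))"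
      using Suc.prems shift_prod_carrier[OF w(5), of e m] shift_carrier[OF w(5), of "e m"]
      by (auto simp: scalar_prod_def atLeast0LessThan intro!: sum.cong)
    also have "\<dots> = (\<Sum>l<n. 0)"
    proof (rule sum.cong)
      fix l assume "l \<in> {..<n}"
      then have l: "l < n" by simp
      show "shift_prod n B e m $$ (i,l) * (B - e m \<cdot>\<^sub>m 1\<^sub>m n) $$ (l,j) = 0"
      proof (cases "l < m")
        case True then show ?thesis using Suc.IH[of l] Suc.prems by simp
      next
        case False
        \<comment> \<open>With l \<ge> m and j \<le> m the entry (l,j) lies below the diagonal or is
          the diagonal entry that the shift by \<open>e m\<close> cancels.\<close>
        then have "j < l \<or> (j = l \<and> l = m)" using Suc.prems by auto
        then have "(B - e m \<cdot>\<^sub>m 1\<^sub>m n) $$ (l,j) = 0"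
          using ut w(5) l Suc.prems Bii unfolding upper_triangular_def by auto
        then show ?thesis by simp
      qed
    qed simp
    finally show ?case by simp
  qed simp
  have Tconj: "shift_prod n T e m = P * shift_prod n B e m * Q" for m
  proof (induction m)
    case 0 then show ?case using w by (simp add: right_mult_one_mat[of _ n n])
  next
    case (Suc m)
    have "T - e m \<cdot>\<^sub>m 1\<^sub>m n = P * (B - e m \<cdot>\<^sub>m 1\<^sub>m n) * Q"
    proof -
      have "P * (B - e m \<cdot>\<^sub>m 1\<^sub>m n) * Q = (P * B - P * (e m \<cdot>\<^sub>m 1\<^sub>m n)) * Q"
        using w by (subst mult_minus_distrib_mat[of _ n n _ n]) auto
      also have "\<dots> = P * B * Q - P * (e m \<cdot>\<^sub>m 1\<^sub>m n) * Q"
        using w by (subst minus_mult_distrib_mat[of _ n n _ _ n]) auto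
      also have "P * (e m \<cdot>\<^sub>m 1\<^sub>m n) = e m \<cdot>\<^sub>m P"
        using w by (subst mult_smult_distrib[of _ n n _ n]) auto
      also have "e m \<cdot>\<^sub>m P * Q = e m \<cdot>\<^sub>m 1\<^sub>m n"
        using w by (subst mult_smult_assoc_mat[of _ n n _ n]) auto
      finally show ?thesis using w by simp
    qed
    then have "shift_prod n T e (Suc m) = P * shift_prod n B e m * Q * (P * (B - e m \<cdot>\<^sub>m 1\<^sub>m n) * Q)"
      using Suc.IH by simp
    also have "\<dots> = P * shift_prod n B e m * (Q * P) * (B - e m \<cdot>\<^sub>m 1\<^sub>m n) * Q"
      using w(5,6,7) by (simp add: assoc_mult_mat[of _ n n _ n _ n])
    also have "\<dots> = P * shift_prod n B e (Suc m) * Q"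
      using w by (simp add: assoc_mult_mat[of _ n n _ n _ n] left_mult_one_mat[of _ n n])
    finally show ?case .
  qed
  have "shift_prod n B e n = 0\<^sub>m n n"
    using zero shift_prod_carrier[OF w(5), of e n] by (intro eq_matI) auto
  then have "shift_prod n T e n = 0\<^sub>m n n" unfolding Tconj using w by simp
  moreover have "e i \<in> eigvals T" if "i < n" for i
  proof -
    have "e i \<in> set es" using that es(2) unfolding e_def by auto
    then have "poly (char_poly T) (e i) = 0" unfolding es(1) by (auto simp: poly_prod_list prod_list_zero_iff image_iff intro!: bexI[of _ "e i"])
    then have "eigenvalue T (e i)" using eigenvalue_root_char_poly[OF T] by simp
    then show ?thesis using T eigvals_iff[OF T] unfolding eigenvalue_def eigenvector_def by auto
  qed
  ultimately show ?thesis using that by blast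
qed

text \<open>A holomorphic \<open>f\<close> equals \<open>f e + (z - e) h z\<close> with \<open>h\<close> holomorphic; iterating over all eigenvalues,
  any functional calculus defect that transforms by the factor \<open>T - e\<close> is killed by Cayley-Hamilton.\<close>
lemma calculus_defect_vanishes:
  assumes T: "T \<in> carrier_mat n n" and S: "open S" "eigvals T \<subseteq> S"
    and E: "\<And>f. f holomorphic_on S \<Longrightarrow> E f \<in> carrier_mat n n"
    and step: "\<And>h c e. h holomorphic_on S \<Longrightarrow> e \<in> S \<Longrightarrow> E (\<lambda>z. c + (z - e) * h z) = (T - e \<cdot>\<^sub>m 1\<^sub>m n) * E h"
    and f: "f holomorphic_on S"
  shows "E f = 0\<^sub>m n n"
proof -
  obtain e where e: "\<And>i. i < n \<Longrightarrow> e i \<in> eigvals T" "shift_prod n T e n = 0\<^sub>m n n"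
    by (rule cayley_hamilton_eigenvalues[OF T]) blast
  have "\<exists>h. h holomorphic_on S \<and> E f = shift_prod n T e m * E h" if "m \<le> n" for m
    using that
  proof (induction m)
    case 0
    then show ?case using f E[OF f] by (intro exI[of _ f]) (simp add: left_mult_one_mat[of _ n n])
  next
    case (Suc m)
    then obtain h where h: "h holomorphic_on S" "E f = shift_prod n T e m * E h" by auto
    have em: "e m \<in> S" using e(1) S(2) Suc.prems by auto
    define k where "k z = (if z = e m then deriv h (e m) else (h z - h (e m)) / (z - e m))" for z
    have k: "k holomorphic_on S"
      using pole_lemma[OF h(1), of "e m"] em S(1) unfolding k_def by (simp add: interior_open)
    have "h = (\<lambda>z. h (e m) + (z - e m) * k z)" unfolding k_def by auto
    then have "E h = (T - e m \<cdot>\<^sub>m 1\<^sub>m n) * E k" using step[OF k em] by metis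
    then have "E f = shift_prod n T e (Suc m) * E k"
      using h(2) E[OF k] shift_prod_carrier[OF T, of e m] shift_carrier[OF T, of "e m"]
      by (simp add: assoc_mult_mat[of _ n n _ n _ n])
    then show ?case using k by blast
  qed
  then obtain h where "h holomorphic_on S" "E f = shift_prod n T e n * E h" by blast
  then show ?thesis using e(2) E[of h] by simp
qed

text \<open>Induction on the number of poles. For distinct poles a and b, 1/((z - a)(z - b)) = (1/(z
  - a) - 1/(z - b))/(a - b) leaves two products with one pole fewer; by induction their integrals
  agree, so the difference integrates to 0. A single pole of order at least 2 has a
  primitive.\<close>

lemma has_contour_integral_prod_poles:
  assumes g: "valid_path \<gamma>" "pathfinish \<gamma> = pathstart \<gamma>"
    and M: "M \<noteq> {#}" "\<And>e. e \<in># M \<Longrightarrow> e \<notin> path_image \<gamma> \<and> winding_number \<gamma> e = 1"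
  shows "((\<lambda>z. \<Prod>e\<in>#M. 1 / (z - e)) has_contour_integral (if size M = 1 then 2 * pi * \<i> else 0)) \<gamma>"
  using M
proof (induction "size M" arbitrary: M rule: less_induct)
  case less
  obtain a N where M: "M = add_mset a N" using less.prems(1) by (metis multiset_cases)
  have a: "a \<notin> path_image \<gamma>" "winding_number \<gamma> a = 1" using less.prems(2)[of a] M by auto
  show ?case
  proof (cases "N = {#}")
    case True
    then show ?thesis using has_contour_integral_winding_number[OF g(1) a(1)] a(2) M by simp
  next
    case False
    show ?thesis
    proof (cases "\<exists>b\<in>#N. b \<noteq> a")
      case True
      then obtain b N' where N: "N = add_mset b N'" and b: "b \<noteq> a" by (metis multi_member_split)
      define c where "c = (if size N = 1 then 2 * pi * \<i> else 0)"
      have hyp: "((\<lambda>z. \<Prod>e\<in>#K. 1 / (z - e)) has_contour_integral c) \<gamma>"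
        if "K \<noteq> {#}" "size K = size N" "set_mset K \<subseteq> set_mset M" for K
        unfolding c_def that(2)[symmetric] by (rule less.hyps) (use that M less.prems(2) in auto)
      have "((\<lambda>z. \<Prod>e\<in>#add_mset a N'. 1 / (z - e)) has_contour_integral c) \<gamma>"
        and "((\<lambda>z. \<Prod>e\<in>#add_mset b N'. 1 / (z - e)) has_contour_integral c) \<gamma>"
        by (rule hyp; use M N in auto)+
      from has_contour_integral_lmul[OF has_contour_integral_diff[OF this], of "1 / (a - b)"]
      have "((\<lambda>z. 1 / (a - b) * ((\<Prod>e\<in>#add_mset a N'. 1 / (z - e)) - (\<Prod>e\<in>#add_mset b N'. 1 / (z - e)))) has_contour_integral 0) \<gamma>"
        by simp
      then have "((\<lambda>z. \<Prod>e\<in>#M. 1 / (z - e)) has_contour_integral 0) \<gamma>"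
      proof (rule has_contour_integral_eq)
        fix z assume z: "z \<in> path_image \<gamma>"
        have "z \<noteq> a" "z \<noteq> b" using z a less.prems(2)[of b] M N by auto
        then have "1 / (a - b) * (1 / (z - a) - 1 / (z - b)) = 1 / (z - a) * (1 / (z - b))"
          using b by (simp add: divide_simps)
        then show "1 / (a - b) * ((\<Prod>e\<in>#add_mset a N'. 1 / (z - e)) - (\<Prod>e\<in>#add_mset b N'. 1 / (z - e))) = (\<Prod>e\<in>#M. 1 / (z - e))"
          unfolding M N by (simp only: image_mset_add_mset prod_mset.add_mset mult.assoc[symmetric] left_diff_distrib[symmetric])
      qed
      moreover have "size M \<noteq> 1" using M N by simp
      ultimately show ?thesis by simp
    next
      case same: False
      define k where "k = size N"
      have k: "0 < k" unfolding k_def using False by (simp add: nonempty_has_size)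
      have N: "N = replicate_mset k a" unfolding k_def using same by (metis set_mset_subset_singletonD subsetI singletonI)
      have "((\<lambda>z. 1 / (z - a) ^ Suc k) has_contour_integral 0) \<gamma>"
      proof (rule Cauchy_theorem_primitive[where S = "- {a}", OF _ g(1) _ g(2)])
        fix z assume z: "z \<in> - {a}"
        show "((\<lambda>z. - 1 / (of_nat k * (z - a) ^ k)) has_field_derivative 1 / (z - a) ^ Suc k) (at z within - {a})"
          using z k by (auto intro!: derivative_eq_intros simp: divide_simps) (cases k; simp add: algebra_simps)
      qed (use a in auto)
      moreover have "(\<Prod>e\<in>#M. 1 / (z - e)) = 1 / (z - a) ^ Suc k" for z
        unfolding M N by (simp add: power_one_over)
      moreover have "size M \<noteq> 1" using M N k by simp
      ultimately show ?thesis by simp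
    qed
  qed
qed

section \<open>Holomorphic functional calculus\<close>

text \<open>The condition under the choice in \<open>hol_calc slit_plane\<close>, named so that the
  laws can be proved for every admissible path; \<open>path_calc\<close> likewise takes the path as
  an argument.\<close>

definition calc_path :: "complex mat \<Rightarrow> (real \<Rightarrow> complex) \<Rightarrow> bool" where
  "calc_path T \<gamma> \<longleftrightarrow> valid_path \<gamma> \<and> pathfinish \<gamma> = pathstart \<gamma> \<and>
    path_image \<gamma> \<subseteq> slit_plane - eigvals T \<and>
    (\<forall>z \<in> eigvals T. winding_number \<gamma> z = 1) \<and>
    (\<forall>w. w \<notin> slit_plane \<longrightarrow> winding_number \<gamma> w = 0)"

definition path_calc :: "(real \<Rightarrow> complex) \<Rightarrow> (complex \<Rightarrow> complex) \<Rightarrow> complex mat \<Rightarrow> complex mat" where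
  "path_calc \<gamma> f T = (let n = dim_row T in Matrix.mat n n (\<lambda>(i,j). contour_integral \<gamma>
          (\<lambda>z. f z * minv (z \<cdot>\<^sub>m 1\<^sub>m n - T) $$ (i,j)) / (2 * of_real pi * \<i>)))"

lemma det_holomorphic:
  assumes M: "\<And>z. M z \<in> carrier_mat k k"
    and h: "\<And>i j. i < k \<Longrightarrow> j < k \<Longrightarrow> (\<lambda>z. M z $$ (i,j)) holomorphic_on S"
  shows "(\<lambda>z. det (M z)) holomorphic_on S"
proof -
  have eq: "(\<lambda>z. det (M z)) = (\<lambda>z. \<Sum>p\<in>{p. p permutes {0..<k}}. signof p * (\<Prod>i=0..<k. M z $$ (i, p i)))"
    using det_def'[OF M] by auto
  show ?thesis
    unfolding eq by (intro holomorphic_intros h) (auto simp: permutes_in_image)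
qed

lemma mult_mat_index_sum:
  assumes "A \<in> carrier_mat n m" "B \<in> carrier_mat m k" "i < n" "j < k"
  shows "(A * B) $$ (i,j) = (\<Sum>l<m. A $$ (i,l) * B $$ (l,j))"
  using assms by (auto simp: scalar_prod_def atLeast0LessThan intro!: sum.cong)

lemma one_smult_mat [simp]: "(1::complex) \<cdot>\<^sub>m A = A"
  by (intro eq_matI) auto

lemma char_mat_carrier [simp]: "T \<in> carrier_mat n n \<Longrightarrow> z \<cdot>\<^sub>m 1\<^sub>m n - T \<in> carrier_mat n n"
  by (rule minus_carrier_mat)

text \<open>Cramer's rule: each entry is a cofactor divided by the characteristic
  determinant.\<close>

lemma resolvent_holomorphic:
  assumes T: "T \<in> carrier_mat n n" and ij: "i < n" "j < n"
  shows "(\<lambda>z. minv (z \<cdot>\<^sub>m 1\<^sub>m n - T) $$ (i,j)) holomorphic_on - eigvals T"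
proof -
  have e: "(\<lambda>z. (z \<cdot>\<^sub>m 1\<^sub>m n - T) $$ (a,b)) holomorphic_on S" if "a < n" "b < n" for a b S
  proof -
    have "(\<lambda>z. (z \<cdot>\<^sub>m 1\<^sub>m n - T) $$ (a,b)) = (\<lambda>z. (if a = b then z else 0) - T $$ (a,b))"
      using T that by auto
    then show ?thesis by (cases "a = b") (auto intro!: holomorphic_intros)
  qed
  have nz: "det (z \<cdot>\<^sub>m 1\<^sub>m n - T) \<noteq> 0" if "z \<in> - eigvals T" for z
    using that T unfolding eigvals_def by auto
  have cof: "(\<lambda>z. cofactor (z \<cdot>\<^sub>m 1\<^sub>m n - T) j i) holomorphic_on - eigvals T"
    unfolding cofactor_def
  proof (intro holomorphic_intros det_holomorphic[where k = "n - 1"])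
    fix z show "mat_delete (z \<cdot>\<^sub>m 1\<^sub>m n - T) j i \<in> carrier_mat (n-1) (n-1)"
      using T unfolding mat_delete_def by auto
  next
    fix a b assume ab: "a < n - 1" "b < n - 1"
    define a' where "a' = (if a < j then a else Suc a)"
    define b' where "b' = (if b < i then b else Suc b)"
    have "(\<lambda>z. mat_delete (z \<cdot>\<^sub>m 1\<^sub>m n - T) j i $$ (a,b)) = (\<lambda>z. (z \<cdot>\<^sub>m 1\<^sub>m n - T) $$ (a',b'))"
      using ab T unfolding mat_delete_def a'_def b'_def by auto
    moreover have "a' < n" "b' < n" using ab unfolding a'_def b'_def by auto
    ultimately show "(\<lambda>z. mat_delete (z \<cdot>\<^sub>m 1\<^sub>m n - T) j i $$ (a,b)) holomorphic_on - eigvals T"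
      using e by simp
  qed
  have "(\<lambda>z. (1 / det (z \<cdot>\<^sub>m 1\<^sub>m n - T)) * cofactor (z \<cdot>\<^sub>m 1\<^sub>m n - T) j i) holomorphic_on - eigvals T"
    by (intro holomorphic_intros det_holomorphic[where k = n] cof e) (use nz T in auto)
  moreover have "minv (z \<cdot>\<^sub>m 1\<^sub>m n - T) $$ (i,j) = (1 / det (z \<cdot>\<^sub>m 1\<^sub>m n - T)) * cofactor (z \<cdot>\<^sub>m 1\<^sub>m n - T) j i"
    if "z \<in> - eigvals T" for z
    using minv_inverse(4)[OF char_mat_carrier[OF T, of z] nz[OF that]] ij T
    unfolding adj_mat_def by auto
  ultimately show ?thesis by (subst holomorphic_cong) auto
qed

context
  fixes n :: nat and T :: "complex mat"
  assumes T: "T \<in> carrier_mat n n"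
begin

lemma path_calc_carrier [simp]: "path_calc \<gamma> f T \<in> carrier_mat n n"
  using T unfolding path_calc_def by (simp add: Let_def)

lemma path_calc_dim [simp]: "dim_row (path_calc \<gamma> f T) = n" "dim_col (path_calc \<gamma> f T) = n"
  by (rule carrier_matD[OF path_calc_carrier])+

lemma path_calc_index: "i < n \<Longrightarrow> j < n \<Longrightarrow>
    path_calc \<gamma> f T $$ (i,j) = contour_integral \<gamma> (\<lambda>z. f z * minv (z \<cdot>\<^sub>m 1\<^sub>m n - T) $$ (i,j)) / (2 * of_real pi * \<i>)"
  using T unfolding path_calc_def by (simp add: Let_def)

lemma path_calc_integrable:
  assumes "calc_path T \<gamma>" "f holomorphic_on slit_plane - eigvals T" "i < n" "j < n"
  shows "(\<lambda>z. f z * minv (z \<cdot>\<^sub>m 1\<^sub>m n - T) $$ (i,j)) contour_integrable_on \<gamma>"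
proof (rule contour_integrable_holomorphic_simple)
  show "(\<lambda>z. f z * minv (z \<cdot>\<^sub>m 1\<^sub>m n - T) $$ (i,j)) holomorphic_on slit_plane - eigvals T"
    by (intro holomorphic_intros assms(2) holomorphic_on_subset[OF resolvent_holomorphic[OF T assms(3,4)]]) auto
  show "open (slit_plane - eigvals T)"
    using finite_eigvals[OF T] by (intro open_Diff open_slit_plane finite_imp_closed)
qed (use assms(1) in \<open>auto simp: calc_path_def\<close>)

lemma path_calc_linear:
  assumes "calc_path T \<gamma>" "f holomorphic_on slit_plane - eigvals T" "h holomorphic_on slit_plane - eigvals T"
  shows "path_calc \<gamma> (\<lambda>z. a * f z + b * h z) T = a \<cdot>\<^sub>m path_calc \<gamma> f T + b \<cdot>\<^sub>m path_calc \<gamma> h T"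
proof (rule eq_matI)
  fix i j assume "i < dim_row (a \<cdot>\<^sub>m path_calc \<gamma> f T + b \<cdot>\<^sub>m path_calc \<gamma> h T)"
    "j < dim_col (a \<cdot>\<^sub>m path_calc \<gamma> f T + b \<cdot>\<^sub>m path_calc \<gamma> h T)"
  then have ij: "i < n" "j < n" by auto
  have "contour_integral \<gamma> (\<lambda>z. (a * f z + b * h z) * minv (z \<cdot>\<^sub>m 1\<^sub>m n - T) $$ (i,j)) =
     contour_integral \<gamma> (\<lambda>z. a * (f z * minv (z \<cdot>\<^sub>m 1\<^sub>m n - T) $$ (i,j)) + b * (h z * minv (z \<cdot>\<^sub>m 1\<^sub>m n - T) $$ (i,j)))"
    by (intro arg_cong[where f = "contour_integral \<gamma>"] ext) (simp add: algebra_simps)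
  also have "\<dots> = a * contour_integral \<gamma> (\<lambda>z. f z * minv (z \<cdot>\<^sub>m 1\<^sub>m n - T) $$ (i,j))
      + b * contour_integral \<gamma> (\<lambda>z. h z * minv (z \<cdot>\<^sub>m 1\<^sub>m n - T) $$ (i,j))"
    using path_calc_integrable[OF assms(1,2) ij] path_calc_integrable[OF assms(1,3) ij]
    by (simp add: contour_integral_add contour_integral_lmul contour_integrable_lmul)
  finally show "path_calc \<gamma> (\<lambda>z. a * f z + b * h z) T $$ (i,j) = (a \<cdot>\<^sub>m path_calc \<gamma> f T + b \<cdot>\<^sub>m path_calc \<gamma> h T) $$ (i,j)"
    using ij path_calc_carrier[of \<gamma> f] path_calc_carrier[of \<gamma> h]
    by (simp add: path_calc_index add_divide_distrib)
qed (use path_calc_carrier[of \<gamma> f] path_calc_carrier[of \<gamma> h] path_calc_carrier[of \<gamma> "\<lambda>z. a * f z + b * h z"] in auto)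

text \<open>The resolvent identity (z - c) R(z) = 1 + (T - c) R(z), multiplied by f and integrated.
  Since f may have poles at eigenvalues, its own integral stays in the formula;
  \<open>path_calc_one\<close> depends on that term.\<close>

lemma path_calc_shift:
  assumes g: "calc_path T \<gamma>" and f: "f holomorphic_on slit_plane - eigvals T"
  shows "path_calc \<gamma> (\<lambda>z. (z - c) * f z) T =
    (contour_integral \<gamma> f / (2 * of_real pi * \<i>)) \<cdot>\<^sub>m 1\<^sub>m n + (T - c \<cdot>\<^sub>m 1\<^sub>m n) * path_calc \<gamma> f T"
proof (rule eq_matI)
  let ?R = "\<lambda>z. minv (z \<cdot>\<^sub>m 1\<^sub>m n - T)"
  let ?rhs = "(contour_integral \<gamma> f / (2 * of_real pi * \<i>)) \<cdot>\<^sub>m 1\<^sub>m n + (T - c \<cdot>\<^sub>m 1\<^sub>m n) * path_calc \<gamma> f T"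
  have rc: "?rhs \<in> carrier_mat n n" using shift_carrier[OF T, of c] by simp
  fix i j assume "i < dim_row ?rhs" "j < dim_col ?rhs"
  then have ij: "i < n" "j < n" using rc by auto
  have open': "open (slit_plane - eigvals T)"
    using finite_eigvals[OF T] by (intro open_Diff open_slit_plane finite_imp_closed)
  have fi: "f contour_integrable_on \<gamma>"
    using contour_integrable_holomorphic_simple[OF f open'] g unfolding calc_path_def by auto
  have *: "(z - c) * ?R z $$ (i,j) = (if i = j then 1 else 0) + (\<Sum>k<n. (T - c \<cdot>\<^sub>m 1\<^sub>m n) $$ (i,k) * ?R z $$ (k,j))"
    if z: "z \<in> path_image \<gamma>" for z
  proof -
    have "det (z \<cdot>\<^sub>m 1\<^sub>m n - T) \<noteq> 0" using z g T unfolding calc_path_def eigvals_def by auto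
    note R = minv_inverse[OF char_mat_carrier[OF T] this]
    have "(\<Sum>k<n. (z \<cdot>\<^sub>m 1\<^sub>m n - T) $$ (i,k) * ?R z $$ (k,j)) = ((z \<cdot>\<^sub>m 1\<^sub>m n - T) * ?R z) $$ (i,j)"
      by (rule mult_mat_index_sum[OF char_mat_carrier[OF T] R(1) ij, symmetric])
    also have "\<dots> = (if i = j then 1 else 0)" unfolding R(2) using ij by simp
    finally have 1: "(\<Sum>k<n. (z \<cdot>\<^sub>m 1\<^sub>m n - T) $$ (i,k) * ?R z $$ (k,j)) = (if i = j then 1 else 0)" .
    have "(\<Sum>k<n. (z \<cdot>\<^sub>m 1\<^sub>m n - T) $$ (i,k) * ?R z $$ (k,j)) + (\<Sum>k<n. (T - c \<cdot>\<^sub>m 1\<^sub>m n) $$ (i,k) * ?R z $$ (k,j))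
       = (\<Sum>k<n. if k = i then (z - c) * ?R z $$ (k,j) else 0)"
      unfolding sum.distrib[symmetric] using T ij by (intro sum.cong) (auto simp: algebra_simps)
    then show ?thesis using 1 ij by simp
  qed
  have gen: "y * (d + (\<Sum>k<n. a k * b k)) = d * y + (\<Sum>k<n. a k * (y * b k))" for y d :: complex and a b
    by (simp add: distrib_left sum_distrib_left mult_ac)
  have "contour_integral \<gamma> (\<lambda>z. (z - c) * f z * ?R z $$ (i,j)) =
    contour_integral \<gamma> (\<lambda>z. (if i = j then 1 else 0) * f z + (\<Sum>k<n. (T - c \<cdot>\<^sub>m 1\<^sub>m n) $$ (i,k) * (f z * ?R z $$ (k,j))))"
  proof (rule contour_integral_eq)
    fix z assume "z \<in> path_image \<gamma>"
    note zz = *[OF this]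
    have "(z - c) * f z * ?R z $$ (i,j) = f z * ((z - c) * ?R z $$ (i,j))" by (simp only: mult_ac)
    also have "\<dots> = f z * ((if i = j then 1 else 0) + (\<Sum>k<n. (T - c \<cdot>\<^sub>m 1\<^sub>m n) $$ (i,k) * ?R z $$ (k,j)))"
      unfolding zz ..
    finally show "(z - c) * f z * ?R z $$ (i,j) = (if i = j then 1 else 0) * f z + (\<Sum>k<n. (T - c \<cdot>\<^sub>m 1\<^sub>m n) $$ (i,k) * (f z * ?R z $$ (k,j)))"
      unfolding gen .
  qed
  also have "\<dots> = (if i = j then 1 else 0) * contour_integral \<gamma> f +
      (\<Sum>k<n. (T - c \<cdot>\<^sub>m 1\<^sub>m n) $$ (i,k) * contour_integral \<gamma> (\<lambda>z. f z * ?R z $$ (k,j)))"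
    using ij(2)
    by (intro contour_integral_unique has_contour_integral_add has_contour_integral_lmul has_contour_integral_sum
        has_contour_integral_integral fi path_calc_integrable[OF g f]) auto
  finally have "path_calc \<gamma> (\<lambda>z. (z - c) * f z) T $$ (i,j) = (if i = j then 1 else 0) * (contour_integral \<gamma> f / (2 * of_real pi * \<i>)) +
      (\<Sum>k<n. (T - c \<cdot>\<^sub>m 1\<^sub>m n) $$ (i,k) * path_calc \<gamma> f T $$ (k,j))"
    using ij by (simp only: path_calc_index[OF ij] add_divide_distrib sum_divide_distrib)
      (auto simp: path_calc_index simp del: index_minus_mat intro!: sum.cong)
  also have "(\<Sum>k<n. (T - c \<cdot>\<^sub>m 1\<^sub>m n) $$ (i,k) * path_calc \<gamma> f T $$ (k,j)) = ((T - c \<cdot>\<^sub>m 1\<^sub>m n) * path_calc \<gamma> f T) $$ (i,j)"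
    by (rule mult_mat_index_sum[OF shift_carrier[OF T] path_calc_carrier ij, symmetric])
  finally show "path_calc \<gamma> (\<lambda>z. (z - c) * f z) T $$ (i,j) = ?rhs $$ (i,j)"
    using ij shift_carrier[OF T, of c] path_calc_carrier[of \<gamma> f] by simp
next
  show "dim_row (path_calc \<gamma> (\<lambda>z. (z - c) * f z) T) = dim_row ((contour_integral \<gamma> f / (2 * of_real pi * \<i>)) \<cdot>\<^sub>m 1\<^sub>m n + (T - c \<cdot>\<^sub>m 1\<^sub>m n) * path_calc \<gamma> f T)"
    "dim_col (path_calc \<gamma> (\<lambda>z. (z - c) * f z) T) = dim_col ((contour_integral \<gamma> f / (2 * of_real pi * \<i>)) \<cdot>\<^sub>m 1\<^sub>m n + (T - c \<cdot>\<^sub>m 1\<^sub>m n) * path_calc \<gamma> f T)"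
    using path_calc_carrier[of \<gamma> "\<lambda>z. (z - c) * f z"] path_calc_carrier[of \<gamma> f] T by auto
qed

text \<open>The path is arbitrary, so an expansion at infinity is not at hand. Instead 1 = w 0
  starts a chain w m = (z - e m) w (m+1), where w m is the product of 1/(z - e k) over k < m. By
  \<open>path_calc_shift\<close> each link contributes the integral of w (m+1), which is 2 pi i for
  m = 0 and 0 afterwards, and Cayley-Hamilton kills the end of the chain.\<close>

lemma path_calc_one:
  assumes g: "calc_path T \<gamma>"
  shows "path_calc \<gamma> (\<lambda>z. 1) T = 1\<^sub>m n"
proof (cases "n = 0")
  case True
  then show ?thesis using path_calc_carrier[of \<gamma> "\<lambda>z. 1"] by (intro eq_matI) auto
next
  case False
  obtain e where e: "\<And>i. i < n \<Longrightarrow> e i \<in> eigvals T" "shift_prod n T e n = 0\<^sub>m n n"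
    by (rule cayley_hamilton_eigenvalues[OF T]) blast
  define w where "w m z = (\<Prod>k<m. 1 / (z - e k))" for m z
  have w: "w m holomorphic_on slit_plane - eigvals T" if "m \<le> n" for m
    unfolding w_def using e(1) that by (intro holomorphic_intros) force
  have wint: "contour_integral \<gamma> (w m) = (if m = 1 then 2 * of_real pi * \<i> else 0)" if "0 < m" "m \<le> n" for m
  proof -
    have "((\<lambda>z. \<Prod>a\<in>#image_mset e (mset_set {..<m}). 1 / (z - a)) has_contour_integral
        (if size (image_mset e (mset_set {..<m})) = 1 then 2 * pi * \<i> else 0)) \<gamma>"
      by (rule has_contour_integral_prod_poles)
        (use g e(1) that in \<open>auto simp: calc_path_def mset_set_empty_iff lessThan_empty_iff\<close>)
    moreover have "(\<Prod>a\<in>#image_mset e (mset_set {..<m}). 1 / (z - a)) = w m z" for z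
      unfolding w_def by (simp add: prod_unfold_prod_mset image_mset.compositionality comp_def)
    ultimately show ?thesis using contour_integral_unique by fastforce
  qed
  have rec: "path_calc \<gamma> (w m) T = (if m = 0 then 1 else 0) \<cdot>\<^sub>m 1\<^sub>m n + (T - e m \<cdot>\<^sub>m 1\<^sub>m n) * path_calc \<gamma> (w (Suc m)) T"
    if m: "m < n" for m
  proof -
    have "path_calc \<gamma> (w m) T = path_calc \<gamma> (\<lambda>z. (z - e m) * w (Suc m) z) T"
    proof (rule eq_matI)
      fix i j assume "i < dim_row (path_calc \<gamma> (\<lambda>z. (z - e m) * w (Suc m) z) T)" "j < dim_col (path_calc \<gamma> (\<lambda>z. (z - e m) * w (Suc m) z) T)"
      then have ij: "i < n" "j < n" using path_calc_carrier[of \<gamma> "\<lambda>z. (z - e m) * w (Suc m) z"] by auto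
      have "w m z = (z - e m) * w (Suc m) z" if "z \<in> path_image \<gamma>" for z
      proof -
        have "z \<noteq> e m" using that g e(1)[OF m] unfolding calc_path_def by auto
        then show ?thesis unfolding w_def by simp
      qed
      then show "path_calc \<gamma> (w m) T $$ (i,j) = path_calc \<gamma> (\<lambda>z. (z - e m) * w (Suc m) z) T $$ (i,j)"
        unfolding path_calc_index[OF ij] by (intro arg_cong2[of _ _ _ _ "(/)"] contour_integral_eq) auto
    qed (use path_calc_carrier[of \<gamma> "w m"] path_calc_carrier[of \<gamma> "\<lambda>z. (z - e m) * w (Suc m) z"] in auto)
    also have "\<dots> = (contour_integral \<gamma> (w (Suc m)) / (2 * of_real pi * \<i>)) \<cdot>\<^sub>m 1\<^sub>m n + (T - e m \<cdot>\<^sub>m 1\<^sub>m n) * path_calc \<gamma> (w (Suc m)) T"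
      using m by (intro path_calc_shift[OF g w]) simp
    finally show ?thesis using wint[of "Suc m"] m by simp
  qed
  have "path_calc \<gamma> (w 0) T = 1\<^sub>m n + shift_prod n T e m * path_calc \<gamma> (w m) T" if "0 < m" "m \<le> n" for m
    using that
  proof (induction m)
    case (Suc m)
    show ?case
    proof (cases "m = 0")
      case True
      then show ?thesis using rec[of 0] Suc.prems shift_carrier[OF T, of "e 0"]
        by (simp add: left_mult_one_mat[of _ n n] one_smult_mat)
    next
      case False
      then have "path_calc \<gamma> (w 0) T = 1\<^sub>m n + shift_prod n T e m * path_calc \<gamma> (w m) T"
        using Suc by simp
      also have "path_calc \<gamma> (w m) T = (T - e m \<cdot>\<^sub>m 1\<^sub>m n) * path_calc \<gamma> (w (Suc m)) T"
      proof -
        have "0 \<cdot>\<^sub>m 1\<^sub>m n = (0\<^sub>m n n :: complex mat)" by (intro eq_matI) auto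
        then show ?thesis using rec[of m] Suc.prems False shift_carrier[OF T, of "e m"] by simp
      qed
      also have "shift_prod n T e m * ((T - e m \<cdot>\<^sub>m 1\<^sub>m n) * path_calc \<gamma> (w (Suc m)) T) = shift_prod n T e (Suc m) * path_calc \<gamma> (w (Suc m)) T"
        using shift_carrier[OF T, of "e m"] shift_prod_carrier[OF T, of e m] by (simp add: assoc_mult_mat[of _ n n _ n _ n])
      finally show ?thesis .
    qed
  qed simp
  from this[of n] have "path_calc \<gamma> (w 0) T = 1\<^sub>m n" using False e(2) by simp
  then show ?thesis unfolding w_def by simp
qed

text \<open>Cauchy's theorem removes the integral term of \<open>path_calc_shift\<close> when h is
  holomorphic on the slit plane. The resulting shape is the one that
  \<open>calculus_defect_vanishes\<close> exploits.\<close>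

lemma path_calc_step:
  assumes g: "calc_path T \<gamma>" and h: "h holomorphic_on slit_plane"
  shows "path_calc \<gamma> (\<lambda>z. c + (z - e) * h z) T = c \<cdot>\<^sub>m 1\<^sub>m n + (T - e \<cdot>\<^sub>m 1\<^sub>m n) * path_calc \<gamma> h T"
proof -
  have h': "h holomorphic_on slit_plane - eigvals T" using h by (rule holomorphic_on_subset) auto
  have "(h has_contour_integral 0) \<gamma>"
    using g by (intro Cauchy_theorem_global[OF open_slit_plane h]) (auto simp: calc_path_def)
  then have 0: "contour_integral \<gamma> h = 0" by (rule contour_integral_unique)
  have z: "0 \<cdot>\<^sub>m 1\<^sub>m n = (0\<^sub>m n n :: complex mat)" by (intro eq_matI) auto
  have "path_calc \<gamma> (\<lambda>z. c * 1 + 1 * ((z - e) * h z)) T =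
      c \<cdot>\<^sub>m path_calc \<gamma> (\<lambda>z. 1) T + 1 \<cdot>\<^sub>m path_calc \<gamma> (\<lambda>z. (z - e) * h z) T"
    by (intro path_calc_linear[OF g] holomorphic_intros h')
  then show ?thesis
    unfolding path_calc_one[OF g] path_calc_shift[OF g h'] 0
    using shift_carrier[OF T, of e] by (simp add: z one_smult_mat)
qed

text \<open>For fixed f the defect of multiplicativity in h transforms by the factor T - e: the
  constant c contributes c times the calculus of f to both terms and cancels.\<close>

lemma path_calc_mult:
  assumes g: "calc_path T \<gamma>" and f: "f holomorphic_on slit_plane" and h: "h holomorphic_on slit_plane"
  shows "path_calc \<gamma> (\<lambda>z. h z * f z) T = path_calc \<gamma> h T * path_calc \<gamma> f T"
proof (cases "eigvals T \<subseteq> slit_plane")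
  \<comment> \<open>An eigenvalue on the slit would need winding number 1 and 0 at once, so the
    assumed path cannot exist.\<close>
  case False
  then obtain w where "w \<in> eigvals T" "w \<notin> slit_plane" by auto
  then show ?thesis using g unfolding calc_path_def by (metis zero_neq_one)
next
  case True
  have f': "f holomorphic_on slit_plane - eigvals T" using f by (rule holomorphic_on_subset) auto
  define D where "D h = path_calc \<gamma> (\<lambda>z. h z * f z) T - path_calc \<gamma> h T * path_calc \<gamma> f T" for h
  note c = path_calc_carrier[of \<gamma>]
  have "D h = 0\<^sub>m n n"
  proof (rule calculus_defect_vanishes[OF T open_slit_plane True _ _ h])
    show "D h \<in> carrier_mat n n" for h unfolding D_def by (rule minus_carrier_mat) (use c in simp)
    fix h c e assume h: "h holomorphic_on slit_plane"
    have hf: "(\<lambda>z. h z * f z) holomorphic_on slit_plane" by (intro holomorphic_intros h f)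
    have F: "path_calc \<gamma> f T \<in> carrier_mat n n" "path_calc \<gamma> h T \<in> carrier_mat n n"
      "path_calc \<gamma> (\<lambda>z. h z * f z) T \<in> carrier_mat n n" by auto
    have S: "T - e \<cdot>\<^sub>m 1\<^sub>m n \<in> carrier_mat n n" using T by simp
    have "path_calc \<gamma> (\<lambda>z. (c + (z - e) * h z) * f z) T = path_calc \<gamma> (\<lambda>z. c * f z + 1 * ((z - e) * (h z * f z))) T"
      by (simp add: algebra_simps)
    also have "\<dots> = c \<cdot>\<^sub>m path_calc \<gamma> f T + 1 \<cdot>\<^sub>m path_calc \<gamma> (\<lambda>z. (z - e) * (h z * f z)) T"
      by (intro path_calc_linear[OF g] f' holomorphic_intros holomorphic_on_subset[OF hf]) auto
    also have "path_calc \<gamma> (\<lambda>z. (z - e) * (h z * f z)) T = path_calc \<gamma> (\<lambda>z. 0 + (z - e) * (h z * f z)) T" by simp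
    also have "\<dots> = 0 \<cdot>\<^sub>m 1\<^sub>m n + (T - e \<cdot>\<^sub>m 1\<^sub>m n) * path_calc \<gamma> (\<lambda>z. h z * f z) T"
      by (rule path_calc_step[OF g hf])
    finally have 1: "path_calc \<gamma> (\<lambda>z. (c + (z - e) * h z) * f z) T =
        c \<cdot>\<^sub>m path_calc \<gamma> f T + 1 \<cdot>\<^sub>m (0 \<cdot>\<^sub>m 1\<^sub>m n + (T - e \<cdot>\<^sub>m 1\<^sub>m n) * path_calc \<gamma> (\<lambda>z. h z * f z) T)" .
    have 2: "path_calc \<gamma> (\<lambda>z. c + (z - e) * h z) T * path_calc \<gamma> f T =
        c \<cdot>\<^sub>m path_calc \<gamma> f T + (T - e \<cdot>\<^sub>m 1\<^sub>m n) * (path_calc \<gamma> h T * path_calc \<gamma> f T)"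
      unfolding path_calc_step[OF g h]
      using S F(1,2) by (simp add: add_mult_distrib_mat[of _ n n _ _ n] mult_smult_assoc_mat[of _ n n _ n]
          assoc_mult_mat[of _ n n _ n _ n] left_mult_one_mat[of _ n n])
    have 3: "(T - e \<cdot>\<^sub>m 1\<^sub>m n) * D h = (T - e \<cdot>\<^sub>m 1\<^sub>m n) * path_calc \<gamma> (\<lambda>z. h z * f z) T
        - (T - e \<cdot>\<^sub>m 1\<^sub>m n) * (path_calc \<gamma> h T * path_calc \<gamma> f T)"
      unfolding D_def using S F by (subst mult_minus_distrib_mat[of _ n n _ n]) auto
    define X where "X = (T - e \<cdot>\<^sub>m 1\<^sub>m n) * path_calc \<gamma> (\<lambda>z. h z * f z) T"
    define Y where "Y = (T - e \<cdot>\<^sub>m 1\<^sub>m n) * (path_calc \<gamma> h T * path_calc \<gamma> f T)"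
    have "X \<in> carrier_mat n n" "Y \<in> carrier_mat n n" unfolding X_def Y_def using S F by simp_all
    then show "D (\<lambda>z. c + (z - e) * h z) = (T - e \<cdot>\<^sub>m 1\<^sub>m n) * D h"
      unfolding 3 unfolding D_def 1 2 X_def[symmetric] Y_def[symmetric] using F(1)
      by (intro eq_matI) auto
  qed
  then have 0: "path_calc \<gamma> (\<lambda>z. h z * f z) T - path_calc \<gamma> h T * path_calc \<gamma> f T = 0\<^sub>m n n" unfolding D_def .
  have P: "path_calc \<gamma> h T * path_calc \<gamma> f T \<in> carrier_mat n n" by simp
  show ?thesis
  proof (rule eq_matI)
    fix i j assume "i < dim_row (path_calc \<gamma> h T * path_calc \<gamma> f T)" "j < dim_col (path_calc \<gamma> h T * path_calc \<gamma> f T)"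
    then show "path_calc \<gamma> (\<lambda>z. h z * f z) T $$ (i,j) = (path_calc \<gamma> h T * path_calc \<gamma> f T) $$ (i,j)"
      using arg_cong[OF 0, of "\<lambda>M. M $$ (i,j)"] P by (simp del: index_mult_mat(1))
  qed (use P c[of "\<lambda>z. h z * f z"] in auto)
qed

text \<open>The difference of the calculi along two paths is again such a defect: the constants
  cancel and the factor T - e comes out.\<close>

lemma path_calc_unique:
  assumes g: "calc_path T \<gamma>" "calc_path T \<gamma>'" and f: "f holomorphic_on slit_plane"
  shows "path_calc \<gamma> f T = path_calc \<gamma>' f T"
proof (cases "eigvals T \<subseteq> slit_plane")
  case False
  then obtain w where "w \<in> eigvals T" "w \<notin> slit_plane" by auto
  then show ?thesis using g unfolding calc_path_def by (metis zero_neq_one)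
next
  case True
  define D where "D h = path_calc \<gamma> h T - path_calc \<gamma>' h T" for h
  have 0: "D f = 0\<^sub>m n n"
  proof (rule calculus_defect_vanishes[OF T open_slit_plane True _ _ f])
    show "D h \<in> carrier_mat n n" for h unfolding D_def by (rule minus_carrier_mat) simp
    fix h c e assume h: "h holomorphic_on slit_plane"
    define X where "X = (T - e \<cdot>\<^sub>m 1\<^sub>m n) * path_calc \<gamma> h T"
    define Y where "Y = (T - e \<cdot>\<^sub>m 1\<^sub>m n) * path_calc \<gamma>' h T"
    have S: "T - e \<cdot>\<^sub>m 1\<^sub>m n \<in> carrier_mat n n" using T by simp
    have XY: "X \<in> carrier_mat n n" "Y \<in> carrier_mat n n" unfolding X_def Y_def using S by simp_all
    have "(T - e \<cdot>\<^sub>m 1\<^sub>m n) * D h = X - Y"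
      unfolding D_def X_def Y_def using S by (subst mult_minus_distrib_mat[of _ n n _ n]) auto
    then show "D (\<lambda>z. c + (z - e) * h z) = (T - e \<cdot>\<^sub>m 1\<^sub>m n) * D h"
      unfolding D_def path_calc_step[OF g(1) h] path_calc_step[OF g(2) h] X_def[symmetric] Y_def[symmetric]
      using XY by (intro eq_matI) auto
  qed
  show ?thesis
  proof (rule eq_matI)
    fix i j assume "i < dim_row (path_calc \<gamma>' f T)" "j < dim_col (path_calc \<gamma>' f T)"
    then show "path_calc \<gamma> f T $$ (i,j) = path_calc \<gamma>' f T $$ (i,j)"
      using arg_cong[OF 0, of "\<lambda>M. M $$ (i,j)"] path_calc_carrier[of \<gamma>' f] unfolding D_def by simp
  qed (use path_calc_carrier[of \<gamma> f] path_calc_carrier[of \<gamma>' f] in auto)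
qed

end

section \<open>Means of accretive matrices\<close>

text \<open>|p - c| < c - \<delta> amounts to |p|^2 < 2c (Re p - \<delta>) + \<delta>^2, which holds
  for all large c once Re p > \<delta>.\<close>

lemma finite_half_plane_disc:
  assumes "finite E" "\<And>p. p \<in> E \<Longrightarrow> 0 < Re p"
  obtains c r where "0 < r" "r < c" "\<And>p. p \<in> E \<Longrightarrow> cmod (p - complex_of_real c) < r"
proof -
  obtain \<delta> where \<delta>: "0 < \<delta>" "\<And>p. p \<in> E \<Longrightarrow> \<delta> < Re p"
  proof (cases "E = {}")
    case True then show ?thesis using that[of 1] by simp
  next
    case False
    then have "0 < Min (Re ` E)" "\<And>p. p \<in> E \<Longrightarrow> Min (Re ` E) \<le> Re p" using assms by auto
    then show ?thesis using that[of "Min (Re ` E) / 2"] by force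
  qed
  have "\<forall>\<^sub>F c in at_top. \<forall>p\<in>E. cmod (p - complex_of_real c) < c - \<delta>"
  proof (intro eventually_ball_finite assms(1) ballI)
    fix p assume p: "p \<in> E"
    have "\<forall>\<^sub>F c in at_top. ((cmod p)\<^sup>2 + 1) / (2 * (Re p - \<delta>)) < c" by (rule eventually_gt_at_top)
    then show "\<forall>\<^sub>F c in at_top. cmod (p - complex_of_real c) < c - \<delta>"
      using eventually_gt_at_top[of \<delta>]
    proof eventually_elim
      case (elim c)
      have "(cmod p)\<^sup>2 < c * (2 * (Re p - \<delta>))"
        using elim \<delta>(2)[OF p] by (simp add: divide_less_eq)
      moreover have "(cmod (p - complex_of_real c))\<^sup>2 = (cmod p)\<^sup>2 - 2 * c * Re p + c\<^sup>2"
        unfolding cmod_power2 by (simp add: power2_eq_square algebra_simps)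
      ultimately have "(cmod (p - complex_of_real c))\<^sup>2 < (c - \<delta>)\<^sup>2"
        using zero_le_power2[of \<delta>] unfolding power2_diff by (simp only: right_diff_distrib mult_ac)
      then show ?case by (rule power_less_imp_less_base) (use elim in simp)
    qed
  qed
  then have "\<forall>\<^sub>F c in at_top. (\<forall>p\<in>E. cmod (p - complex_of_real c) < c - \<delta>) \<and> \<delta> < c"
    using eventually_gt_at_top[of \<delta>] by (rule eventually_conj)
  then obtain c where "\<forall>p\<in>E. cmod (p - complex_of_real c) < c - \<delta>" "\<delta> < c"
    by (metis (mono_tags, lifting) eventually_at_top_linorder order_refl)
  then show ?thesis using that[of "c - \<delta>" c] \<delta>(1) by auto
qed

lemma Re_csqrt_pos:
  assumes "z \<in> slit_plane"
  shows "0 < Re (csqrt z)"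
proof -
  have "Re (csqrt z) \<noteq> 0"
  proof
    assume 0: "Re (csqrt z) = 0"
    have "z = (csqrt z)\<^sup>2" by simp
    also have "\<dots> = complex_of_real (- (Im (csqrt z))\<^sup>2)"
      using 0 by (simp add: complex_eq_iff power2_eq_square del: csqrt.sel)
    finally have "z \<in> \<real>\<^sub>\<le>\<^sub>0" by (metis nonpos_Reals_of_real_iff neg_le_0_iff_le zero_le_power2)
    then show False using assms by simp
  qed
  then show ?thesis using csqrt_principal[of z] by linarith
qed

text \<open>The square of a circle in the right half-plane avoids the slit; substituting \<open>z = u\<^sup>2\<close> gives
  \<open>2 u / (u\<^sup>2 - a\<^sup>2) = 1 / (u - a) + 1 / (u + a)\<close>, and \<open>-a\<close> is not enclosed.\<close>
lemma calc_path_exists: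
  assumes T: "T \<in> carrier_mat n n" and E: "eigvals T \<subseteq> slit_plane"
  obtains \<gamma> B where "calc_path T \<gamma>" "\<And>t. t \<in> {0..1} \<Longrightarrow> cmod (vector_derivative \<gamma> (at t)) \<le> B"
proof -
  \<comment> \<open>A disc inside the slit plane need not be able to hold all eigenvalues, but their
    principal square roots lie in the open right half-plane, where one disc contains them.\<close>
  obtain c r where cr: "0 < r" "r < c" "\<And>p. p \<in> csqrt ` eigvals T \<Longrightarrow> cmod (p - complex_of_real c) < r"
    by (rule finite_half_plane_disc[of "csqrt ` eigvals T"])
      (use finite_eigvals[OF T] E Re_csqrt_pos in blast)+
  define \<sigma> where "\<sigma> = circlepath (complex_of_real c) r"
  define q where "q u = u\<^sup>2" for u :: complex
  define \<gamma> where "\<gamma> = q \<circ> \<sigma>"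
  have \<sigma>: "valid_path \<sigma>" "pathfinish \<sigma> = pathstart \<sigma>" "path_image \<sigma> = sphere (complex_of_real c) r"
    unfolding \<sigma>_def using cr(1) by auto
  have q: "q analytic_on UNIV" "deriv q = (\<lambda>u. 2 * u)" "\<And>u. q field_differentiable at u"
    unfolding q_def by (auto intro!: analytic_intros derivative_intros ext DERIV_imp_deriv derivative_eq_intros)
  have Repos: "0 < Re u" if "cmod (u - complex_of_real c) \<le> r" for u
    using that abs_Re_le_cmod[of "u - complex_of_real c"] cr(2) by simp
  have slit: "q u \<in> slit_plane" if "0 < Re u" for u
  proof
    assume "q u \<in> \<real>\<^sub>\<le>\<^sub>0"
    then obtain t where t: "q u = complex_of_real t" "t \<le> 0" by (auto elim!: nonpos_Reals_cases)
    then have "Re u * Im u = 0" "(Re u)\<^sup>2 - (Im u)\<^sup>2 = t"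
      unfolding q_def by (auto simp: complex_eq_iff power2_eq_square)
    then show False using that t(2) mult_pos_pos[OF that that] by (auto simp: power2_eq_square)
  qed
  have vp: "valid_path \<gamma>"
    unfolding \<gamma>_def using \<sigma>(1) q(1) by (rule valid_path_compose_analytic) auto
  have cl: "pathfinish \<gamma> = pathstart \<gamma>" using \<sigma>(2) unfolding \<gamma>_def pathfinish_def pathstart_def by simp
  have sphere: "cmod (u - complex_of_real c) = r" if "u \<in> path_image \<sigma>" for u
    using that unfolding \<sigma>(3) by (simp add: dist_norm norm_minus_commute)
  have pis: "path_image \<gamma> \<subseteq> slit_plane"
    unfolding \<gamma>_def path_image_compose using slit Repos sphere by fastforce
  have sq: "u = csqrt (q u)" if "0 < Re u" for u unfolding q_def using csqrt_square that by metis
  have noteig: "z \<notin> path_image \<gamma>" if z: "z \<in> eigvals T" for z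
  proof
    assume "z \<in> path_image \<gamma>"
    then obtain u where u: "u \<in> path_image \<sigma>" "z = q u" unfolding \<gamma>_def path_image_compose by auto
    then have "u = csqrt z" using sq[of u] Repos[of u] sphere[of u] by simp
    then show False using cr(3)[of u] sphere[OF u(1)] z by simp
  qed
  have wn: "winding_number \<gamma> z = 1" if z: "z \<in> eigvals T" for z
  proof -
    define a where "a = csqrt z"
    have a: "cmod (a - complex_of_real c) < r" "q a = z" unfolding a_def q_def using cr(3) z by auto
    then have aRe: "0 < Re a" using Repos[of a] by simp
    have out: "r < cmod (- a - complex_of_real c)"
      using aRe cr(2) abs_Re_le_cmod[of "- a - complex_of_real c"] by simp
    have "winding_number \<gamma> z = 1 / (2 * pi * \<i>) * contour_integral \<gamma> (\<lambda>w. 1 / (w - z))"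
      by (rule winding_number_valid_path[OF vp noteig[OF z]])
    also have "contour_integral \<gamma> (\<lambda>w. 1 / (w - z)) = contour_integral \<sigma> (\<lambda>u. 2 * u * (1 / (q u - z)))"
      unfolding \<gamma>_def using contour_integral_comp_analyticW[OF q(1) \<sigma>(1), of "\<lambda>w. 1 / (w - z)"] q(2) by simp
    also have "\<dots> = contour_integral \<sigma> (\<lambda>u. 1 / (u - a) + 1 / (u - (- a)))"
    proof (rule contour_integral_eq)
      fix u assume "u \<in> path_image \<sigma>"
      then have "u \<noteq> a" "u \<noteq> - a" using sphere[of u] a(1) out by auto
      then have "u - a \<noteq> 0" "u + a \<noteq> 0" by (auto simp: eq_neg_iff_add_eq_0)
      moreover have "q u - z = (u - a) * (u + a)"
        unfolding a(2)[symmetric] q_def by (simp add: power2_eq_square algebra_simps)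
      ultimately show "2 * u * (1 / (q u - z)) = 1 / (u - a) + 1 / (u - (- a))"
        by (simp add: divide_simps)
    qed
    also have "\<dots> = 2 * pi * \<i> * winding_number \<sigma> a + 2 * pi * \<i> * winding_number \<sigma> (- a)"
      by (intro contour_integral_unique has_contour_integral_add has_contour_integral_winding_number \<sigma>(1))
        (use sphere a(1) out in auto)
    also have "winding_number \<sigma> a = 1"
      unfolding \<sigma>_def using a(1) by (intro winding_number_circlepath) simp
    also have "winding_number \<sigma> (- a) = 0"
    proof (rule winding_number_zero_outside[OF valid_path_imp_path[OF \<sigma>(1)] convex_cball \<sigma>(2)])
      show "- a \<notin> cball (complex_of_real c) r" using out norm_minus_commute[of "- a" "complex_of_real c"] by (simp add: dist_norm)
      show "path_image \<sigma> \<subseteq> cball (complex_of_real c) r" unfolding \<sigma>(3) by (rule sphere_cball)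
    qed
    finally show ?thesis by simp
  qed
  have "calc_path T \<gamma>"
    unfolding calc_path_def
    using vp cl pis noteig wn simply_connected_imp_winding_number_zero[OF simply_connected_slit_plane valid_path_imp_path[OF vp] pis cl]
    by blast
  \<comment> \<open>The speed bound is exported for the interchange of limit and integral. It is
    |2u| \<le> 2(c + r) on the circle times the speed of the circle.\<close>
  moreover have "cmod (vector_derivative \<gamma> (at t)) \<le> 2 * pi * r * (2 * (c + r))" if "t \<in> {0..1}" for t
  proof -
    have "vector_derivative \<gamma> (at t) = vector_derivative \<sigma> (at t) * deriv q (\<sigma> t)"
      unfolding \<gamma>_def using q(3)
      by (intro vector_derivative_chain_at_general) (auto simp: \<sigma>_def intro: has_vector_derivative_circlepath differentiableI_vector)
    moreover have "\<sigma> t \<in> path_image \<sigma>" using that unfolding path_image_def by auto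
    then have "cmod (\<sigma> t) \<le> c + r"
      using sphere[of "\<sigma> t"] norm_triangle_ineq2[of "\<sigma> t" "complex_of_real c"] cr by simp
    moreover have "cmod (vector_derivative \<sigma> (at t)) = 2 * pi * r"
      unfolding \<sigma>_def vector_derivative_circlepath using cr(1) by (simp add: norm_mult norm_exp_eq_Re)
    ultimately show ?thesis using cr(1) q(2) by (simp add: norm_mult mult_left_mono)
  qed
  ultimately show ?thesis by (rule that)
qed

section \<open>Laws of the functional calculus on the slit plane\<close>

text \<open>Path independence replaces the choice inside \<open>hol_calc\<close> by any convenient
  admissible path.\<close>

lemma hol_calc_path:
  assumes T: "T \<in> carrier_mat n n" and g: "calc_path T \<gamma>" and f: "f holomorphic_on slit_plane"
  shows "hol_calc slit_plane f T = path_calc \<gamma> f T"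
proof -
  have "calc_path T (SOME \<gamma>. calc_path T \<gamma>)" using g by (rule someI[of "calc_path T" \<gamma>])
  then have "path_calc (SOME \<gamma>. calc_path T \<gamma>) f T = path_calc \<gamma> f T"
    by (rule path_calc_unique[OF T _ g f])
  then show ?thesis unfolding hol_calc_def path_calc_def calc_path_def[symmetric] Let_def .
qed

context
  fixes n :: nat and T :: "complex mat"
  assumes T: "T \<in> carrier_mat n n" and E: "eigvals T \<subseteq> slit_plane"
begin

lemma hol_calc_carrier: "hol_calc slit_plane f T \<in> carrier_mat n n"
  using T unfolding hol_calc_def by (simp add: Let_def)

lemma hol_calc_linear:
  assumes "f holomorphic_on slit_plane" "h holomorphic_on slit_plane"
  shows "hol_calc slit_plane (\<lambda>z. a * f z + b * h z) T = a \<cdot>\<^sub>m hol_calc slit_plane f T + b \<cdot>\<^sub>m hol_calc slit_plane h T"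
proof -
  obtain \<gamma> where g: "calc_path T \<gamma>" using calc_path_exists[OF T E] by blast
  have "(\<lambda>z. a * f z + b * h z) holomorphic_on slit_plane" by (intro holomorphic_intros assms)
  then show ?thesis
    using path_calc_linear[OF T g, of f h a b] assms
    by (simp add: hol_calc_path[OF T g] holomorphic_on_subset[OF _ Diff_subset])
qed

lemma hol_calc_mult:
  assumes "f holomorphic_on slit_plane" "h holomorphic_on slit_plane"
  shows "hol_calc slit_plane (\<lambda>z. f z * h z) T = hol_calc slit_plane f T * hol_calc slit_plane h T"
proof -
  obtain \<gamma> where g: "calc_path T \<gamma>" using calc_path_exists[OF T E] by blast
  have "(\<lambda>z. f z * h z) holomorphic_on slit_plane" by (intro holomorphic_intros assms)
  then show ?thesis
    using path_calc_mult[OF T g assms(2,1)] assms by (simp add: hol_calc_path[OF T g])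
qed

lemma hol_calc_one: "hol_calc slit_plane (\<lambda>z. 1) T = 1\<^sub>m n"
proof -
  obtain \<gamma> where g: "calc_path T \<gamma>" using calc_path_exists[OF T E] by blast
  show ?thesis using path_calc_one[OF T g] by (simp add: hol_calc_path[OF T g])
qed

lemma hol_calc_ident: "hol_calc slit_plane (\<lambda>z. z) T = T"
proof -
  obtain \<gamma> where g: "calc_path T \<gamma>" using calc_path_exists[OF T E] by blast
  have 0: "0 \<cdot>\<^sub>m 1\<^sub>m n = (0\<^sub>m n n :: complex mat)" by (intro eq_matI) auto
  have "T - 0\<^sub>m n n = T" using T by (intro eq_matI) auto
  then show ?thesis
    using path_calc_step[OF T g, of "\<lambda>z. 1" 0 0] T
    by (simp add: hol_calc_path[OF T g] path_calc_one[OF T g] 0 right_mult_one_mat[of _ n n])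
qed

text \<open>The path image is compact, so the integrands converge uniformly on it, and the speed
  bound lets the limit pass under the integral.\<close>

lemma hol_calc_limit:
  assumes f: "\<And>k. f k holomorphic_on slit_plane" and G: "G holomorphic_on slit_plane"
    and lim: "\<And>K. compact K \<Longrightarrow> K \<subseteq> slit_plane \<Longrightarrow> uniform_limit K f G sequentially"
    and ij: "i < n" "j < n"
  shows "(\<lambda>k. hol_calc slit_plane (f k) T $$ (i,j)) \<longlonglongrightarrow> hol_calc slit_plane G T $$ (i,j)"
proof -
  obtain \<gamma> B where g: "calc_path T \<gamma>" and B: "\<And>t. t \<in> {0..1} \<Longrightarrow> cmod (vector_derivative \<gamma> (at t)) \<le> B"
    using calc_path_exists[OF T E] by blast
  have vp: "valid_path \<gamma>" and pi: "path_image \<gamma> \<subseteq> slit_plane" "path_image \<gamma> \<subseteq> - eigvals T"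
    using g unfolding calc_path_def by auto
  have comp: "compact (path_image \<gamma>)" by (rule compact_valid_path_image[OF vp])
  let ?R = "\<lambda>z. minv (z \<cdot>\<^sub>m 1\<^sub>m n - T) $$ (i,j)"
  have Rc: "continuous_on (path_image \<gamma>) ?R"
    using holomorphic_on_imp_continuous_on[OF resolvent_holomorphic[OF T ij]] pi(2) by (rule continuous_on_subset)
  have Gc: "continuous_on (path_image \<gamma>) G"
    using holomorphic_on_imp_continuous_on[OF G] pi(1) by (rule continuous_on_subset)
  have hs: "f k holomorphic_on slit_plane - eigvals T" for k
    using f by (rule holomorphic_on_subset) auto
  have ul: "uniform_limit (path_image \<gamma>) (\<lambda>k z. f k z * ?R z) (\<lambda>z. G z * ?R z) sequentially"
    by (intro uniform_lim_mult uniform_limit_const lim comp pi(1))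
      (auto intro!: compact_imp_bounded compact_continuous_image comp Rc Gc)
  have "(\<lambda>k. contour_integral \<gamma> (\<lambda>z. f k z * ?R z)) \<longlonglongrightarrow> contour_integral \<gamma> (\<lambda>z. G z * ?R z)"
    by (rule contour_integral_uniform_limit(2)[OF _ ul B vp]) (use path_calc_integrable[OF T g hs ij] in auto)
  then show ?thesis
    unfolding hol_calc_path[OF T g f] hol_calc_path[OF T g G] path_calc_index[OF T ij]
    by (intro tendsto_divide tendsto_const) auto
qed

text \<open>Multiplicativity turns the scalar identity (s z + 1 - s) harm_s(z) = z into a matrix
  identity without inverting anything.\<close>

lemma hol_calc_harm:
  assumes s: "0 \<le> s" "s \<le> 1"
  shows "(of_real s \<cdot>\<^sub>m T + of_real (1 - s) \<cdot>\<^sub>m 1\<^sub>m n) * hol_calc slit_plane (harm s) T = T"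
proof -
  have h: "harm s holomorphic_on slit_plane" using harm_comb_holomorphic harm_comb.harm[OF s] by blast
  have i: "(\<lambda>z. of_real s * z + of_real (1 - s) * 1) holomorphic_on slit_plane" by (intro holomorphic_intros)
  obtain \<gamma> where g: "calc_path T \<gamma>" using calc_path_exists[OF T E] by blast
  have "hol_calc slit_plane (\<lambda>z. z) T = hol_calc slit_plane (\<lambda>z. (of_real s * z + of_real (1 - s) * 1) * harm s z) T"
  proof -
    have hi: "(\<lambda>z. (of_real s * z + of_real (1 - s) * 1) * harm s z) holomorphic_on slit_plane" by (intro holomorphic_intros h)
    have hz: "(\<lambda>z. z) holomorphic_on slit_plane" by (intro holomorphic_intros)
    \<comment> \<open>Off the slit plane the denominator may vanish, so the two integrands are
      compared on the path.\<close>
    have *: "z = (of_real s * z + of_real (1 - s) * 1) * harm s z" if "z \<in> path_image \<gamma>" for z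
    proof -
      have "z \<in> slit_plane" using that g unfolding calc_path_def by auto
      then show ?thesis using harm_denominator[OF s] unfolding harm_def by (simp del: of_real_diff)
    qed
    show ?thesis
      unfolding hol_calc_path[OF T g hi] hol_calc_path[OF T g hz]
    proof (rule eq_matI)
      fix i j assume "i < dim_row (path_calc \<gamma> (\<lambda>z. (of_real s * z + of_real (1 - s) * 1) * harm s z) T)"
        "j < dim_col (path_calc \<gamma> (\<lambda>z. (of_real s * z + of_real (1 - s) * 1) * harm s z) T)"
      then have ij: "i < n" "j < n" using path_calc_dim[OF T] by auto
      show "path_calc \<gamma> (\<lambda>z. z) T $$ (i,j) = path_calc \<gamma> (\<lambda>z. (of_real s * z + of_real (1 - s) * 1) * harm s z) T $$ (i,j)"
        unfolding path_calc_index[OF T ij] by (intro arg_cong2[of _ _ _ _ "(/)"] contour_integral_eq) (use * in metis)+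
    qed (use path_calc_dim[OF T] in auto)
  qed
  also have "\<dots> = hol_calc slit_plane (\<lambda>z. of_real s * z + of_real (1 - s) * 1) T * hol_calc slit_plane (harm s) T"
    by (rule hol_calc_mult[OF i h])
  also have "hol_calc slit_plane (\<lambda>z. of_real s * z + of_real (1 - s) * 1) T = of_real s \<cdot>\<^sub>m T + of_real (1 - s) \<cdot>\<^sub>m 1\<^sub>m n"
    by (subst hol_calc_linear) (auto intro!: holomorphic_intros simp: hol_calc_ident hol_calc_one)
  finally show ?thesis unfolding hol_calc_ident by simp
qed

end

section \<open>Accretive matrices and their square roots\<close>

definition accretive :: "nat \<Rightarrow> complex mat \<Rightarrow> bool" where
  "accretive n X \<longleftrightarrow> X \<in> carrier_mat n n \<and> (\<forall>x \<in> carrier_vec n. x \<noteq> 0\<^sub>v n \<longrightarrow> 0 < Re (qform X x))"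

text \<open>The forms satisfy q_B(u) = z q_A(u), so a real z \<le> 0 would make the real part of
  q_B(u) nonpositive. With the identity in place of A this locates the eigenvalues of B; with
  general A it locates those of \<open>msqrt_inv A * B * msqrt_inv A\<close>.\<close>

lemma accretive_pencil:
  assumes A: "accretive n A" and B: "accretive n B"
    and u: "u \<in> carrier_vec n" "u \<noteq> 0\<^sub>v n" "B *\<^sub>v u = z \<cdot>\<^sub>v (A *\<^sub>v u)"
  shows "z \<in> slit_plane"
proof
  assume "z \<in> \<real>\<^sub>\<le>\<^sub>0"
  then obtain t where t: "z = complex_of_real t" "t \<le> 0" by (auto elim!: nonpos_Reals_cases)
  have Ac: "A \<in> carrier_mat n n" using A unfolding accretive_def by auto
  have "qform B u = z * qform A u"
    unfolding qform_def u(3) using Ac u(1) by (intro cscalar_smult(1)[of _ n]) auto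
  then have "Re (qform B u) = t * Re (qform A u)" unfolding t by simp
  moreover have "0 < Re (qform B u)" "0 < Re (qform A u)" using A B u unfolding accretive_def by auto
  ultimately show False using t(2) by (metis mult_nonpos_nonneg less_imp_le not_less)
qed

lemma accretive_one: "accretive n (1\<^sub>m n)"
  unfolding accretive_def using cscalar_self_pos by (auto simp: qform_one)

lemma accretive_eigvals: "accretive n A \<Longrightarrow> eigvals A \<subseteq> slit_plane"
proof
  fix z assume A: "accretive n A" and z: "z \<in> eigvals A"
  then have "A \<in> carrier_mat n n" unfolding accretive_def by auto
  then obtain v where "v \<in> carrier_vec n" "v \<noteq> 0\<^sub>v n" "A *\<^sub>v v = z \<cdot>\<^sub>v v" using eigvals_iff z by blast
  then show "z \<in> slit_plane" by (intro accretive_pencil[OF accretive_one A, of v]) auto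
qed

lemma accretive_det: "accretive n A \<Longrightarrow> det A \<noteq> 0"
proof
  assume A: "accretive n A" and d: "det A = 0"
  then have Ac: "A \<in> carrier_mat n n" unfolding accretive_def by auto
  then obtain v where v: "v \<in> carrier_vec n" "v \<noteq> 0\<^sub>v n" "A *\<^sub>v v = 0\<^sub>v n"
    using det_nonzero_iff_ker[OF Ac] d by auto
  have "qform A v = 0" unfolding qform_def v(3) using v by auto
  then show False using A v unfolding accretive_def by auto
qed

lemma msqrt_square:
  assumes A: "accretive n A"
  shows "msqrt A \<in> carrier_mat n n" "msqrt A * msqrt A = A" "det (msqrt A) \<noteq> 0"
proof -
  have Ac: "A \<in> carrier_mat n n" using A unfolding accretive_def by auto
  note E = accretive_eigvals[OF A]
  show c: "msqrt A \<in> carrier_mat n n" unfolding msqrt_def by (rule hol_calc_carrier[OF Ac E])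
  show sq: "msqrt A * msqrt A = A"
    unfolding msqrt_def
    using hol_calc_mult[OF Ac E holomorphic_on_csqrt holomorphic_on_csqrt] hol_calc_ident[OF Ac E]
    by (simp flip: power2_eq_square)
  have "det (msqrt A) * det (msqrt A) = det A" using det_mult[OF c c] sq by simp
  then show "det (msqrt A) \<noteq> 0" using accretive_det[OF A] by auto
qed

section \<open>The mean as a function of its representing function\<close>

definition pmean :: "(complex \<Rightarrow> complex) \<Rightarrow> complex mat \<Rightarrow> complex mat \<Rightarrow> complex mat" where
  "pmean f A B = (let R = msqrt A; Ri = minv R in R * hol_calc slit_plane f (Ri * B * Ri) * R)"

definition msqrt_inv :: "complex mat \<Rightarrow> complex mat" where
  "msqrt_inv A = minv (msqrt A)"

lemma mean_app_pmean: "mean_app g A B = pmean (hol_ext g) A B"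
  unfolding mean_app_def pmean_def ..

context
  fixes n :: nat and A B :: "complex mat"
  assumes A: "accretive n A" and B: "accretive n B"
begin

lemma pmean_factor_carriers: "A \<in> carrier_mat n n" "B \<in> carrier_mat n n" "msqrt A \<in> carrier_mat n n" "msqrt_inv A \<in> carrier_mat n n"
  using A B msqrt_square[OF A] minv_inverse[of "msqrt A" n] unfolding accretive_def msqrt_inv_def by auto

lemma msqrt_inverse: "msqrt A * msqrt_inv A = 1\<^sub>m n" "msqrt_inv A * msqrt A = 1\<^sub>m n" "msqrt A * msqrt A = A"
  using msqrt_square[OF A] minv_inverse[of "msqrt A" n] unfolding msqrt_inv_def by auto

lemma pmean_arg_carrier: "msqrt_inv A * B * msqrt_inv A \<in> carrier_mat n n"
  using pmean_factor_carriers by simp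

text \<open>With R the square root of A, an eigenvector v of the argument yields u = R^-1 v with B u
  = z A u, and \<open>accretive_pencil\<close> applies.\<close>

lemma pmean_arg_eigvals: "eigvals (msqrt_inv A * B * msqrt_inv A) \<subseteq> slit_plane"
proof
  fix z assume "z \<in> eigvals (msqrt_inv A * B * msqrt_inv A)"
  then obtain v where v: "v \<in> carrier_vec n" "v \<noteq> 0\<^sub>v n" "(msqrt_inv A * B * msqrt_inv A) *\<^sub>v v = z \<cdot>\<^sub>v v"
    using eigvals_iff[OF pmean_arg_carrier] by auto
  define u where "u = msqrt_inv A *\<^sub>v v"
  have u: "u \<in> carrier_vec n" unfolding u_def by (rule mult_mat_vec_carrier[OF pmean_factor_carriers(4) v(1)])
  have Ru: "msqrt A *\<^sub>v u = v"
    unfolding u_def using assoc_mult_mat_vec[OF pmean_factor_carriers(3,4) v(1)] msqrt_inverse(1) v(1) by simp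
  have Bu: "B *\<^sub>v u \<in> carrier_vec n" by (rule mult_mat_vec_carrier[OF pmean_factor_carriers(2) u])
  have 1: "(msqrt_inv A * B * msqrt_inv A) *\<^sub>v v = msqrt_inv A *\<^sub>v (B *\<^sub>v u)"
    unfolding u_def using pmean_factor_carriers v(1) by (simp add: assoc_mult_mat_vec[of _ n n _ n] assoc_mult_mat[of _ n n _ n _ n])
  have "B *\<^sub>v u = (msqrt A * msqrt_inv A) *\<^sub>v (B *\<^sub>v u)" unfolding msqrt_inverse(1) using Bu by simp
  also have "\<dots> = msqrt A *\<^sub>v (msqrt_inv A *\<^sub>v (B *\<^sub>v u))" by (rule assoc_mult_mat_vec[OF pmean_factor_carriers(3,4) Bu])
  also have "\<dots> = msqrt A *\<^sub>v (z \<cdot>\<^sub>v (msqrt A *\<^sub>v u))" using 1 v(3) Ru by simp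
  also have "\<dots> = z \<cdot>\<^sub>v (msqrt A *\<^sub>v (msqrt A *\<^sub>v u))"
    by (rule mult_mat_vec[OF pmean_factor_carriers(3)]) (use Ru v(1) in simp)
  also have "msqrt A *\<^sub>v (msqrt A *\<^sub>v u) = A *\<^sub>v u"
    using assoc_mult_mat_vec[OF pmean_factor_carriers(3,3) u] msqrt_inverse(3) by simp
  finally have "B *\<^sub>v u = z \<cdot>\<^sub>v (A *\<^sub>v u)" .
  moreover have "u \<noteq> 0\<^sub>v n"
  proof
    assume "u = 0\<^sub>v n"
    moreover have "msqrt A *\<^sub>v 0\<^sub>v n = 0\<^sub>v n" using pmean_factor_carriers(3) by (intro eq_vecI) auto
    ultimately show False using Ru v(2) by simp
  qed
  ultimately show "z \<in> slit_plane" using accretive_pencil[OF A B u] by blast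
qed

lemma pmean_eq: "pmean f A B = msqrt A * hol_calc slit_plane f (msqrt_inv A * B * msqrt_inv A) * msqrt A"
  unfolding pmean_def msqrt_inv_def Let_def ..

lemma pmean_carrier: "pmean f A B \<in> carrier_mat n n"
  unfolding pmean_eq using pmean_factor_carriers hol_calc_carrier[OF pmean_arg_carrier pmean_arg_eigvals, of f] by simp

lemma pmean_index:
  assumes "i < n" "j < n"
  shows "pmean f A B $$ (i,j) = (\<Sum>k<n. (\<Sum>l<n. msqrt A $$ (i,l) * hol_calc slit_plane f (msqrt_inv A * B * msqrt_inv A) $$ (l,k)) * msqrt A $$ (k,j))"
proof -
  note H = hol_calc_carrier[OF pmean_arg_carrier pmean_arg_eigvals, of f]
  have "pmean f A B $$ (i,j) = (\<Sum>k<n. (msqrt A * hol_calc slit_plane f (msqrt_inv A * B * msqrt_inv A)) $$ (i,k) * msqrt A $$ (k,j))"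
    unfolding pmean_eq by (rule mult_mat_index_sum) (use pmean_factor_carriers H assms in auto)
  also have "\<dots> = (\<Sum>k<n. (\<Sum>l<n. msqrt A $$ (i,l) * hol_calc slit_plane f (msqrt_inv A * B * msqrt_inv A) $$ (l,k)) * msqrt A $$ (k,j))"
    by (intro sum.cong arg_cong2[of _ _ _ _ "(*)"] mult_mat_index_sum[OF pmean_factor_carriers(3) H assms(1)]) auto
  finally show ?thesis .
qed

lemma pmean_linear:
  assumes fh: "f holomorphic_on slit_plane" "h holomorphic_on slit_plane" and ij: "i < n" "j < n"
  shows "pmean (\<lambda>z. a * f z + b * h z) A B $$ (i,j) = a * pmean f A B $$ (i,j) + b * pmean h A B $$ (i,j)"
proof -
  note H = hol_calc_carrier[OF pmean_arg_carrier pmean_arg_eigvals]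
  have "hol_calc slit_plane (\<lambda>z. a * f z + b * h z) (msqrt_inv A * B * msqrt_inv A) $$ (l,k) =
      a * hol_calc slit_plane f (msqrt_inv A * B * msqrt_inv A) $$ (l,k) + b * hol_calc slit_plane h (msqrt_inv A * B * msqrt_inv A) $$ (l,k)"
    if "l < n" "k < n" for l k
    unfolding hol_calc_linear[OF pmean_arg_carrier pmean_arg_eigvals fh] using that H[of f] H[of h] by simp
  then show ?thesis
    unfolding pmean_index[OF ij]
    by (simp add: sum_distrib_left sum_distrib_right sum.distrib algebra_simps)
qed

lemma pmean_limit:
  assumes f: "\<And>k. f k holomorphic_on slit_plane" and G: "G holomorphic_on slit_plane"
    and lim: "\<And>K. compact K \<Longrightarrow> K \<subseteq> slit_plane \<Longrightarrow> uniform_limit K f G sequentially"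
    and ij: "i < n" "j < n"
  shows "(\<lambda>k. pmean (f k) A B $$ (i,j)) \<longlonglongrightarrow> pmean G A B $$ (i,j)"
  unfolding pmean_index[OF ij]
  by (intro tendsto_sum tendsto_mult tendsto_const hol_calc_limit[OF pmean_arg_carrier pmean_arg_eigvals f G lim]) auto

text \<open>Identifies the mean for \<open>harm s\<close> as the weighted harmonic mean, the inverse
  of s A^-1 + (1 - s) B^-1. With R the square root of A, \<open>hol_calc_harm\<close> is multiplied
  on the left by B^-1 R, which turns the argument R^-1 B R^-1 into R^-1.\<close>

lemma pmean_harm:
  assumes s: "0 \<le> s" "s \<le> 1"
  shows "(of_real s \<cdot>\<^sub>m minv A + of_real (1 - s) \<cdot>\<^sub>m minv B) * pmean (harm s) A B = 1\<^sub>m n"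
proof -
  note as = assoc_mult_mat[of _ n n _ n _ n]
  define X where "X = hol_calc slit_plane (harm s) (msqrt_inv A * B * msqrt_inv A)"
  have X: "X \<in> carrier_mat n n" unfolding X_def by (rule hol_calc_carrier[OF pmean_arg_carrier pmean_arg_eigvals])
  have iB: "minv B \<in> carrier_mat n n" "minv B * B = 1\<^sub>m n" "B * minv B = 1\<^sub>m n"
    using minv_inverse[OF pmean_factor_carriers(2) accretive_det[OF B]] by auto
  have iA: "minv A = msqrt_inv A * msqrt_inv A"
  proof (rule minv_eq[OF pmean_factor_carriers(1)])
    have "A * (msqrt_inv A * msqrt_inv A) = (msqrt A * msqrt A) * (msqrt_inv A * msqrt_inv A)"
      using msqrt_inverse(3) by simp
    also have "\<dots> = msqrt A * (msqrt A * msqrt_inv A) * msqrt_inv A" using pmean_factor_carriers by (simp add: as)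
    finally show "A * (msqrt_inv A * msqrt_inv A) = 1\<^sub>m n" unfolding msqrt_inverse(1) using msqrt_inverse(1) pmean_factor_carriers by simp
  qed (use pmean_factor_carriers in simp)
  let ?T = "msqrt_inv A * B * msqrt_inv A"
  have 1: "(of_real s \<cdot>\<^sub>m ?T + of_real (1 - s) \<cdot>\<^sub>m 1\<^sub>m n) * X = ?T"
    unfolding X_def by (rule hol_calc_harm[OF pmean_arg_carrier pmean_arg_eigvals s])
  have Wc: "minv B * msqrt A \<in> carrier_mat n n" using iB pmean_factor_carriers by simp
  have "minv B * msqrt A * ?T = minv B * (msqrt A * msqrt_inv A) * B * msqrt_inv A" using iB(1) pmean_factor_carriers by (simp add: as)
  then have WT: "minv B * msqrt A * ?T = msqrt_inv A" using msqrt_inverse iB pmean_factor_carriers by simp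
  have "msqrt_inv A = (minv B * msqrt A) * ((of_real s \<cdot>\<^sub>m ?T + of_real (1 - s) \<cdot>\<^sub>m 1\<^sub>m n) * X)" unfolding 1 WT ..
  also have "\<dots> = ((minv B * msqrt A) * (of_real s \<cdot>\<^sub>m ?T + of_real (1 - s) \<cdot>\<^sub>m 1\<^sub>m n)) * X"
    by (rule assoc_mult_mat[symmetric, OF Wc _ X]) (use pmean_arg_carrier in simp)
  also have "(minv B * msqrt A) * (of_real s \<cdot>\<^sub>m ?T + of_real (1 - s) \<cdot>\<^sub>m 1\<^sub>m n) = of_real s \<cdot>\<^sub>m msqrt_inv A + of_real (1 - s) \<cdot>\<^sub>m (minv B * msqrt A)"
  proof -
    have "(minv B * msqrt A) * (of_real s \<cdot>\<^sub>m ?T + of_real (1 - s) \<cdot>\<^sub>m 1\<^sub>m n) =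
       (minv B * msqrt A) * (of_real s \<cdot>\<^sub>m ?T) + (minv B * msqrt A) * (of_real (1 - s) \<cdot>\<^sub>m 1\<^sub>m n)"
      by (rule mult_add_distrib_mat[OF Wc, of _ n]) (use pmean_arg_carrier in simp_all)
    also have "(minv B * msqrt A) * (of_real s \<cdot>\<^sub>m ?T) = of_real s \<cdot>\<^sub>m (minv B * msqrt A * ?T)"
      by (rule mult_smult_distrib[OF Wc pmean_arg_carrier])
    also have "(minv B * msqrt A) * (of_real (1 - s) \<cdot>\<^sub>m 1\<^sub>m n) = of_real (1 - s) \<cdot>\<^sub>m (minv B * msqrt A * 1\<^sub>m n)"
      by (rule mult_smult_distrib[OF Wc one_carrier_mat])
    finally show ?thesis unfolding WT right_mult_one_mat[OF Wc] .
  qed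
  finally have key: "msqrt_inv A = (of_real s \<cdot>\<^sub>m msqrt_inv A + of_real (1 - s) \<cdot>\<^sub>m (minv B * msqrt A)) * X" .
  have "of_real s \<cdot>\<^sub>m minv A + of_real (1 - s) \<cdot>\<^sub>m minv B = (of_real s \<cdot>\<^sub>m msqrt_inv A + of_real (1 - s) \<cdot>\<^sub>m (minv B * msqrt A)) * msqrt_inv A"
  proof -
    have "(of_real s \<cdot>\<^sub>m msqrt_inv A + of_real (1 - s) \<cdot>\<^sub>m (minv B * msqrt A)) * msqrt_inv A =
        (of_real s \<cdot>\<^sub>m msqrt_inv A) * msqrt_inv A + (of_real (1 - s) \<cdot>\<^sub>m (minv B * msqrt A)) * msqrt_inv A"
      by (rule add_mult_distrib_mat[of _ n n _ _ n]) (use pmean_factor_carriers Wc in simp_all)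
    also have "(of_real s \<cdot>\<^sub>m msqrt_inv A) * msqrt_inv A = of_real s \<cdot>\<^sub>m (msqrt_inv A * msqrt_inv A)"
      by (rule mult_smult_assoc_mat[of _ n n _ n]) (use pmean_factor_carriers in simp_all)
    also have "(of_real (1 - s) \<cdot>\<^sub>m (minv B * msqrt A)) * msqrt_inv A = of_real (1 - s) \<cdot>\<^sub>m (minv B * msqrt A * msqrt_inv A)"
      by (rule mult_smult_assoc_mat[of _ n n _ n]) (use pmean_factor_carriers Wc in simp_all)
    also have "minv B * msqrt A * msqrt_inv A = minv B"
      using assoc_mult_mat[OF iB(1) pmean_factor_carriers(3,4)] msqrt_inverse iB by simp
    finally show ?thesis unfolding iA by simp
  qed
  also have "\<dots> * pmean (harm s) A B = (of_real s \<cdot>\<^sub>m msqrt_inv A + of_real (1 - s) \<cdot>\<^sub>m (minv B * msqrt A)) * (msqrt_inv A * msqrt A) * X * msqrt A"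
    unfolding pmean_eq X_def[symmetric] using pmean_factor_carriers Wc X by (simp add: as)
  also have "\<dots> = (of_real s \<cdot>\<^sub>m msqrt_inv A + of_real (1 - s) \<cdot>\<^sub>m (minv B * msqrt A)) * X * msqrt A"
    unfolding msqrt_inverse(2) by (subst right_mult_one_mat[of _ n n]) (use pmean_factor_carriers Wc in simp_all)
  also have "\<dots> = msqrt_inv A * msqrt A" unfolding key[symmetric] ..
  finally show ?thesis unfolding msqrt_inverse(2) .
qed

end

section \<open>Sectorial matrices\<close>

text \<open>Continuity refers to locally uniform convergence. Affinity is asked for convex
  combinations, so that constant functionals are included and inequalities with constants can be
  transferred.\<close>

definition affine_cont :: "((complex \<Rightarrow> complex) \<Rightarrow> real) \<Rightarrow> bool" where
  "affine_cont L \<longleftrightarrow>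
    (\<forall>f h u. f holomorphic_on slit_plane \<longrightarrow> h holomorphic_on slit_plane \<longrightarrow> 0 \<le> u \<longrightarrow> u \<le> 1 \<longrightarrow>
      L (\<lambda>z. of_real u * f z + of_real (1 - u) * h z) = u * L f + (1 - u) * L h) \<and>
    (\<forall>f G. (\<forall>k. f k holomorphic_on slit_plane) \<longrightarrow> G holomorphic_on slit_plane \<longrightarrow>
      (\<forall>K. compact K \<longrightarrow> K \<subseteq> slit_plane \<longrightarrow> uniform_limit K f G sequentially) \<longrightarrow>
      (\<lambda>k. L (f k)) \<longlonglongrightarrow> L G)"

text \<open>Lifts an inequality from the harmonic functions through convex combinations to their
  limits; the bounds for general means are all obtained this way.\<close>

lemma affine_cont_nonneg:
  assumes L: "affine_cont L" and h: "\<And>s. 0 \<le> s \<Longrightarrow> s \<le> 1 \<Longrightarrow> 0 \<le> L (harm s)" and G: "loewner_fun G"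
  shows "0 \<le> L G"
proof -
  have comb: "0 \<le> L f" if "harm_comb f" for f
    using that
  proof (induction rule: harm_comb.induct)
    case (comb f h u)
    then show ?case using L harm_comb_holomorphic unfolding affine_cont_def by auto
  qed (rule h)
  obtain f where f: "\<And>k. harm_comb (f k)" "\<And>K. compact K \<Longrightarrow> K \<subseteq> slit_plane \<Longrightarrow> uniform_limit K f G sequentially"
    and Gh: "G holomorphic_on slit_plane"
    using G unfolding loewner_fun_def by blast
  have "(\<lambda>k. L (f k)) \<longlonglongrightarrow> L G"
    using L f Gh harm_comb_holomorphic unfolding affine_cont_def by blast
  then show ?thesis using comb f(1) by (intro LIMSEQ_le_const) auto
qed

lemma affine_cont_const: "affine_cont (\<lambda>f. c)"
  unfolding affine_cont_def by (auto simp: algebra_simps)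

lemma affine_cont_add:
  assumes "affine_cont L" "affine_cont L'"
  shows "affine_cont (\<lambda>f. L f + L' f)"
proof -
  have "u * x + (1 - u) * y + (u * x' + (1 - u) * y') = u * (x + x') + (1 - u) * (y + y')" for u x y x' y' :: real
    by (simp add: algebra_simps)
  then show ?thesis
    using assms unfolding affine_cont_def by (simp add: tendsto_add del: of_real_diff)
qed

lemma affine_cont_scale:
  assumes "affine_cont L"
  shows "affine_cont (\<lambda>f. c * L f)"
proof -
  have "c * (u * x + (1 - u) * y) = u * (c * x) + (1 - u) * (c * y)" for u x y :: real
    by (simp add: algebra_simps)
  then show ?thesis
    using assms unfolding affine_cont_def by (simp add: tendsto_mult_left del: of_real_diff)
qed

lemma affine_cont_diff: "affine_cont L \<Longrightarrow> affine_cont L' \<Longrightarrow> affine_cont (\<lambda>f. L f - L' f)"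
  using affine_cont_add[of L "\<lambda>f. (-1) * L' f"] affine_cont_scale[of L' "-1"] by simp

lemma affine_cont_sum: "(\<And>i. i \<in> I \<Longrightarrow> affine_cont (L i)) \<Longrightarrow> affine_cont (\<lambda>f. \<Sum>i\<in>I. L i f)"
  by (induction I rule: infinite_finite_induct) (auto intro: affine_cont_const affine_cont_add)

lemma affine_cont_eval:
  assumes z: "z \<in> slit_plane"
  shows "affine_cont (\<lambda>f. Re (f z))"
  unfolding affine_cont_def
proof (intro conjI allI impI)
  fix f :: "nat \<Rightarrow> complex \<Rightarrow> complex" and G
  assume *: "\<forall>K. compact K \<longrightarrow> K \<subseteq> slit_plane \<longrightarrow> uniform_limit K f G sequentially"
  have ul: "uniform_limit {z} f G sequentially" by (rule *[rule_format]) (use z in auto)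
  show "(\<lambda>k. Re (f k z)) \<longlonglongrightarrow> Re (G z)" by (intro tendsto_Re tendsto_uniform_limitI[OF ul]) simp
qed (simp del: of_real_diff)

lemma affine_cont_pmean:
  assumes A: "accretive n A" and B: "accretive n B" and ij: "i < n" "j < n"
  shows "affine_cont (\<lambda>f. Re (c * pmean f A B $$ (i,j)))"
  unfolding affine_cont_def
proof (intro conjI allI impI)
  fix f h :: "complex \<Rightarrow> complex" and u :: real
  assume fh: "f holomorphic_on slit_plane" "h holomorphic_on slit_plane"
  have "c * pmean (\<lambda>z. of_real u * f z + of_real (1 - u) * h z) A B $$ (i,j) =
      of_real u * (c * pmean f A B $$ (i,j)) + of_real (1 - u) * (c * pmean h A B $$ (i,j))"
    unfolding pmean_linear[OF A B fh ij] by (simp only: distrib_left mult.left_commute)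
  then show "Re (c * pmean (\<lambda>z. of_real u * f z + of_real (1 - u) * h z) A B $$ (i,j)) =
      u * Re (c * pmean f A B $$ (i,j)) + (1 - u) * Re (c * pmean h A B $$ (i,j))"
    by (simp only: plus_complex.sel Re_complex_of_real Im_complex_of_real times_complex.sel mult_zero_left diff_zero)
next
  fix f :: "nat \<Rightarrow> complex \<Rightarrow> complex" and G
  assume "\<forall>k. f k holomorphic_on slit_plane" "G holomorphic_on slit_plane"
    "\<forall>K. compact K \<longrightarrow> K \<subseteq> slit_plane \<longrightarrow> uniform_limit K f G sequentially"
  then show "(\<lambda>k. Re (c * pmean (f k) A B $$ (i,j))) \<longlonglongrightarrow> Re (c * pmean G A B $$ (i,j))"
    by (intro tendsto_Re tendsto_mult tendsto_const pmean_limit[OF A B _ _ _ ij]) auto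
qed

lemma qform_entries:
  assumes "X \<in> carrier_mat n n" "x \<in> carrier_vec n"
  shows "qform X x = (\<Sum>i<n. \<Sum>j<n. (x $ j * cnj (x $ i)) * X $$ (i,j))"
  using assms unfolding qform_def
  by (subst cscalar_sum[of _ n])
    (auto simp: scalar_prod_def atLeast0LessThan sum_distrib_right sum_distrib_left ac_simps intro!: sum.cong)

lemma affine_cont_qform:
  assumes A: "accretive n A" and B: "accretive n B" and x: "x \<in> carrier_vec n"
  shows "affine_cont (\<lambda>f. Re (c * qform (pmean f A B) x))"
proof -
  have "Re (c * qform (pmean f A B) x) = (\<Sum>i<n. \<Sum>j<n. Re ((c * (x $ j * cnj (x $ i))) * pmean f A B $$ (i,j)))" for f
    unfolding qform_entries[OF pmean_carrier[OF A B] x] by (simp only: sum_distrib_left Re_sum mult.assoc)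
  then show ?thesis
    by (simp only:) (intro affine_cont_sum affine_cont_pmean[OF A B], auto)
qed

text \<open>For positive definite A and B, the decomposition of x with A u = B w is the minimizing
  one in the variational formula for the harmonic mean. For accretive A and B it still splits the
  form, and the estimates of harmonic means start from it.\<close>

lemma harmonic_mean_qform:
  assumes A: "accretive n A" and B: "accretive n B" and x: "x \<in> carrier_vec n" and s: "0 \<le> s" "s \<le> 1"
  obtains u w z where "u \<in> carrier_vec n" "w \<in> carrier_vec n" "z \<in> carrier_vec n"
    "x = of_real s \<cdot>\<^sub>v u + of_real (1 - s) \<cdot>\<^sub>v w" "A *\<^sub>v u = z" "B *\<^sub>v w = z"
    "qform (pmean (harm s) A B) x = z \<bullet>c x"
    "qform (pmean (harm s) A B) x = of_real s * qform A u + of_real (1 - s) * qform B w"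
proof -
  define H where "H = pmean (harm s) A B"
  have Ac: "A \<in> carrier_mat n n" and Bc: "B \<in> carrier_mat n n" using A B unfolding accretive_def by auto
  note iA = minv_inverse[OF Ac accretive_det[OF A]] and iB = minv_inverse[OF Bc accretive_det[OF B]]
  have H: "H \<in> carrier_mat n n" unfolding H_def by (rule pmean_carrier[OF A B])
  define z where "z = H *\<^sub>v x"
  define u where "u = minv A *\<^sub>v z"
  define w where "w = minv B *\<^sub>v z"
  have z: "z \<in> carrier_vec n" unfolding z_def by (rule mult_mat_vec_carrier[OF H x])
  have u: "u \<in> carrier_vec n" unfolding u_def by (rule mult_mat_vec_carrier[OF iA(1) z])
  have w: "w \<in> carrier_vec n" unfolding w_def by (rule mult_mat_vec_carrier[OF iB(1) z])
  have Au: "A *\<^sub>v u = z" unfolding u_def using assoc_mult_mat_vec[OF Ac iA(1) z] iA(2) z by simp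
  have Bw: "B *\<^sub>v w = z" unfolding w_def using assoc_mult_mat_vec[OF Bc iB(1) z] iB(2) z by simp
  let ?C = "of_real s \<cdot>\<^sub>m minv A + of_real (1 - s) \<cdot>\<^sub>m minv B"
  have sm: "(c \<cdot>\<^sub>m X) *\<^sub>v z = c \<cdot>\<^sub>v (X *\<^sub>v z)" if "X \<in> carrier_mat n n" for X and c :: complex
    using that z by (intro eq_vecI) (auto simp: scalar_prod_def sum_distrib_left ac_simps)
  have "x = (?C * H) *\<^sub>v x" unfolding H_def pmean_harm[OF A B s] using x by simp
  also have "\<dots> = ?C *\<^sub>v z" unfolding z_def by (rule assoc_mult_mat_vec[of _ n n _ n]) (use iA iB H x in auto)
  also have "\<dots> = (of_real s \<cdot>\<^sub>m minv A) *\<^sub>v z + (of_real (1 - s) \<cdot>\<^sub>m minv B) *\<^sub>v z"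
    by (rule add_mult_distrib_mat_vec[of _ n n]) (use iA iB z in auto)
  also have "\<dots> = of_real s \<cdot>\<^sub>v u + of_real (1 - s) \<cdot>\<^sub>v w" unfolding u_def w_def sm[OF iA(1)] sm[OF iB(1)] ..
  finally have xx: "x = of_real s \<cdot>\<^sub>v u + of_real (1 - s) \<cdot>\<^sub>v w" .
  have q: "qform H x = z \<bullet>c x" unfolding qform_def z_def ..
  also have "\<dots> = of_real s * (z \<bullet>c u) + of_real (1 - s) * (z \<bullet>c w)"
    unfolding xx using u w z by (subst cscalar_add(2)[of _ n]) (auto simp: cscalar_smult[of _ n])
  also have "\<dots> = of_real s * qform A u + of_real (1 - s) * qform B w" unfolding qform_def Au Bw ..
  finally show ?thesis using that[OF u w z xx Au Bw] q unfolding H_def by blast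
qed

section \<open>Sectorial matrices in diagonal form\<close>

text \<open>\<open>sector_mat\<close> without the normalization of x, so that the conditions are
  homogeneous and can be added.\<close>

definition sectorial :: "nat \<Rightarrow> real \<Rightarrow> complex mat \<Rightarrow> bool" where
  "sectorial n \<theta> X \<longleftrightarrow> accretive n X \<and> (\<forall>x \<in> carrier_vec n. \<bar>Im (qform X x)\<bar> \<le> tan \<theta> * Re (qform X x))"

lemma qform_scale:
  assumes "X \<in> carrier_mat n n" "x \<in> carrier_vec n"
  shows "qform X (c \<cdot>\<^sub>v x) = of_real ((cmod c)\<^sup>2) * qform X x"
proof -
  have "X *\<^sub>v (c \<cdot>\<^sub>v x) = c \<cdot>\<^sub>v (X *\<^sub>v x)" using assms by (rule mult_mat_vec)
  then have "qform X (c \<cdot>\<^sub>v x) = (c * cnj c) * qform X x"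
    unfolding qform_def using assms by (simp add: cscalar_smult[of _ n] mult.assoc)
  then show ?thesis by (simp only: complex_norm_square)
qed

lemma sector_mat_sectorial:
  assumes X: "sector_mat n \<theta> X"
  shows "sectorial n \<theta> X"
proof -
  have Xc: "X \<in> carrier_mat n n" using X unfolding sector_mat_def by auto
  have main: "0 < Re (qform X x)" "\<bar>Im (qform X x)\<bar> \<le> tan \<theta> * Re (qform X x)"
    if x: "x \<in> carrier_vec n" "x \<noteq> 0\<^sub>v n" for x
  proof -
    define r where "r = Re (x \<bullet>c x)"
    have r: "0 < r" unfolding r_def by (rule cscalar_self_pos[OF x])
    have xx: "x \<bullet>c x = of_real r" using cscalar_self_nonneg(2)[OF x(1)] unfolding r_def by (simp add: complex_eq_iff)
    define c where "c = complex_of_real (1 / sqrt r)"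
    have c2: "(cmod c)\<^sup>2 = 1 / r" unfolding c_def using r by (simp add: norm_divide power_divide)
    have "(c \<cdot>\<^sub>v x) \<bullet>c (c \<cdot>\<^sub>v x) = qform (1\<^sub>m n) (c \<cdot>\<^sub>v x)" using x by (simp add: qform_one)
    also have "\<dots> = 1" using r by (simp only: qform_scale[OF one_carrier_mat x(1)] qform_one[OF x(1)] c2 xx) simp
    finally have "0 < Re (qform X (c \<cdot>\<^sub>v x)) \<and> \<bar>Im (qform X (c \<cdot>\<^sub>v x))\<bar> \<le> Re (qform X (c \<cdot>\<^sub>v x)) * tan \<theta>"
      using X x unfolding sector_mat_def by auto
    then have "0 < Re (qform X x) / r" "\<bar>Im (qform X x) / r\<bar> \<le> Re (qform X x) / r * tan \<theta>"
      unfolding qform_scale[OF Xc x(1)] c2 by simp_all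
    then show "0 < Re (qform X x)" "\<bar>Im (qform X x)\<bar> \<le> tan \<theta> * Re (qform X x)"
      using r by (simp_all add: zero_less_divide_iff divide_le_cancel abs_div_pos[symmetric] mult.commute)
  qed
  have "qform X (0\<^sub>v n) = 0" unfolding qform_def using Xc by (auto simp: scalar_prod_def)
  then show ?thesis
    unfolding sectorial_def accretive_def using Xc main by (metis abs_zero complex.sel(1,2) mult_zero_right order_refl zero_complex.sel)
qed

lemma accretive_pd_Re:
  assumes "accretive n X" shows "pd_mat n (mat_Re X)"
  using assms hermitian_mat_Re[of X n] qform_mat_Re[of X n] unfolding accretive_def pd_mat_def by auto

lemma diag_form:
  assumes "S \<in> carrier_mat n n" "x \<in> carrier_vec n"
  shows "qform (S * mat_diag n (\<lambda>i. of_real (d i)) * mat_adjoint S) x =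
    of_real (\<Sum>i<n. d i * (cmod ((mat_adjoint S *\<^sub>v x) $ i))\<^sup>2)"
proof -
  have c: "mat_adjoint S *\<^sub>v x \<in> carrier_vec n" by (rule mult_mat_vec_carrier[of _ n n]) (use assms in auto)
  show ?thesis using assms by (subst qform_cong[of _ n n]) (auto simp: qform_diag[OF c])
qed

text \<open>The columns of the adjoint of T have unit vectors as coordinates, so a diagonal form
  evaluated there shows one diagonal entry.\<close>

lemma diag_test_vector:
  assumes "(S::complex mat) \<in> carrier_mat n n" "T \<in> carrier_mat n n" "T * S = 1\<^sub>m n" "i < n"
  shows "mat_adjoint T *\<^sub>v unit_vec n i \<in> carrier_vec n" "mat_adjoint T *\<^sub>v unit_vec n i \<noteq> 0\<^sub>v n"
    "mat_adjoint S *\<^sub>v (mat_adjoint T *\<^sub>v unit_vec n i) = unit_vec n i"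
proof -
  show c: "mat_adjoint T *\<^sub>v unit_vec n i \<in> carrier_vec n"
    by (rule mult_mat_vec_carrier[of _ n n]) (use assms in auto)
  have "mat_adjoint S * mat_adjoint T = 1\<^sub>m n"
    using adj_mult[OF assms(2,1)] assms(3) by simp
  then show e: "mat_adjoint S *\<^sub>v (mat_adjoint T *\<^sub>v unit_vec n i) = unit_vec n i"
    using assoc_mult_mat_vec[of "mat_adjoint S" n n "mat_adjoint T" n "unit_vec n i"] assms by simp
  show "mat_adjoint T *\<^sub>v unit_vec n i \<noteq> 0\<^sub>v n"
  proof
    assume "mat_adjoint T *\<^sub>v unit_vec n i = 0\<^sub>v n"
    moreover have "mat_adjoint S *\<^sub>v 0\<^sub>v n = 0\<^sub>v n" using assms(1) by (intro eq_vecI) auto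
    ultimately have "unit_vec n i = (0\<^sub>v n :: complex vec)" using e by simp
    then show False using assms(4) by simp
  qed
qed

lemma sum_unit_vec: "i < n \<Longrightarrow> (\<Sum>k<n. d k * (cmod (unit_vec n i $ k))\<^sup>2) = (d i :: real)"
proof -
  assume i: "i < n"
  have "(\<Sum>k<n. d k * (cmod (unit_vec n i $ k))\<^sup>2) = (\<Sum>k<n. if k = i then d i else 0)"
    using i by (intro sum.cong) (auto simp: unit_vec_def)
  then show ?thesis using i by simp
qed

lemma det_mat_diag: "det (mat_diag n f) = (\<Prod>i<n. f i)" for f :: "nat \<Rightarrow> complex"
proof -
  have "det (mat_diag n f) = prod_list (diag_mat (mat_diag n f))"
    by (rule det_upper_triangular[of _ n]) (auto simp: mat_diag_def)
  also have "diag_mat (mat_diag n f) = map f [0..<n]"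
    unfolding diag_mat_def by (auto simp: mat_diag_def)
  also have "prod_list (map f [0..<n]) = (\<Prod>i<n. f i)"
    by (simp add: prod.distinct_set_conv_list[symmetric] atLeast0LessThan)
  finally show ?thesis .
qed

lemma det_diag_cong:
  assumes "(S::complex mat) \<in> carrier_mat n n"
  shows "det (S * mat_diag n f * mat_adjoint S) = det S * det (mat_adjoint S) * (\<Prod>i<n. f i)"
  using assms det_mult[of "S * mat_diag n f" n "mat_adjoint S"] det_mult[of S n "mat_diag n f"]
  by (simp add: det_mat_diag)

text \<open>Diagonalize both by one congruence S, with X going to the identity and Y to diag d. The
  test vectors give d i \<ge> 1, and the factor coming from S is common to both
  determinants.\<close>

lemma det_mono:
  assumes X: "pd_mat n X" and Y: "hermitian_mat n Y"
    and le: "\<And>x. x \<in> carrier_vec n \<Longrightarrow> Re (qform X x) \<le> Re (qform Y x)"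
  shows "cmod (det X) \<le> cmod (det Y)"
proof -
  obtain S T d where S: "S \<in> carrier_mat n n" "T \<in> carrier_mat n n" "S * T = 1\<^sub>m n" "T * S = 1\<^sub>m n"
    and XY: "X = S * mat_adjoint S" "Y = S * mat_diag n (\<lambda>i. complex_of_real (d i)) * mat_adjoint S"
    using simultaneous_diagonalization[OF X Y] .
  have X1: "X = S * mat_diag n (\<lambda>i. complex_of_real 1) * mat_adjoint S" using XY S by simp
  have d: "1 \<le> d i" if "i < n" for i
  proof -
    note t = diag_test_vector[OF S(1,2,4) that]
    have "Re (qform X (mat_adjoint T *\<^sub>v unit_vec n i)) = 1"
      unfolding X1 diag_form[OF S(1) t(1)] t(3) sum_unit_vec[OF that] by simp
    moreover have "Re (qform Y (mat_adjoint T *\<^sub>v unit_vec n i)) = d i"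
      unfolding XY(2) diag_form[OF S(1) t(1)] t(3) sum_unit_vec[OF that] by simp
    ultimately show ?thesis using le[OF t(1)] by simp
  qed
  have "cmod (det X) = cmod (det S * det (mat_adjoint S)) * 1" unfolding X1 det_diag_cong[OF S(1)] by simp
  also have "\<dots> \<le> cmod (det S * det (mat_adjoint S)) * cmod (\<Prod>i<n. complex_of_real (d i))"
  proof (intro mult_left_mono)
    have "1 \<le> (\<Prod>i<n. \<bar>d i\<bar>)" using d by (intro prod_ge_1) force
    then show "1 \<le> cmod (\<Prod>i<n. complex_of_real (d i))" by (simp add: prod_norm[symmetric])
  qed simp
  also have "\<dots> = cmod (det Y)" unfolding XY(2) det_diag_cong[OF S(1)] by (simp add: norm_mult)
  finally show ?thesis .
qed

text \<open>Cartesian decomposition: the imaginary part of X is \<open>mat_Re\<close> of -i X, and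
  it is diagonalized together with the positive definite real part. In these coordinates d i is the
  tangent of the argument of the diagonal entry.\<close>

lemma sectorial_diag:
  assumes X: "sectorial n \<theta> X"
  obtains S T d where "S \<in> carrier_mat n n" "T \<in> carrier_mat n n" "S * T = 1\<^sub>m n" "T * S = 1\<^sub>m n"
    "mat_Re X = S * mat_adjoint S" "X = S * mat_diag n (\<lambda>i. Complex 1 (d i)) * mat_adjoint S"
    "\<And>i. i < n \<Longrightarrow> \<bar>d i\<bar> \<le> tan \<theta>"
proof -
  have acc: "accretive n X" and Xc: "X \<in> carrier_mat n n"
    and sec: "\<And>x. x \<in> carrier_vec n \<Longrightarrow> \<bar>Im (qform X x)\<bar> \<le> tan \<theta> * Re (qform X x)"
    using X unfolding sectorial_def accretive_def by auto
  have iX: "(- \<i>) \<cdot>\<^sub>m X \<in> carrier_mat n n" using Xc by simp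
  obtain S T d where S: "S \<in> carrier_mat n n" "T \<in> carrier_mat n n" "S * T = 1\<^sub>m n" "T * S = 1\<^sub>m n"
    and R: "mat_Re X = S * mat_adjoint S"
      "mat_Re ((- \<i>) \<cdot>\<^sub>m X) = S * mat_diag n (\<lambda>i. complex_of_real (d i)) * mat_adjoint S"
    using simultaneous_diagonalization[OF accretive_pd_Re[OF acc] hermitian_mat_Re[OF iX]] .
  have XX: "X = S * mat_diag n (\<lambda>i. Complex 1 (d i)) * mat_adjoint S"
  proof (rule eq_matI)
    fix i j assume "i < dim_row (S * mat_diag n (\<lambda>i. Complex 1 (d i)) * mat_adjoint S)"
      "j < dim_col (S * mat_diag n (\<lambda>i. Complex 1 (d i)) * mat_adjoint S)"
    then have ij: "i < n" "j < n" using S by auto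
    have "X $$ (i,j) = mat_Re X $$ (i,j) + \<i> * mat_Re ((- \<i>) \<cdot>\<^sub>m X) $$ (i,j)"
      unfolding mat_Re_def using Xc ij by (simp add: field_simps)
    also have "mat_Re X $$ (i,j) = (S * mat_diag n (\<lambda>i. 1) * mat_adjoint S) $$ (i,j)"
      unfolding R(1) using S by simp
    also have "\<dots> = (\<Sum>k<n. S $$ (i,k) * 1 * cnj (S $$ (j,k)))" by (rule diag_cong_index[OF S(1) ij])
    also have "mat_Re ((- \<i>) \<cdot>\<^sub>m X) $$ (i,j) = (\<Sum>k<n. S $$ (i,k) * complex_of_real (d k) * cnj (S $$ (j,k)))"
      unfolding R(2) by (rule diag_cong_index[OF S(1) ij])
    also have "(\<Sum>k<n. S $$ (i,k) * 1 * cnj (S $$ (j,k))) + \<i> * (\<Sum>k<n. S $$ (i,k) * complex_of_real (d k) * cnj (S $$ (j,k)))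
        = (\<Sum>k<n. S $$ (i,k) * Complex 1 (d k) * cnj (S $$ (j,k)))"
      unfolding sum_distrib_left sum.distrib[symmetric]
      by (intro sum.cong) (auto simp: complex_eq_iff algebra_simps)
    also have "\<dots> = (S * mat_diag n (\<lambda>i. Complex 1 (d i)) * mat_adjoint S) $$ (i,j)"
      by (rule diag_cong_index[OF S(1) ij, symmetric])
    finally show "X $$ (i,j) = (S * mat_diag n (\<lambda>i. Complex 1 (d i)) * mat_adjoint S) $$ (i,j)" .
  qed (use Xc S in auto)
  have "\<bar>d i\<bar> \<le> tan \<theta>" if i: "i < n" for i
  proof -
    note t = diag_test_vector[OF S(1,2,4) i]
    define x where "x = mat_adjoint T *\<^sub>v unit_vec n i"
    have xc: "x \<in> carrier_vec n" unfolding x_def by (rule t(1))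
    have X1: "mat_Re X = S * mat_diag n (\<lambda>i. complex_of_real 1) * mat_adjoint S" using R(1) S by simp
    have "qform (mat_Re X) x = of_real 1"
      unfolding X1 diag_form[OF S(1) xc] unfolding x_def t(3) sum_unit_vec[OF i] ..
    then have re: "Re (qform X x) = 1" using qform_mat_Re[OF Xc xc] by simp
    have "qform (mat_Re ((- \<i>) \<cdot>\<^sub>m X)) x = of_real (d i)"
      unfolding R(2) diag_form[OF S(1) xc] unfolding x_def t(3) sum_unit_vec[OF i] ..
    then have "Im (qform X x) = d i" using qform_mat_Re[OF iX xc] qform_smult[OF Xc xc, of "- \<i>"] by simp
    then show ?thesis using sec[OF xc] re by simp
  qed
  then show ?thesis using that[OF S R(1) XX] by blast
qed

lemma cmod_Complex_sec:
  assumes "0 \<le> \<theta>" "\<theta> < pi / 2" "\<bar>d\<bar> \<le> tan \<theta>"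
  shows "1 + d\<^sup>2 \<le> (1 / cos \<theta>)\<^sup>2"
proof -
  have c: "cos \<theta> > 0" using assms by (intro cos_gt_zero_pi) auto
  have "d\<^sup>2 \<le> (tan \<theta>)\<^sup>2" using power_mono[OF assms(3), of 2] by simp
  also have "1 + (tan \<theta>)\<^sup>2 = (1 / cos \<theta>)\<^sup>2"
    using c sin_cos_squared_add[of \<theta>] unfolding tan_def by (simp add: field_simps)
  finally show ?thesis by simp
qed

text \<open>In diagonal form det X is det (Re X) times the product of the 1 + i d_k, and each factor
  has modulus between 1 and sec \<theta>.\<close>

lemma sectorial_det:
  assumes th: "0 \<le> \<theta>" "\<theta> < pi / 2" and X: "sectorial n \<theta> X"
  shows "cmod (det X) \<le> (1 / cos \<theta>) ^ n * cmod (det (mat_Re X))" "cmod (det (mat_Re X)) \<le> cmod (det X)"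
proof -
  obtain S T d where S: "S \<in> carrier_mat n n" and R: "mat_Re X = S * mat_adjoint S"
    and XX: "X = S * mat_diag n (\<lambda>i. Complex 1 (d i)) * mat_adjoint S"
    and d: "\<And>i. i < n \<Longrightarrow> \<bar>d i\<bar> \<le> tan \<theta>"
    using sectorial_diag[OF X] by metis
  have c: "cos \<theta> > 0" using th by (intro cos_gt_zero_pi) auto
  have "mat_Re X = S * mat_diag n (\<lambda>i. 1) * mat_adjoint S" using R S by simp
  then have dR: "det (mat_Re X) = det S * det (mat_adjoint S)" using det_diag_cong[OF S, of "\<lambda>_. 1"] by simp
  have dX: "cmod (det X) = cmod (det (mat_Re X)) * (\<Prod>i<n. cmod (Complex 1 (d i)))"
  proof -
    have "det X = det S * det (mat_adjoint S) * (\<Prod>i<n. Complex 1 (d i))"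
      by (subst XX) (rule det_diag_cong[OF S])
    then show ?thesis unfolding dR by (simp add: norm_mult prod_norm)
  qed
  have up: "cmod (Complex 1 (d i)) \<le> 1 / cos \<theta>" if "i < n" for i
  proof (rule power2_le_imp_le)
    show "(cmod (Complex 1 (d i)))\<^sup>2 \<le> (1 / cos \<theta>)\<^sup>2"
      unfolding cmod_power2 using cmod_Complex_sec[OF th d[OF that]] by simp
  qed (use c in simp)
  have lo: "1 \<le> cmod (Complex 1 (d i))" for i
    using complex_Re_le_cmod[of "Complex 1 (d i)"] by simp
  have "(\<Prod>i<n. cmod (Complex 1 (d i))) \<le> (\<Prod>i<n. 1 / cos \<theta>)" using up by (intro prod_mono) auto
  then show "cmod (det X) \<le> (1 / cos \<theta>) ^ n * cmod (det (mat_Re X))"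
    unfolding dX by (subst mult.commute) (intro mult_right_mono, auto)
  have "1 \<le> (\<Prod>i<n. cmod (Complex 1 (d i)))" using lo by (intro prod_ge_1) auto
  then show "cmod (det (mat_Re X)) \<le> cmod (det X)"
    unfolding dX using mult_left_mono[of 1 _ "cmod (det (mat_Re X))"] by simp
qed

text \<open>This is cos^2 \<theta> (Re X)^-1 \<le> Re (X^-1), written with z = X u so that no form
  of X^-1 occurs. With a the coordinates of u, the form of (Re X)^-1 at z is the sum of (1 + d_i^2)
  |a_i|^2, while Re q_X(u) is the sum of |a_i|^2.\<close>

lemma sectorial_inverse_Re:
  assumes th: "0 \<le> \<theta>" "\<theta> < pi / 2" and X: "sectorial n \<theta> X"
    and u: "u \<in> carrier_vec n" "X *\<^sub>v u = z"
  shows "(cos \<theta>)\<^sup>2 * Re (qform (minv (mat_Re X)) z) \<le> Re (qform X u)"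
proof -
  note as = assoc_mult_mat_vec[of _ n n _ n]
  have Xc: "X \<in> carrier_mat n n" using X unfolding sectorial_def accretive_def by auto
  obtain S T d where S: "S \<in> carrier_mat n n" "T \<in> carrier_mat n n" "S * T = 1\<^sub>m n" "T * S = 1\<^sub>m n"
    and R: "mat_Re X = S * mat_adjoint S"
    and XX: "X = S * mat_diag n (\<lambda>i. Complex 1 (d i)) * mat_adjoint S"
    and d: "\<And>i. i < n \<Longrightarrow> \<bar>d i\<bar> \<le> tan \<theta>"
    using sectorial_diag[OF X] by metis
  have c: "cos \<theta> > 0" using th by (intro cos_gt_zero_pi) auto
  have aS: "mat_adjoint S \<in> carrier_mat n n" "mat_adjoint T \<in> carrier_mat n n" using S by auto
  have aST: "mat_adjoint S * mat_adjoint T = 1\<^sub>m n" using adj_mult[OF S(2,1)] S(4) by simp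
  have mR: "minv (mat_Re X) = mat_adjoint T * T"
  proof (rule minv_eq[where n = n])
    have "mat_Re X * (mat_adjoint T * T) = S * (mat_adjoint S * mat_adjoint T) * T"
      unfolding R using S aS by (simp add: assoc_mult_mat[of _ n n _ n _ n])
    then show "mat_Re X * (mat_adjoint T * T) = 1\<^sub>m n" unfolding aST using S by simp
  qed (use S aS R in auto)
  define a where "a = mat_adjoint S *\<^sub>v u"
  have a: "a \<in> carrier_vec n" unfolding a_def by (rule mult_mat_vec_carrier[OF aS(1) u(1)])
  have zc: "z \<in> carrier_vec n" unfolding u(2)[symmetric] by (rule mult_mat_vec_carrier[OF Xc u(1)])
  have Da: "mat_diag n (\<lambda>i. Complex 1 (d i)) *\<^sub>v a \<in> carrier_vec n" by (rule mult_mat_vec_carrier[OF mat_diag_dim a])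
  have "z = S *\<^sub>v (mat_diag n (\<lambda>i. Complex 1 (d i)) *\<^sub>v a)"
  proof -
    have "z = (S * mat_diag n (\<lambda>i. Complex 1 (d i))) *\<^sub>v a"
      unfolding u(2)[symmetric] a_def by (subst XX, rule as) (use S aS u in auto)
    also have "\<dots> = S *\<^sub>v (mat_diag n (\<lambda>i. Complex 1 (d i)) *\<^sub>v a)" by (rule as) (use S a in auto)
    finally show ?thesis .
  qed
  then have Tz: "T *\<^sub>v z = mat_diag n (\<lambda>i. Complex 1 (d i)) *\<^sub>v a"
    using as[OF S(2,1) Da] S(4) Da by simp
  have Tzi: "(T *\<^sub>v z) $ i = Complex 1 (d i) * a $ i" if "i < n" for i
    unfolding Tz using a that by (auto simp: mat_diag_def scalar_prod_def if_distrib if_distribR cong: if_cong)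
  have Tzc: "T *\<^sub>v z \<in> carrier_vec n" by (rule mult_mat_vec_carrier[OF S(2) zc])
  have "qform (minv (mat_Re X)) z = (T *\<^sub>v z) \<bullet>c (T *\<^sub>v z)"
  proof -
    have "(mat_adjoint T * T) *\<^sub>v z = mat_adjoint T *\<^sub>v (T *\<^sub>v z)" by (rule as[OF aS(2) S(2) zc])
    then show ?thesis unfolding qform_def mR using cscalar_adj[OF aS(2) Tzc zc] by simp
  qed
  also have "\<dots> = of_real (\<Sum>i<n. (1 + (d i)\<^sup>2) * (cmod (a $ i))\<^sup>2)"
    unfolding cscalar_self[OF Tzc]
    by (intro arg_cong[where f = of_real] sum.cong) (auto simp: Tzi norm_mult power_mult_distrib cmod_power2[of "Complex _ _"])
  finally have "(cos \<theta>)\<^sup>2 * Re (qform (minv (mat_Re X)) z) = (\<Sum>i<n. ((cos \<theta>)\<^sup>2 * (1 + (d i)\<^sup>2)) * (cmod (a $ i))\<^sup>2)"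
    by (simp add: sum_distrib_left mult.assoc)
  also have "\<dots> \<le> (\<Sum>i<n. 1 * (cmod (a $ i))\<^sup>2)"
  proof (intro sum_mono mult_right_mono)
    fix i assume "i \<in> {..<n}"
    then have "(cos \<theta>)\<^sup>2 * (1 + (d i)\<^sup>2) \<le> (cos \<theta>)\<^sup>2 * (1 / cos \<theta>)\<^sup>2"
      using cmod_Complex_sec[OF th d] by (intro mult_left_mono) auto
    then show "(cos \<theta>)\<^sup>2 * (1 + (d i)\<^sup>2) \<le> 1" using c by (simp add: power_divide)
  qed simp
  also have "\<dots> = Re (qform X u)"
  proof -
    have "qform (mat_Re X) u = qform (S * mat_diag n (\<lambda>i. complex_of_real 1) * mat_adjoint S) u" using R S by simp
    then have "Re (qform (mat_Re X) u) = (\<Sum>i<n. 1 * (cmod (a $ i))\<^sup>2)"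
      unfolding diag_form[OF S(1) u(1)] a_def by simp
    then show ?thesis unfolding qform_mat_Re[OF Xc u(1)] by simp
  qed
  finally show ?thesis .
qed

section \<open>Determinant inequalities\<close>

lemma harm_of_real_Re: "Re (harm s (of_real t)) = t / (s * t + (1 - s))"
  unfolding harm_of_real by simp

lemma harm_den_pos: "0 \<le> s \<Longrightarrow> s \<le> 1 \<Longrightarrow> 0 < t \<Longrightarrow> 0 < s * t + (1 - s :: real)"
  by (cases "s = 0") (auto intro: add_pos_nonneg)

text \<open>Cleared of denominators the gap is s (1 - s) (t - 1)^2.\<close>

lemma harm_le_arith:
  fixes s t :: real
  assumes "0 \<le> s" "s \<le> 1" "0 < t"
  shows "t / (s * t + (1 - s)) \<le> s + (1 - s) * t"
proof -
  have "(s + (1 - s) * t) * (s * t + (1 - s)) - t = s * (1 - s) * (t - 1)\<^sup>2"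
    by (simp add: power2_eq_square algebra_simps)
  moreover have "0 \<le> s * (1 - s) * (t - 1)\<^sup>2" using assms by simp
  ultimately have "t \<le> (s + (1 - s) * t) * (s * t + (1 - s))" by linarith
  then show ?thesis using harm_den_pos[OF assms] by (simp add: divide_le_eq)
qed

text \<open>Bounding each harmonic value by its arithmetic counterpart gives s + (1 - s) t for the
  first term and s t + 1 - s for the second. Their sum 1 + t is independent of s, so the bound
  passes to g, and the product is then estimated by the arithmetic-geometric mean
  inequality.\<close>

lemma op_mean_fun_symmetric_product:
  assumes g: "op_mean_fun g" and t: "0 < t"
  shows "g t * g (1 / t) \<le> (1 + t)\<^sup>2 / (4 * t)"
proof -
  let ?L = "\<lambda>f. (1 + t) - (Re (f (of_real t)) + t * Re (f (of_real (1 / t))))"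
  have "0 \<le> ?L (hol_ext g)"
  proof (rule affine_cont_nonneg[OF _ _ hol_ext_loewner(1)[OF g]])
    show "affine_cont ?L"
      by (intro affine_cont_diff affine_cont_const affine_cont_add affine_cont_scale affine_cont_eval of_real_in_slit_plane)
        (use t in auto)
    fix s :: real assume s: "0 \<le> s" "s \<le> 1"
    have "Re (harm s (of_real (1 / t))) \<le> s + (1 - s) * (1 / t)"
      unfolding harm_of_real_Re by (rule harm_le_arith) (use s t in auto)
    then have "t * Re (harm s (of_real (1 / t))) \<le> t * (s + (1 - s) * (1 / t))"
      using t by (intro mult_left_mono) auto
    also have "\<dots> = s * t + (1 - s)" using t by (simp add: field_simps)
    finally show "0 \<le> ?L (harm s)"
      using harm_le_arith[OF s t] unfolding harm_of_real_Re by (simp add: algebra_simps)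
  qed
  then have "g t + t * g (1 / t) \<le> 1 + t"
    using hol_ext_loewner(2)[OF g t] hol_ext_loewner(2)[OF g, of "1 / t"] t by simp
  moreover have "0 < g t" "0 < g (1 / t)" using g t unfolding op_mean_fun_def by auto
  ultimately have "(g t + t * g (1 / t))\<^sup>2 \<le> (1 + t)\<^sup>2"
    using t by (intro power_mono) (auto intro: add_nonneg_nonneg mult_nonneg_nonneg less_imp_le)
  moreover have "4 * (g t * (t * g (1 / t))) \<le> (g t + t * g (1 / t))\<^sup>2"
    using zero_le_power2[of "g t - t * g (1 / t)"] by (simp add: power2_eq_square algebra_simps)
  ultimately have "(g t * g (1 / t)) * (4 * t) \<le> (1 + t)\<^sup>2" by (simp add: mult_ac)
  then show ?thesis using t by (simp add: le_divide_eq)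
qed

section \<open>Two sectorial matrices in coordinates that diagonalize their real parts\<close>

locale sectorial_pair =
  fixes n :: nat and \<theta> :: real and A B S T :: "complex mat" and d :: "nat \<Rightarrow> real"
  assumes th: "0 \<le> \<theta>" "\<theta> < pi / 2"
    and A: "sectorial n \<theta> A" and B: "sectorial n \<theta> B"
    and S: "S \<in> carrier_mat n n" "T \<in> carrier_mat n n" "S * T = 1\<^sub>m n" "T * S = 1\<^sub>m n"
    and ReA: "mat_Re A = S * mat_adjoint S"
    and ReB: "mat_Re B = S * mat_diag n (\<lambda>i. complex_of_real (d i)) * mat_adjoint S"
begin

abbreviation "coord x i \<equiv> (mat_adjoint S *\<^sub>v x) $ i"

abbreviation "diag_cong f \<equiv> S * mat_diag n (\<lambda>i. complex_of_real (f i)) * mat_adjoint S"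

lemma acc: "accretive n A" "accretive n B" "A \<in> carrier_mat n n" "B \<in> carrier_mat n n"
  using A B unfolding sectorial_def accretive_def by auto

lemma adjoint_carriers: "mat_adjoint S \<in> carrier_mat n n" "mat_adjoint T \<in> carrier_mat n n"
  using S by auto

lemma ReA': "mat_Re A = diag_cong (\<lambda>_. 1)"
  using ReA S by simp

lemma qform_A: "x \<in> carrier_vec n \<Longrightarrow> Re (qform A x) = (\<Sum>i<n. 1 * (cmod (coord x i))\<^sup>2)"
  using qform_mat_Re[OF acc(3), of x] diag_form[OF S(1), of x "\<lambda>_. 1"] unfolding ReA' by (metis Re_complex_of_real)

lemma qform_B: "x \<in> carrier_vec n \<Longrightarrow> Re (qform B x) = (\<Sum>i<n. d i * (cmod (coord x i))\<^sup>2)"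
  using qform_mat_Re[OF acc(4), of x] diag_form[OF S(1), of x d] unfolding ReB by (metis Re_complex_of_real)

lemma test_values:
  assumes "i < n"
  defines "x \<equiv> mat_adjoint T *\<^sub>v unit_vec n i"
  shows "x \<in> carrier_vec n" "x \<noteq> 0\<^sub>v n" "Re (qform A x) = 1" "Re (qform B x) = d i"
proof -
  note t = diag_test_vector[OF S(1,2,4) assms(1), folded x_def]
  show "x \<in> carrier_vec n" "x \<noteq> 0\<^sub>v n" using t by auto
  show "Re (qform A x) = 1" unfolding qform_A[OF t(1)] t(3) sum_unit_vec[OF assms(1)] ..
  show "Re (qform B x) = d i" unfolding qform_B[OF t(1)] t(3) sum_unit_vec[OF assms(1)] ..
qed

lemma d_pos: "i < n \<Longrightarrow> 0 < d i"
  using test_values[of i] acc(2) unfolding accretive_def by metis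

lemma coord_carrier: "x \<in> carrier_vec n \<Longrightarrow> mat_adjoint S *\<^sub>v x \<in> carrier_vec n"
  by (rule mult_mat_vec_carrier[OF adjoint_carriers(1)])

lemma coord_nonzero:
  assumes x: "x \<in> carrier_vec n" "x \<noteq> 0\<^sub>v n"
  obtains i where "i < n" "coord x i \<noteq> 0"
proof -
  have "mat_adjoint S *\<^sub>v x \<noteq> 0\<^sub>v n"
  proof
    assume 0: "mat_adjoint S *\<^sub>v x = 0\<^sub>v n"
    have "mat_adjoint T * mat_adjoint S = 1\<^sub>m n" using adj_mult[OF S(1,2)] S(3) by simp
    then have "x = mat_adjoint T *\<^sub>v (mat_adjoint S *\<^sub>v x)"
      using assoc_mult_mat_vec[OF adjoint_carriers(2,1) x(1)] x by simp
    also have "\<dots> = 0\<^sub>v n" unfolding 0 using S(2) by (intro eq_vecI) auto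
    finally show False using x(2) by simp
  qed
  then show ?thesis using that coord_carrier[OF x(1)] by (metis eq_vecI carrier_vecD index_zero_vec)
qed

text \<open>The triangle inequality reduces each coordinate to scalars, where d/(s d + 1 - s) times
  (s p + (1 - s) r)^2 is at most s p^2 + (1 - s) d r^2.\<close>

lemma harm_lower:
  assumes x: "x \<in> carrier_vec n" and s: "0 \<le> s" "s \<le> 1"
  shows "(\<Sum>i<n. Re (harm s (of_real (d i))) * (cmod (coord x i))\<^sup>2) \<le> Re (qform (pmean (harm s) A B) x)"
proof -
  obtain u w z where u: "u \<in> carrier_vec n" and w: "w \<in> carrier_vec n"
    and xx: "x = of_real s \<cdot>\<^sub>v u + of_real (1 - s) \<cdot>\<^sub>v w"
    and q: "qform (pmean (harm s) A B) x = of_real s * qform A u + of_real (1 - s) * qform B w"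
    by (rule harmonic_mean_qform[OF acc(1,2) x s]) blast
  have ci: "coord x i = of_real s * coord u i + of_real (1 - s) * coord w i" if "i < n" for i
  proof -
    have "mat_adjoint S *\<^sub>v x = mat_adjoint S *\<^sub>v (of_real s \<cdot>\<^sub>v u) + mat_adjoint S *\<^sub>v (of_real (1 - s) \<cdot>\<^sub>v w)"
      unfolding xx by (rule mult_add_distrib_mat_vec[OF adjoint_carriers(1)]) (use u w in auto)
    also have "\<dots> = of_real s \<cdot>\<^sub>v (mat_adjoint S *\<^sub>v u) + of_real (1 - s) \<cdot>\<^sub>v (mat_adjoint S *\<^sub>v w)"
      using mult_mat_vec[OF adjoint_carriers(1) u] mult_mat_vec[OF adjoint_carriers(1) w] by simp
    finally show ?thesis
      using that carrier_vecD[OF coord_carrier[OF u]] carrier_vecD[OF coord_carrier[OF w]]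
      by (simp del: index_mult_mat_vec dim_mult_mat_vec)
  qed
  have "Re (harm s (of_real (d i))) * (cmod (coord x i))\<^sup>2 \<le> s * (cmod (coord u i))\<^sup>2 + (1 - s) * (d i * (cmod (coord w i))\<^sup>2)"
    if i: "i < n" for i
  proof -
    define p where "p = cmod (coord u i)"
    define r where "r = cmod (coord w i)"
    define D where "D = s * d i + (1 - s)"
    have D: "0 < D" unfolding D_def by (rule harm_den_pos[OF s d_pos[OF i]])
    have "cmod (coord x i) \<le> s * p + (1 - s) * r"
      unfolding ci[OF i] p_def r_def
      by (rule order_trans[OF norm_triangle_ineq]) (use s in \<open>simp add: norm_mult del: of_real_diff index_mult_mat_vec\<close>)
    then have "(cmod (coord x i))\<^sup>2 \<le> (s * p + (1 - s) * r)\<^sup>2" by (rule power_mono) simp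
    then have "d i / D * (cmod (coord x i))\<^sup>2 \<le> d i / D * (s * p + (1 - s) * r)\<^sup>2"
      using D d_pos[OF i] by (intro mult_left_mono) auto
    also have "\<dots> \<le> s * p\<^sup>2 + (1 - s) * (d i * r\<^sup>2)"
    proof -
      \<comment> \<open>The square on the right vanishes at p = d r, the scalar counterpart of A u =
        B w.\<close>
      have "(s * p\<^sup>2 + (1 - s) * (d i * r\<^sup>2)) * D - d i * (s * p + (1 - s) * r)\<^sup>2 = s * (1 - s) * (p - d i * r)\<^sup>2"
        unfolding D_def by (simp add: power2_eq_square algebra_simps)
      moreover have "0 \<le> s * (1 - s) * (p - d i * r)\<^sup>2" using s by simp
      ultimately have "d i * (s * p + (1 - s) * r)\<^sup>2 \<le> (s * p\<^sup>2 + (1 - s) * (d i * r\<^sup>2)) * D" by linarith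
      then show ?thesis using D by (simp add: divide_le_eq)
    qed
    finally show ?thesis unfolding harm_of_real_Re p_def r_def D_def .
  qed
  then have "(\<Sum>i<n. Re (harm s (of_real (d i))) * (cmod (coord x i))\<^sup>2) \<le>
      (\<Sum>i<n. s * (cmod (coord u i))\<^sup>2 + (1 - s) * (d i * (cmod (coord w i))\<^sup>2))"
    by (intro sum_mono) auto
  also have "\<dots> = s * Re (qform A u) + (1 - s) * Re (qform B w)"
    unfolding qform_A[OF u] qform_B[OF w] by (simp add: sum.distrib sum_distrib_left del: index_mult_mat_vec)
  also have "\<dots> = Re (qform (pmean (harm s) A B) x)" unfolding q by (simp del: of_real_diff)
  finally show ?thesis .
qed

text \<open>Inverting S F S^H gives T^H F^-1 T, where H marks the adjoint, so both inverses are
  diagonal in the coordinates T z.\<close>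

lemma minv_Re_forms:
  assumes z: "z \<in> carrier_vec n"
  shows "Re (qform (minv (mat_Re A)) z) = (\<Sum>i<n. 1 * (cmod ((T *\<^sub>v z) $ i))\<^sup>2)"
    "Re (qform (minv (mat_Re B)) z) = (\<Sum>i<n. 1 / d i * (cmod ((T *\<^sub>v z) $ i))\<^sup>2)"
proof -
  have inv: "minv (diag_cong f) = mat_adjoint T * mat_diag n (\<lambda>i. complex_of_real (1 / f i)) * mat_adjoint (mat_adjoint T)"
    if f: "\<And>i. i < n \<Longrightarrow> 0 < f i" for f
  proof (rule minv_eq[where n = n])
    note as = assoc_mult_mat[of _ n n _ n _ n]
    have aST: "mat_adjoint S * mat_adjoint T = 1\<^sub>m n" using adj_mult[OF S(2,1)] S(4) by simp
    let ?F = "mat_diag n (\<lambda>i. complex_of_real (f i))" and ?G = "mat_diag n (\<lambda>i. complex_of_real (1 / f i))"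
    have FG: "?F * ?G = 1\<^sub>m n"
      unfolding mat_diag_diag mat_diag_one[symmetric] by (intro mat_diag_cong) (use f in force)
    have "diag_cong f * (mat_adjoint T * ?G * mat_adjoint (mat_adjoint T)) = S * ?F * (mat_adjoint S * mat_adjoint T) * ?G * T"
      using S adjoint_carriers by (simp add: as)
    also have "\<dots> = S * (?F * ?G) * T" unfolding aST using S by (simp add: as right_mult_one_mat[of _ n n] left_mult_one_mat[of _ n n] del: mat_diag_diag)
    also have "\<dots> = 1\<^sub>m n" unfolding FG using S by simp
    finally show "diag_cong f * (mat_adjoint T * ?G * mat_adjoint (mat_adjoint T)) = 1\<^sub>m n" .
  qed (use S adjoint_carriers in auto)
  show "Re (qform (minv (mat_Re A)) z) = (\<Sum>i<n. 1 * (cmod ((T *\<^sub>v z) $ i))\<^sup>2)"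
  proof -
    have e: "minv (diag_cong (\<lambda>_. 1)) = mat_adjoint T * mat_diag n (\<lambda>i. complex_of_real (1 / 1)) * mat_adjoint (mat_adjoint T)"
      by (rule inv) simp
    show ?thesis unfolding ReA' e diag_form[OF adjoint_carriers(2) z] by simp
  qed
  show "Re (qform (minv (mat_Re B)) z) = (\<Sum>i<n. 1 / d i * (cmod ((T *\<^sub>v z) $ i))\<^sup>2)"
  proof -
    have e: "minv (diag_cong d) = mat_adjoint T * mat_diag n (\<lambda>i. complex_of_real (1 / d i)) * mat_adjoint (mat_adjoint T)"
      by (rule inv) (rule d_pos)
    show ?thesis unfolding ReB e diag_form[OF adjoint_carriers(2) z] by simp
  qed
qed

lemma cos_pos: "0 < cos \<theta>"
  using th by (intro cos_gt_zero_pi) auto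

text \<open>With \<open>z = H x\<close> one has \<open>Re q\<^sub>H(x) = 2 Re (z,x) - Re q\<^sub>H(x)\<close>; bounding the last term below by the
  form of the inverse real parts leaves a completed square in each coordinate.\<close>
lemma harm_upper:
  assumes x: "x \<in> carrier_vec n" and s: "0 \<le> s" "s \<le> 1"
  shows "Re (qform (pmean (harm s) A B) x) \<le> (1 / cos \<theta>)\<^sup>2 * (\<Sum>i<n. Re (harm s (of_real (d i))) * (cmod (coord x i))\<^sup>2)"
proof -
  obtain u w z where u: "u \<in> carrier_vec n" and w: "w \<in> carrier_vec n" and z: "z \<in> carrier_vec n"
    and Au: "A *\<^sub>v u = z" and Bw: "B *\<^sub>v w = z"
    and qz: "qform (pmean (harm s) A B) x = z \<bullet>c x"
    and q: "qform (pmean (harm s) A B) x = of_real s * qform A u + of_real (1 - s) * qform B w"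
    by (rule harmonic_mean_qform[OF acc(1,2) x s]) blast
  define b where "b i = (T *\<^sub>v z) $ i" for i
  have Tz: "T *\<^sub>v z \<in> carrier_vec n" by (rule mult_mat_vec_carrier[OF S(2) z])
  have "z = S *\<^sub>v (T *\<^sub>v z)" using assoc_mult_mat_vec[OF S(1,2) z] S(3) z by simp
  then have "z \<bullet>c x = (T *\<^sub>v z) \<bullet>c (mat_adjoint S *\<^sub>v x)" using cscalar_adj[OF S(1) Tz x] by simp
  also have "\<dots> = (\<Sum>i<n. b i * cnj (coord x i))"
    unfolding b_def by (rule cscalar_sum) (rule carrier_vecD[OF coord_carrier[OF x]])
  finally have zx: "Re (z \<bullet>c x) = (\<Sum>i<n. Re (b i * cnj (coord x i)))" by (simp only: Re_sum)
  define c where "c = cos \<theta>"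
  have c: "0 < c" unfolding c_def by (rule cos_pos)
  have "c\<^sup>2 * (s * (\<Sum>i<n. 1 * (cmod (b i))\<^sup>2) + (1 - s) * (\<Sum>i<n. 1 / d i * (cmod (b i))\<^sup>2)) \<le> Re (qform (pmean (harm s) A B) x)"
  proof -
    have "c\<^sup>2 * (\<Sum>i<n. 1 * (cmod (b i))\<^sup>2) \<le> Re (qform A u)"
      using sectorial_inverse_Re[OF th A u Au] unfolding minv_Re_forms(1)[OF z] b_def c_def .
    then have 1: "s * (c\<^sup>2 * (\<Sum>i<n. 1 * (cmod (b i))\<^sup>2)) \<le> s * Re (qform A u)" using s by (intro mult_left_mono)
    have "c\<^sup>2 * (\<Sum>i<n. 1 / d i * (cmod (b i))\<^sup>2) \<le> Re (qform B w)"
      using sectorial_inverse_Re[OF th B w Bw] unfolding minv_Re_forms(2)[OF z] b_def c_def .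
    then have 2: "(1 - s) * (c\<^sup>2 * (\<Sum>i<n. 1 / d i * (cmod (b i))\<^sup>2)) \<le> (1 - s) * Re (qform B w)" using s by (intro mult_left_mono) auto
    have "Re (qform (pmean (harm s) A B) x) = s * Re (qform A u) + (1 - s) * Re (qform B w)"
      unfolding q by (simp del: of_real_diff)
    then show ?thesis using add_mono[OF 1 2] by (simp only: distrib_left mult.left_commute)
  qed
  then have "Re (qform (pmean (harm s) A B) x) \<le> 2 * Re (z \<bullet>c x) -
      c\<^sup>2 * (s * (\<Sum>i<n. 1 * (cmod (b i))\<^sup>2) + (1 - s) * (\<Sum>i<n. 1 / d i * (cmod (b i))\<^sup>2))"
    unfolding qz by linarith
  also have "\<dots> = (\<Sum>i<n. 2 * Re (b i * cnj (coord x i)) - c\<^sup>2 * (s + (1 - s) / d i) * (cmod (b i))\<^sup>2)"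
    unfolding zx by (simp add: sum_subtractf sum.distrib sum_distrib_left algebra_simps del: index_mult_mat_vec complex_cnj)
  also have "\<dots> \<le> (\<Sum>i<n. (1 / c)\<^sup>2 * (Re (harm s (of_real (d i))) * (cmod (coord x i))\<^sup>2))"
  proof (rule sum_mono)
    fix i assume "i \<in> {..<n}"
    then have i: "i < n" by simp
    define k where "k = c\<^sup>2 * (s + (1 - s) / d i)"
    define \<beta> where "\<beta> = cmod (b i)"
    define \<alpha> where "\<alpha> = cmod (coord x i)"
    have h: "Re (harm s (of_real (d i))) = 1 / (s + (1 - s) / d i)"
      unfolding harm_of_real_Re using d_pos[OF i] harm_den_pos[OF s d_pos[OF i]] by (simp add: field_simps)
    have "s + (1 - s) / d i = (s * d i + (1 - s)) / d i" using d_pos[OF i] by (simp add: add_divide_distrib)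
    then have k: "0 < k" unfolding k_def using c d_pos[OF i] harm_den_pos[OF s d_pos[OF i]] by simp
    have "Re (b i * cnj (coord x i)) \<le> \<beta> * \<alpha>"
      using complex_Re_le_cmod[of "b i * cnj (coord x i)"] unfolding \<alpha>_def \<beta>_def by (simp add: norm_mult del: index_mult_mat_vec)
    \<comment> \<open>This is (k \<beta> - \<alpha>)^2 \<ge> 0. As k contains cos^2 \<theta>, its
      reciprocal produces the factor sec^2 \<theta>.\<close>
    moreover have "2 * (\<beta> * \<alpha>) - k * \<beta>\<^sup>2 \<le> \<alpha>\<^sup>2 / k"
      using k zero_le_power2[of "k * \<beta> - \<alpha>"] by (simp add: le_divide_eq power2_eq_square algebra_simps)
    moreover have "(1 / c)\<^sup>2 * (1 / (s + (1 - s) / d i) * \<alpha>\<^sup>2) = \<alpha>\<^sup>2 / k" unfolding k_def by (simp add: power_divide)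
    ultimately show "2 * Re (b i * cnj (coord x i)) - c\<^sup>2 * (s + (1 - s) / d i) * (cmod (b i))\<^sup>2 \<le>
        (1 / c)\<^sup>2 * (Re (harm s (of_real (d i))) * (cmod (coord x i))\<^sup>2)"
      unfolding h k_def[symmetric] \<alpha>_def[symmetric] \<beta>_def[symmetric] by linarith
  qed
  finally show ?thesis unfolding c_def sum_distrib_left .
qed

text \<open>All three bounds are affine in the representing function. The imaginary part enters as
  the real part of i and of -i times the form, because the functionals of \<open>affine_cont\<close>
  are real-valued.\<close>

lemma mean_form_bounds:
  assumes g: "op_mean_fun g" and x: "x \<in> carrier_vec n"
  shows "(\<Sum>i<n. g (d i) * (cmod (coord x i))\<^sup>2) \<le> Re (qform (mean_app g A B) x)"
    "Re (qform (mean_app g A B) x) \<le> (\<Sum>i<n. (1 / cos \<theta>)\<^sup>2 * g (d i) * (cmod (coord x i))\<^sup>2)"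
    "\<bar>Im (qform (mean_app g A B) x)\<bar> \<le> tan \<theta> * Re (qform (mean_app g A B) x)"
proof -
  note G = hol_ext_loewner[OF g]
  let ?q = "\<lambda>f. qform (pmean f A B) x"
  have q: "affine_cont (\<lambda>f. Re (c * ?q f))" for c by (rule affine_cont_qform[OF acc(1,2) x])
  have "affine_cont (\<lambda>f. \<Sum>i<n. (cmod (coord x i))\<^sup>2 * Re (f (of_real (d i))))"
    by (intro affine_cont_sum affine_cont_scale affine_cont_eval of_real_in_slit_plane d_pos) simp
  then have e: "affine_cont (\<lambda>f. \<Sum>i<n. Re (f (of_real (d i))) * (cmod (coord x i))\<^sup>2)"
    by (simp only: mult.commute)
  have ev: "(\<Sum>i<n. Re (hol_ext g (of_real (d i))) * (cmod (coord x i))\<^sup>2) = (\<Sum>i<n. g (d i) * (cmod (coord x i))\<^sup>2)"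
    by (intro sum.cong) (auto simp: G(2)[OF d_pos] simp del: index_mult_mat_vec)
  have "0 \<le> Re (1 * ?q (hol_ext g)) - (\<Sum>i<n. Re (hol_ext g (of_real (d i))) * (cmod (coord x i))\<^sup>2)"
    by (rule affine_cont_nonneg[OF affine_cont_diff[OF q e] _ G(1)]) (use harm_lower[OF x] in simp)
  then show "(\<Sum>i<n. g (d i) * (cmod (coord x i))\<^sup>2) \<le> Re (qform (mean_app g A B) x)"
    unfolding mean_app_pmean ev by simp
  have "0 \<le> (1 / cos \<theta>)\<^sup>2 * (\<Sum>i<n. Re (hol_ext g (of_real (d i))) * (cmod (coord x i))\<^sup>2) - Re (1 * ?q (hol_ext g))"
    by (rule affine_cont_nonneg[OF affine_cont_diff[OF affine_cont_scale[OF e] q] _ G(1)]) (use harm_upper[OF x] in simp)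
  then show "Re (qform (mean_app g A B) x) \<le> (\<Sum>i<n. (1 / cos \<theta>)\<^sup>2 * g (d i) * (cmod (coord x i))\<^sup>2)"
    unfolding mean_app_pmean ev by (simp add: sum_distrib_left mult.assoc del: index_mult_mat_vec)
  have sec: "\<bar>Im (?q (harm s))\<bar> \<le> tan \<theta> * Re (?q (harm s))" if s: "0 \<le> s" "s \<le> 1" for s
  proof -
    obtain u w z where u: "u \<in> carrier_vec n" and w: "w \<in> carrier_vec n"
      and q: "qform (pmean (harm s) A B) x = of_real s * qform A u + of_real (1 - s) * qform B w"
      by (rule harmonic_mean_qform[OF acc(1,2) x s]) blast
    have a: "\<bar>Im (qform A u)\<bar> \<le> tan \<theta> * Re (qform A u)" "\<bar>Im (qform B w)\<bar> \<le> tan \<theta> * Re (qform B w)"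
      using A B u w unfolding sectorial_def by auto
    have "\<bar>s * Im (qform A u) + (1 - s) * Im (qform B w)\<bar> \<le> s * \<bar>Im (qform A u)\<bar> + (1 - s) * \<bar>Im (qform B w)\<bar>"
      using s by (intro order_trans[OF abs_triangle_ineq]) (simp add: abs_mult)
    also have "\<dots> \<le> s * (tan \<theta> * Re (qform A u)) + (1 - s) * (tan \<theta> * Re (qform B w))"
      using s a by (intro add_mono mult_left_mono) auto
    finally show ?thesis unfolding q by (simp add: algebra_simps del: of_real_diff)
  qed
  have "0 \<le> tan \<theta> * Re (1 * ?q (hol_ext g)) - Re (\<i> * ?q (hol_ext g))"
    by (rule affine_cont_nonneg[OF affine_cont_diff[OF affine_cont_scale[OF q] q] _ G(1)]) (use sec in \<open>force simp: abs_le_iff\<close>)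
  moreover have "0 \<le> tan \<theta> * Re (1 * ?q (hol_ext g)) - Re ((- \<i>) * ?q (hol_ext g))"
    by (rule affine_cont_nonneg[OF affine_cont_diff[OF affine_cont_scale[OF q] q] _ G(1)]) (use sec in \<open>force simp: abs_le_iff\<close>)
  ultimately show "\<bar>Im (qform (mean_app g A B) x)\<bar> \<le> tan \<theta> * Re (qform (mean_app g A B) x)"
    unfolding mean_app_pmean by (simp add: abs_le_iff)
qed

lemma diag_cong_pd:
  assumes f: "\<And>i. i < n \<Longrightarrow> 0 < f i"
  shows "pd_mat n (diag_cong f)"
  unfolding pd_mat_def
proof (intro conjI ballI impI)
  show "hermitian_mat n (diag_cong f)" by (rule hermitian_cong[OF S(1) hermitian_diag])
  fix x :: "complex vec" assume x: "x \<in> carrier_vec n" "x \<noteq> 0\<^sub>v n"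
  obtain i where i: "i < n" "coord x i \<noteq> 0" by (rule coord_nonzero[OF x])
  have "0 < (\<Sum>i<n. f i * (cmod (coord x i))\<^sup>2)"
    using i f by (intro sum_pos2[of _ i]) (auto intro!: mult_nonneg_nonneg less_imp_le[OF f] simp del: index_mult_mat_vec)
  then show "0 < Re (qform (diag_cong f) x)" unfolding diag_form[OF S(1) x(1)] by simp
qed

text \<open>Equals |det (Re A)|; it is the factor common to the determinants of all
  \<open>diag_cong f\<close>.\<close>

definition "gram_det = cmod (det S * det (mat_adjoint S))"

lemma det_diag_cong_norm:
  assumes "\<And>i. i < n \<Longrightarrow> 0 < f i"
  shows "cmod (det (diag_cong f)) = gram_det * (\<Prod>i<n. f i)"
proof -
  have "(\<Prod>i<n. cmod (complex_of_real (f i))) = (\<Prod>i<n. f i)"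
    by (intro prod.cong) (auto simp: abs_of_pos[OF assms])
  then show ?thesis unfolding det_diag_cong[OF S(1)] gram_det_def by (simp add: norm_mult prod_norm[symmetric])
qed

lemma sectorial_mean:
  assumes g: "op_mean_fun g"
  shows "sectorial n \<theta> (mean_app g A B)"
  unfolding sectorial_def accretive_def
proof (intro conjI ballI impI)
  show "mean_app g A B \<in> carrier_mat n n" unfolding mean_app_pmean by (rule pmean_carrier[OF acc(1,2)])
  fix x :: "complex vec" assume x: "x \<in> carrier_vec n"
  show "\<bar>Im (qform (mean_app g A B) x)\<bar> \<le> tan \<theta> * Re (qform (mean_app g A B) x)" by (rule mean_form_bounds(3)[OF g x])
  assume x0: "x \<noteq> 0\<^sub>v n"
  have "pd_mat n (diag_cong (\<lambda>i. g (d i)))" using g d_pos unfolding op_mean_fun_def by (intro diag_cong_pd) auto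
  then have "0 < Re (qform (diag_cong (\<lambda>i. g (d i))) x)" using x x0 unfolding pd_mat_def by blast
  also have "\<dots> \<le> Re (qform (mean_app g A B) x)"
    unfolding diag_form[OF S(1) x] using mean_form_bounds(1)[OF g x] by simp
  finally show "0 < Re (qform (mean_app g A B) x)" .
qed

text \<open>The exponent 3n collects 2n from the factor sec^2 \<theta> in each of n coordinates and
  n from \<open>sectorial_det\<close>. The lower bound costs nothing, since |det X| dominates |det
  (Re X)|.\<close>

lemma det_mean_bounds:
  assumes g: "op_mean_fun g"
  shows "cmod (det (mean_app g A B)) \<le> (1 / cos \<theta>) ^ (3 * n) * (gram_det * (\<Prod>i<n. g (d i)))"
    "gram_det * (\<Prod>i<n. g (d i)) \<le> cmod (det (mean_app g A B))"
proof -
  have gd: "0 < g (d i)" if "i < n" for i using g d_pos[OF that] unfolding op_mean_fun_def by blast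
  note sec = sectorial_mean[OF g]
  have acM: "accretive n (mean_app g A B)" and Mc: "mean_app g A B \<in> carrier_mat n n"
    using sec unfolding sectorial_def accretive_def by auto
  let ?f = "\<lambda>i. (1 / cos \<theta>)\<^sup>2 * g (d i)"
  have fpos: "0 < ?f i" if "i < n" for i using gd[OF that] cos_pos by simp
  have "cmod (det (mat_Re (mean_app g A B))) \<le> cmod (det (diag_cong ?f))"
  proof (rule det_mono[OF accretive_pd_Re[OF acM]])
    show "hermitian_mat n (diag_cong ?f)" by (rule hermitian_cong[OF S(1) hermitian_diag])
    fix x :: "complex vec" assume x: "x \<in> carrier_vec n"
    show "Re (qform (mat_Re (mean_app g A B)) x) \<le> Re (qform (diag_cong ?f) x)"
      unfolding qform_mat_Re[OF Mc x] diag_form[OF S(1) x] using mean_form_bounds(2)[OF g x] by simp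
  qed
  also have "\<dots> = gram_det * (\<Prod>i<n. ?f i)" by (rule det_diag_cong_norm[OF fpos])
  also have "\<dots> = (1 / cos \<theta>) ^ (2 * n) * (gram_det * (\<Prod>i<n. g (d i)))"
    by (simp only: prod.distrib prod_constant card_lessThan power_mult[symmetric] mult.left_commute)
  finally have up: "cmod (det (mat_Re (mean_app g A B))) \<le> (1 / cos \<theta>) ^ (2 * n) * (gram_det * (\<Prod>i<n. g (d i)))" .
  have "cmod (det (mean_app g A B)) \<le> (1 / cos \<theta>) ^ n * cmod (det (mat_Re (mean_app g A B)))"
    by (rule sectorial_det(1)[OF th sec])
  also have "\<dots> \<le> (1 / cos \<theta>) ^ n * ((1 / cos \<theta>) ^ (2 * n) * (gram_det * (\<Prod>i<n. g (d i))))"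
    using up cos_pos by (intro mult_left_mono) auto
  also have "\<dots> = (1 / cos \<theta>) ^ (3 * n) * (gram_det * (\<Prod>i<n. g (d i)))"
    by (simp only: mult.assoc[symmetric] power_add[symmetric]) simp
  finally show "cmod (det (mean_app g A B)) \<le> (1 / cos \<theta>) ^ (3 * n) * (gram_det * (\<Prod>i<n. g (d i)))" .
  have "gram_det * (\<Prod>i<n. g (d i)) = cmod (det (diag_cong (\<lambda>i. g (d i))))"
    by (rule det_diag_cong_norm[symmetric, OF gd])
  also have "\<dots> \<le> cmod (det (mat_Re (mean_app g A B)))"
  proof (rule det_mono[OF diag_cong_pd[OF gd] hermitian_mat_Re[OF Mc]])
    fix x :: "complex vec" assume x: "x \<in> carrier_vec n"
    show "Re (qform (diag_cong (\<lambda>i. g (d i))) x) \<le> Re (qform (mat_Re (mean_app g A B)) x)"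
      unfolding qform_mat_Re[OF Mc x] diag_form[OF S(1) x] using mean_form_bounds(1)[OF g x] by simp
  qed
  also have "\<dots> \<le> cmod (det (mean_app g A B))" by (rule sectorial_det(2)[OF th sec])
  finally show "gram_det * (\<Prod>i<n. g (d i)) \<le> cmod (det (mean_app g A B))" .
qed

text \<open>The real part of the arithmetic mean is exactly diagonal in these coordinates, so only
  the factor of \<open>sectorial_det\<close> is lost.\<close>

lemma det_arith_mean_bound:
  assumes v: "0 \<le> v" "v \<le> 1"
  shows "cmod (det (complex_of_real v \<cdot>\<^sub>m A + complex_of_real (1 - v) \<cdot>\<^sub>m B))
    \<le> (1 / cos \<theta>) ^ n * (gram_det * (\<Prod>i<n. v + (1 - v) * d i))"
proof -
  define N where "N = complex_of_real v \<cdot>\<^sub>m A + complex_of_real (1 - v) \<cdot>\<^sub>m B"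
  have Nc: "N \<in> carrier_mat n n" unfolding N_def using acc by simp
  have q: "qform N x = of_real v * qform A x + of_real (1 - v) * qform B x" if x: "x \<in> carrier_vec n" for x
    unfolding N_def using acc(3,4) x
    by (subst qform_add[of _ n]) (auto simp: qform_smult[OF acc(3) x] qform_smult[OF acc(4) x])
  have fpos: "0 < v + (1 - v) * d i" if "i < n" for i
    using v d_pos[OF that] by (cases "v = 0") (auto intro: add_pos_nonneg)
  have form: "Re (qform N x) = (\<Sum>i<n. (v + (1 - v) * d i) * (cmod (coord x i))\<^sup>2)" if x: "x \<in> carrier_vec n" for x
  proof -
    have "Re (qform N x) = v * Re (qform A x) + (1 - v) * Re (qform B x)" unfolding q[OF x] by (simp del: of_real_diff)
    then show ?thesis
      unfolding qform_A[OF x] qform_B[OF x] sum_distrib_left sum.distrib[symmetric]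
      by (simp only: distrib_right mult.assoc mult_1)
  qed
  have sec: "sectorial n \<theta> N"
    unfolding sectorial_def accretive_def
  proof (intro conjI ballI impI)
    fix x :: "complex vec" assume x: "x \<in> carrier_vec n"
    have a: "\<bar>Im (qform A x)\<bar> \<le> tan \<theta> * Re (qform A x)" "\<bar>Im (qform B x)\<bar> \<le> tan \<theta> * Re (qform B x)"
      using A B x unfolding sectorial_def by auto
    have "\<bar>v * Im (qform A x) + (1 - v) * Im (qform B x)\<bar> \<le> v * \<bar>Im (qform A x)\<bar> + (1 - v) * \<bar>Im (qform B x)\<bar>"
      using v by (intro order_trans[OF abs_triangle_ineq]) (simp add: abs_mult)
    also have "\<dots> \<le> v * (tan \<theta> * Re (qform A x)) + (1 - v) * (tan \<theta> * Re (qform B x))"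
      using v a by (intro add_mono mult_left_mono) auto
    finally show "\<bar>Im (qform N x)\<bar> \<le> tan \<theta> * Re (qform N x)" unfolding q[OF x] by (simp add: algebra_simps del: of_real_diff)
    assume x0: "x \<noteq> 0\<^sub>v n"
    have "pd_mat n (diag_cong (\<lambda>i. v + (1 - v) * d i))" by (rule diag_cong_pd[OF fpos])
    then have "0 < Re (qform (diag_cong (\<lambda>i. v + (1 - v) * d i)) x)"
      using x x0 unfolding pd_mat_def by blast
    then show "0 < Re (qform N x)" unfolding form[OF x] diag_form[OF S(1) x] by simp
  qed (rule Nc)
  then have acN: "accretive n N" unfolding sectorial_def by simp
  have "cmod (det N) \<le> (1 / cos \<theta>) ^ n * cmod (det (mat_Re N))" by (rule sectorial_det(1)[OF th sec])
  also have "\<dots> \<le> (1 / cos \<theta>) ^ n * cmod (det (diag_cong (\<lambda>i. v + (1 - v) * d i)))"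
  proof (intro mult_left_mono det_mono[OF accretive_pd_Re[OF acN]] hermitian_cong[OF S(1) hermitian_diag])
    fix x :: "complex vec" assume x: "x \<in> carrier_vec n"
    show "Re (qform (mat_Re N) x) \<le> Re (qform (diag_cong (\<lambda>i. v + (1 - v) * d i)) x)"
      unfolding qform_mat_Re[OF Nc x] diag_form[OF S(1) x] form[OF x] by simp
  qed (use cos_pos in simp)
  also have "cmod (det (diag_cong (\<lambda>i. v + (1 - v) * d i))) = gram_det * (\<Prod>i<n. v + (1 - v) * d i)"
    by (rule det_diag_cong_norm) (rule fpos)
  finally show ?thesis unfolding N_def .
qed

section \<open>Pencil eigenvalues and comparison of determinants\<close>

text \<open>At the test vector x the real parts of the forms of A and B are 1 and d = d i, and both
  lie between m |x|^2 and M |x|^2, so m/M \<le> d \<le> M/m. Cleared of denominators the claim is (M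
  d - m)(M - m d) \<ge> 0.\<close>

lemma pencil_bound:
  assumes m: "0 < m" and i: "i < n"
    and bA: "\<And>x. x \<in> carrier_vec n \<Longrightarrow> m * Re (x \<bullet>c x) \<le> Re (qform A x) \<and> Re (qform A x) \<le> M * Re (x \<bullet>c x)"
    and bB: "\<And>x. x \<in> carrier_vec n \<Longrightarrow> m * Re (x \<bullet>c x) \<le> Re (qform B x) \<and> Re (qform B x) \<le> M * Re (x \<bullet>c x)"
  shows "(1 + d i)\<^sup>2 / (4 * d i) \<le> (M + m)\<^sup>2 / (4 * m * M)"
proof -
  define x where "x = mat_adjoint T *\<^sub>v unit_vec n i"
  note t = test_values[OF i, folded x_def]
  define \<xi> where "\<xi> = Re (x \<bullet>c x)"
  have xi: "0 < \<xi>" unfolding \<xi>_def by (rule cscalar_self_pos[OF t(1,2)])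
  have a: "m * \<xi> \<le> 1" "1 \<le> M * \<xi>" "m * \<xi> \<le> d i" "d i \<le> M * \<xi>"
    using bA[OF t(1)] bB[OF t(1)] unfolding t(3,4) \<xi>_def by auto
  have "0 < M * \<xi>" using a(2) by linarith
  then have M: "0 < M" using xi by (rule zero_less_mult_pos2)
  have "m * 1 \<le> m * (M * \<xi>)" using a(2) m by (intro mult_left_mono) auto
  also have "\<dots> = M * (m * \<xi>)" by simp
  also have "\<dots> \<le> M * d i" using a(3) M by (intro mult_left_mono) auto
  finally have 1: "0 \<le> M * d i - m" by simp
  have "m * d i \<le> m * (M * \<xi>)" using a(4) m by (intro mult_left_mono) auto
  also have "\<dots> = M * (m * \<xi>)" by simp
  also have "\<dots> \<le> M * 1" using a(1) M by (intro mult_left_mono) auto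
  finally have 2: "0 \<le> M - m * d i" by simp
  have "0 \<le> (M * d i - m) * (M - m * d i)" using 1 2 by (rule mult_nonneg_nonneg)
  then have "(1 + d i)\<^sup>2 * (m * M) \<le> (M + m)\<^sup>2 * d i" by (simp add: power2_eq_square algebra_simps)
  then show ?thesis using m M d_pos[OF i] by (simp add: divide_simps mult_ac)
qed

text \<open>Dividing g(d) g(1/d) \<le> K by g(1/d) bounds g by K times its adjoint, which lies below
  g2.\<close>

lemma mean_ratio_bound:
  assumes g: "op_mean_fun g" and g2: "\<And>t. 0 < t \<Longrightarrow> 1 / g (1 / t) \<le> g2 t" and i: "i < n"
    and K: "(1 + d i)\<^sup>2 / (4 * d i) \<le> K"
  shows "g (d i) \<le> K * g2 (d i)"
proof -
  have p: "0 < g (1 / d i)" using g d_pos[OF i] unfolding op_mean_fun_def by auto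
  have "g (d i) * g (1 / d i) \<le> K"
    using op_mean_fun_symmetric_product[OF g d_pos[OF i]] K by linarith
  then have "g (d i) \<le> K * (1 / g (1 / d i))" using p by (simp add: le_divide_eq)
  also have "\<dots> \<le> K * g2 (d i)"
    using g2[OF d_pos[OF i]] K d_pos[OF i] by (intro mult_left_mono) (auto intro: order_trans[rotated])
  finally show ?thesis .
qed

lemma prod_ratio_bound:
  assumes "\<And>i. i < n \<Longrightarrow> 0 \<le> f i \<and> f i \<le> K * h i"
  shows "gram_det * (\<Prod>i<n. f i) \<le> K ^ n * (gram_det * (\<Prod>i<n. h i))"
proof -
  have "(\<Prod>i<n. f i) \<le> (\<Prod>i<n. K * h i)" using assms by (intro prod_mono) auto
  also have "\<dots> = K ^ n * (\<Prod>i<n. h i)" by (simp add: prod.distrib)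
  finally have "gram_det * (\<Prod>i<n. f i) \<le> gram_det * (K ^ n * (\<Prod>i<n. h i))"
    by (rule mult_left_mono) (simp add: gram_det_def)
  then show ?thesis by (simp add: mult.left_commute)
qed

text \<open>For n = 0 the hypothesis is vacuous and K may be negative, but then the power is
  1.\<close>

lemma ratio_power_nonneg:
  assumes K: "\<And>i. i < n \<Longrightarrow> (1 + d i)\<^sup>2 / (4 * d i) \<le> K"
  shows "0 \<le> K ^ n"
proof (cases "n = 0")
  case False
  then have "0 \<le> K" using K[of 0] d_pos[of 0] by (auto intro: order_trans[rotated])
  then show ?thesis by simp
qed simp

text \<open>g1 is replaced by g above it and g2 by the adjoint of g below it; K bridges the gap
  between g and its adjoint.\<close>

lemma det_means_compare:
  assumes g: "op_mean_fun g" "op_mean_fun g1" "op_mean_fun g2"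
    and le: "\<And>t. 0 < t \<Longrightarrow> g1 t \<le> g t" "\<And>t. 0 < t \<Longrightarrow> 1 / g (1 / t) \<le> g2 t"
    and K: "\<And>i. i < n \<Longrightarrow> (1 + d i)\<^sup>2 / (4 * d i) \<le> K"
  shows "cmod (det (mean_app g1 A B)) \<le> (1 / cos \<theta>) ^ (3 * n) * K ^ n * cmod (det (mean_app g2 A B))"
proof -
  have "cmod (det (mean_app g1 A B)) \<le> (1 / cos \<theta>) ^ (3 * n) * (gram_det * (\<Prod>i<n. g1 (d i)))"
    by (rule det_mean_bounds(1)[OF g(2)])
  also have "gram_det * (\<Prod>i<n. g1 (d i)) \<le> K ^ n * (gram_det * (\<Prod>i<n. g2 (d i)))"
  proof (rule prod_ratio_bound)
    fix i assume i: "i < n"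
    have "0 < g1 (d i)" using g(2) d_pos[OF i] unfolding op_mean_fun_def by auto
    then show "0 \<le> g1 (d i) \<and> g1 (d i) \<le> K * g2 (d i)"
      using le(1)[OF d_pos[OF i]] mean_ratio_bound[OF g(1) le(2) i K[OF i]] by linarith
  qed
  also have "K ^ n * (gram_det * (\<Prod>i<n. g2 (d i))) \<le> K ^ n * cmod (det (mean_app g2 A B))"
    by (rule mult_left_mono[OF det_mean_bounds(2)[OF g(3)] ratio_power_nonneg[OF K]])
  finally show ?thesis using cos_pos by (simp add: mult.assoc mult_left_mono)
qed

text \<open>Let X be the arithmetic value at d and Y/d the reciprocal of the harmonic one. Then X +
  Y = 1 + d, so X Y \<le> (1 + d)^2/4, which gives the same constant without an adjoint
  function.\<close>

lemma det_arith_compare: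
  assumes v: "0 \<le> v" "v \<le> 1" and h: "op_mean_fun h"
    and le: "\<And>t. 0 < t \<Longrightarrow> 1 / (v + (1 - v) / t) \<le> h t"
    and K: "\<And>i. i < n \<Longrightarrow> (1 + d i)\<^sup>2 / (4 * d i) \<le> K"
  shows "cmod (det (complex_of_real v \<cdot>\<^sub>m A + complex_of_real (1 - v) \<cdot>\<^sub>m B))
    \<le> (1 / cos \<theta>) ^ n * K ^ n * cmod (det (mean_app h A B))"
proof -
  have "cmod (det (complex_of_real v \<cdot>\<^sub>m A + complex_of_real (1 - v) \<cdot>\<^sub>m B))
    \<le> (1 / cos \<theta>) ^ n * (gram_det * (\<Prod>i<n. v + (1 - v) * d i))"
    by (rule det_arith_mean_bound[OF v])
  also have "gram_det * (\<Prod>i<n. v + (1 - v) * d i) \<le> K ^ n * (gram_det * (\<Prod>i<n. h (d i)))"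
  proof (rule prod_ratio_bound)
    fix i assume i: "i < n"
    note dp = d_pos[OF i]
    define X where "X = v + (1 - v) * d i"
    define Y where "Y = v * d i + (1 - v)"
    have X: "0 \<le> X" unfolding X_def using v dp by simp
    have Y: "0 < Y" unfolding Y_def by (rule harm_den_pos[OF v dp])
    have "4 * (X * Y) \<le> (X + Y)\<^sup>2" using zero_le_power2[of "X - Y"] by (simp add: power2_eq_square algebra_simps)
    also have "X + Y = 1 + d i" unfolding X_def Y_def by (simp add: algebra_simps)
    finally have "X * Y / d i \<le> (1 + d i)\<^sup>2 / (4 * d i)" using dp by (simp add: divide_simps mult_ac)
    then have "X * (Y / d i) \<le> K" using K[OF i] by simp
    moreover have Yd: "Y / d i = v + (1 - v) / d i" unfolding Y_def using dp by (simp add: add_divide_distrib)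
    moreover have "0 < Y / d i" using Y dp by simp
    ultimately have "X \<le> K * (1 / (v + (1 - v) / d i))" by (simp add: le_divide_eq)
    also have "\<dots> \<le> K * h (d i)"
      using le[OF dp] K[OF i] dp by (intro mult_left_mono) (auto intro: order_trans[rotated])
    finally show "0 \<le> v + (1 - v) * d i \<and> v + (1 - v) * d i \<le> K * h (d i)" using X unfolding X_def by simp
  qed
  also have "K ^ n * (gram_det * (\<Prod>i<n. h (d i))) \<le> K ^ n * cmod (det (mean_app h A B))"
    by (rule mult_left_mono[OF det_mean_bounds(2)[OF h] ratio_power_nonneg[OF K]])
  finally show ?thesis using cos_pos by (simp add: mult.assoc mult_left_mono)
qed

end

section \<open>Scalar bounds on real parts and the final assembly\<close>

lemma loewner_le_scalar:
  assumes X: "X \<in> carrier_mat n n" and x: "x \<in> carrier_vec n"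
  shows "loewner_le n (complex_of_real m \<cdot>\<^sub>m 1\<^sub>m n) (mat_Re X) \<Longrightarrow> m * Re (x \<bullet>c x) \<le> Re (qform X x)"
    "loewner_le n (mat_Re X) (complex_of_real m \<cdot>\<^sub>m 1\<^sub>m n) \<Longrightarrow> Re (qform X x) \<le> m * Re (x \<bullet>c x)"
proof -
  have c: "mat_Re X \<in> carrier_mat n n" using hermitian_mat_Re[OF X] unfolding hermitian_mat_def by simp
  have o: "complex_of_real m \<cdot>\<^sub>m 1\<^sub>m n \<in> carrier_mat n n" by simp
  have q: "qform (complex_of_real m \<cdot>\<^sub>m 1\<^sub>m n) x = of_real m * (x \<bullet>c x)"
    unfolding qform_smult[OF one_carrier_mat x] qform_one[OF x] ..
  show "loewner_le n (complex_of_real m \<cdot>\<^sub>m 1\<^sub>m n) (mat_Re X) \<Longrightarrow> m * Re (x \<bullet>c x) \<le> Re (qform X x)"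
    using x unfolding loewner_le_def psd_mat_def
    by (auto simp: qform_minus[OF c o x] q qform_mat_Re[OF X x] dest!: bspec[OF _ x])
  show "loewner_le n (mat_Re X) (complex_of_real m \<cdot>\<^sub>m 1\<^sub>m n) \<Longrightarrow> Re (qform X x) \<le> m * Re (x \<bullet>c x)"
    using x unfolding loewner_le_def psd_mat_def
    by (auto simp: qform_minus[OF o c x] q qform_mat_Re[OF X x] dest!: bspec[OF _ x])
qed

text \<open>The order reversal under inversion is carried out by expanding a nonnegative quadratic
  form at a suitable vector. The factor cos^2 \<theta> appears because Re (X^-1) controls (Re X)^-1
  only up to sec^2 \<theta>.\<close>

lemma inverse_Re_bounds:
  assumes th: "0 \<le> \<theta>" "\<theta> < pi / 2" and X: "sectorial n \<theta> X" and m: "0 < m" "m \<le> M"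
    and lo: "loewner_le n (complex_of_real m \<cdot>\<^sub>m 1\<^sub>m n) (mat_Re (minv X))"
    and hi: "loewner_le n (mat_Re (minv X)) (complex_of_real M \<cdot>\<^sub>m 1\<^sub>m n)"
    and x: "x \<in> carrier_vec n"
  shows "(cos \<theta>)\<^sup>2 / M * Re (x \<bullet>c x) \<le> Re (qform X x)" "Re (qform X x) \<le> 1 / m * Re (x \<bullet>c x)"
proof -
  have acX: "accretive n X" and Xc: "X \<in> carrier_mat n n" using X unfolding sectorial_def accretive_def by auto
  note iX = minv_inverse[OF Xc accretive_det[OF acX]]
  have c: "0 < cos \<theta>" using th by (intro cos_gt_zero_pi) auto
  have qinv: "Re (qform (minv X) (X *\<^sub>v y)) = Re (qform X y)" if y: "y \<in> carrier_vec n" for y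
  proof -
    have Xy: "X *\<^sub>v y \<in> carrier_vec n" by (rule mult_mat_vec_carrier[OF Xc y])
    have "minv X *\<^sub>v (X *\<^sub>v y) = y" using assoc_mult_mat_vec[OF iX(1) Xc y] iX(3) y by simp
    then have "qform (minv X) (X *\<^sub>v y) = y \<bullet>c (X *\<^sub>v y)" unfolding qform_def by simp
    also have "\<dots> = cnj (qform X y)" unfolding qform_def by (rule cscalar_swap[OF Xy y])
    finally show ?thesis by simp
  qed
  have pos: "0 \<le> Re (qform X y)" if "y \<in> carrier_vec n" for y
  proof (cases "y = 0\<^sub>v n")
    case True
    have "qform X (0\<^sub>v n) = 0" unfolding qform_def using Xc by (auto simp: scalar_prod_def)
    then show ?thesis using True by simp
  qed (use acX that in \<open>auto simp: accretive_def intro: less_imp_le\<close>)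
  define z where "z = X *\<^sub>v x"
  have z: "z \<in> carrier_vec n" unfolding z_def by (rule mult_mat_vec_carrier[OF Xc x])
  have q: "qform X x = z \<bullet>c x" unfolding qform_def z_def ..
  show "Re (qform X x) \<le> 1 / m * Re (x \<bullet>c x)"
  proof -
    have 1: "m * Re (z \<bullet>c z) \<le> Re (qform X x)"
      using loewner_le_scalar(1)[OF iX(1) z lo] qinv[OF x] unfolding z_def by simp
    \<comment> \<open>|m z - x|^2 \<ge> 0 together with m |z|^2 \<le> Re (z,x) gives m Re (z,x)
      \<le> |x|^2, and (z,x) is the form of X at x.\<close>
    define y where "y = complex_of_real m \<cdot>\<^sub>v z - x"
    have y: "y \<in> carrier_vec n" unfolding y_def using z x by simp
    have mz: "complex_of_real m \<cdot>\<^sub>v z \<in> carrier_vec n" using z by simp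
    have "y \<bullet>c y = of_real m * (of_real m * (z \<bullet>c z)) - of_real m * (z \<bullet>c x) - (of_real m * (x \<bullet>c z) - x \<bullet>c x)"
      unfolding y_def using z x mz
      by (simp add: cscalar_add(3)[OF mz x z] cscalar_add(3)[OF mz x x] cscalar_add(4)[OF mz x] cscalar_smult[of _ n] right_diff_distrib)
    moreover have "Re (x \<bullet>c z) = Re (z \<bullet>c x)" using cscalar_swap[OF z x] by simp
    moreover have "0 \<le> Re (y \<bullet>c y)" by (rule cscalar_self_nonneg(1)[OF y])
    ultimately have "2 * m * Re (z \<bullet>c x) \<le> m * (m * Re (z \<bullet>c z)) + Re (x \<bullet>c x)" by simp
    also have "\<dots> \<le> m * Re (qform X x) + Re (x \<bullet>c x)" using mult_left_mono[OF 1, of m] m by simp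
    finally have "m * Re (qform X x) \<le> Re (x \<bullet>c x)" unfolding q by simp
    then show ?thesis using m by (simp add: le_divide_eq mult.commute)
  qed
  have pdP: "pd_mat n (mat_Re X)" by (rule accretive_pd_Re[OF acX])
  have Pc: "mat_Re X \<in> carrier_mat n n" using pdP unfolding pd_mat_def hermitian_mat_def by simp
  have acP: "accretive n (mat_Re X)" using pdP Pc unfolding pd_mat_def accretive_def by auto
  note iP = minv_inverse[OF Pc accretive_det[OF acP]]
  define v where "v = minv (mat_Re X) *\<^sub>v x"
  have v: "v \<in> carrier_vec n" unfolding v_def by (rule mult_mat_vec_carrier[OF iP(1) x])
  have Pv: "mat_Re X *\<^sub>v v = x" unfolding v_def using assoc_mult_mat_vec[OF Pc iP(1) x] iP(2) x by simp
  define u where "u = minv X *\<^sub>v x"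
  have u: "u \<in> carrier_vec n" unfolding u_def by (rule mult_mat_vec_carrier[OF iX(1) x])
  have Xu: "X *\<^sub>v u = x" unfolding u_def using assoc_mult_mat_vec[OF Xc iX(1) x] iX(2) x by simp
  have "(cos \<theta>)\<^sup>2 * Re (qform (minv (mat_Re X)) x) \<le> Re (qform X u)"
    by (rule sectorial_inverse_Re[OF th X u Xu])
  also have "\<dots> \<le> M * Re (x \<bullet>c x)"
    using loewner_le_scalar(2)[OF iX(1) x hi] qinv[OF u] unfolding Xu by simp
  also have "Re (qform (minv (mat_Re X)) x) = Re (qform (mat_Re X) v)"
  proof -
    have "qform (minv (mat_Re X)) x = v \<bullet>c x" unfolding qform_def v_def ..
    also have "\<dots> = cnj (x \<bullet>c v)" by (rule cscalar_swap[OF x v])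
    also have "x \<bullet>c v = qform (mat_Re X) v" unfolding qform_def Pv ..
    finally show ?thesis by simp
  qed
  finally have 2: "(cos \<theta>)\<^sup>2 * Re (qform X v) \<le> M * Re (x \<bullet>c x)" unfolding qform_mat_Re[OF Xc v] by simp
  define l where "l = M / (cos \<theta>)\<^sup>2"
  have l: "0 < l" unfolding l_def using c m by simp
  have 3: "Re (qform X v) \<le> l * Re (x \<bullet>c x)" unfolding l_def using 2 c by (simp add: le_divide_eq mult.commute)
  \<comment> \<open>Let q be the form of P = Re X, with P v = x. Positivity at l x - v reads l^2
    q(x) \<ge> 2 l |x|^2 - q(v), and q(v) \<le> l |x|^2.\<close>
  define y where "y = complex_of_real l \<cdot>\<^sub>v x - v"
  have lx: "complex_of_real l \<cdot>\<^sub>v x \<in> carrier_vec n" using x by simp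
  have y: "y \<in> carrier_vec n" unfolding y_def using v x by simp
  let ?P = "mat_Re X"
  have Px: "?P *\<^sub>v x \<in> carrier_vec n" by (rule mult_mat_vec_carrier[OF Pc x])
  have Py: "?P *\<^sub>v y = complex_of_real l \<cdot>\<^sub>v (?P *\<^sub>v x) - x"
    unfolding y_def using mult_minus_distrib_mat_vec[OF Pc lx v] mult_mat_vec[OF Pc x] Pv by simp
  have Pxv: "(?P *\<^sub>v x) \<bullet>c v = x \<bullet>c x"
    using cscalar_adj[OF Pc x v] pdP Pv unfolding pd_mat_def hermitian_mat_def by simp
  have "qform ?P y = of_real l * (of_real l * qform ?P x) - of_real l * (x \<bullet>c x) - (of_real l * (x \<bullet>c x) - qform ?P v)"
  proof -
    have lPx: "complex_of_real l \<cdot>\<^sub>v (?P *\<^sub>v x) \<in> carrier_vec n" using Px by simp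
    have "qform ?P y = (complex_of_real l \<cdot>\<^sub>v (?P *\<^sub>v x)) \<bullet>c y - x \<bullet>c y"
      unfolding qform_def Py by (rule cscalar_add(3)[OF lPx x y])
    also have "(complex_of_real l \<cdot>\<^sub>v (?P *\<^sub>v x)) \<bullet>c y = of_real l * ((?P *\<^sub>v x) \<bullet>c y)"
      by (rule cscalar_smult(1)[OF Px y])
    also have "(?P *\<^sub>v x) \<bullet>c y = (?P *\<^sub>v x) \<bullet>c (complex_of_real l \<cdot>\<^sub>v x) - (?P *\<^sub>v x) \<bullet>c v"
      unfolding y_def by (rule cscalar_add(4)[OF lx v Px])
    also have "(?P *\<^sub>v x) \<bullet>c (complex_of_real l \<cdot>\<^sub>v x) = of_real l * qform ?P x"
      unfolding qform_def by (simp add: cscalar_smult(2)[OF Px x])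
    also have "x \<bullet>c y = x \<bullet>c (complex_of_real l \<cdot>\<^sub>v x) - x \<bullet>c v"
      unfolding y_def by (rule cscalar_add(4)[OF lx v x])
    also have "x \<bullet>c (complex_of_real l \<cdot>\<^sub>v x) = of_real l * (x \<bullet>c x)" by (simp add: cscalar_smult(2)[OF x x])
    also have "x \<bullet>c v = qform ?P v" unfolding qform_def Pv ..
    finally show ?thesis unfolding Pxv by (simp add: algebra_simps)
  qed
  from arg_cong[OF this, of Re]
  have "Re (qform ?P y) = l * (l * Re (qform ?P x)) - l * Re (x \<bullet>c x) - (l * Re (x \<bullet>c x) - Re (qform ?P v))" by simp
  then have "Re (qform X y) = l * (l * Re (qform X x)) - l * Re (x \<bullet>c x) - (l * Re (x \<bullet>c x) - Re (qform X v))"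
    unfolding qform_mat_Re[OF Xc x] qform_mat_Re[OF Xc y] qform_mat_Re[OF Xc v] Re_complex_of_real .
  then have "l * Re (x \<bullet>c x) \<le> l * (l * Re (qform X x))" using pos[OF y] 3 by linarith
  then have "Re (x \<bullet>c x) \<le> l * Re (qform X x)" using l by simp
  then show "(cos \<theta>)\<^sup>2 / M * Re (x \<bullet>c x) \<le> Re (qform X x)"
    unfolding l_def using c m by (simp add: field_simps)
qed

theorem theorem3p2:
  fixes n :: nat and \<theta> m M :: real and A B :: "complex mat"
  assumes th: "0 \<le> \<theta>" "\<theta> < pi / 2"
    and AS: "sector_mat n \<theta> A" and BS: "sector_mat n \<theta> B"
    and mM: "0 < m" "m \<le> M"
  defines "K \<equiv> (M + m)\<^sup>2 / (4 * m * M)"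
  shows
   "(\<forall>g g1 g2. op_mean_fun g \<and> op_mean_fun g1 \<and> op_mean_fun g2 \<and>
       (\<forall>t>0. 1 / g (1 / t) \<le> g1 t \<and> g1 t \<le> g t \<and> 1 / g (1 / t) \<le> g2 t \<and> g2 t \<le> g t) \<longrightarrow>
       (loewner_le n (complex_of_real m \<cdot>\<^sub>m 1\<^sub>m n) (mat_Re A) \<and>
        loewner_le n (mat_Re A) (complex_of_real M \<cdot>\<^sub>m 1\<^sub>m n) \<and>
        loewner_le n (complex_of_real m \<cdot>\<^sub>m 1\<^sub>m n) (mat_Re B) \<and>
        loewner_le n (mat_Re B) (complex_of_real M \<cdot>\<^sub>m 1\<^sub>m n) \<longrightarrow>
          cmod (det (mean_app g1 A B))
            \<le> (1 / cos \<theta>) ^ (3 * n) * K ^ n * cmod (det (mean_app g2 A B))) \<and>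
       (loewner_le n (complex_of_real m \<cdot>\<^sub>m 1\<^sub>m n) (mat_Re (minv A)) \<and>
        loewner_le n (mat_Re (minv A)) (complex_of_real M \<cdot>\<^sub>m 1\<^sub>m n) \<and>
        loewner_le n (complex_of_real m \<cdot>\<^sub>m 1\<^sub>m n) (mat_Re (minv B)) \<and>
        loewner_le n (mat_Re (minv B)) (complex_of_real M \<cdot>\<^sub>m 1\<^sub>m n) \<longrightarrow>
          cmod (det (mean_app g1 A B))
            \<le> (1 / cos \<theta>) ^ (5 * n) * K ^ n * cmod (det (mean_app g2 A B)))) \<and>
    (\<forall>v h. 0 \<le> v \<and> v \<le> 1 \<and> op_mean_fun h \<and>
       (\<forall>t>0. 1 / (v + (1 - v) / t) \<le> h t \<and> h t \<le> v + (1 - v) * t) \<and>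
       loewner_le n (complex_of_real m \<cdot>\<^sub>m 1\<^sub>m n) (mat_Re A) \<and>
       loewner_le n (mat_Re A) (complex_of_real M \<cdot>\<^sub>m 1\<^sub>m n) \<and>
       loewner_le n (complex_of_real m \<cdot>\<^sub>m 1\<^sub>m n) (mat_Re B) \<and>
       loewner_le n (mat_Re B) (complex_of_real M \<cdot>\<^sub>m 1\<^sub>m n) \<longrightarrow>
         cmod (det (complex_of_real v \<cdot>\<^sub>m A + complex_of_real (1 - v) \<cdot>\<^sub>m B))
           \<le> (1 / cos \<theta>) ^ n * K ^ n * cmod (det (mean_app h A B)))"
proof -
  have A: "sectorial n \<theta> A" and B: "sectorial n \<theta> B"
    using sector_mat_sectorial AS BS by auto
  then have acc: "accretive n A" "accretive n B" and c: "A \<in> carrier_mat n n" "B \<in> carrier_mat n n"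
    unfolding sectorial_def accretive_def by auto
  obtain S T d where S: "S \<in> carrier_mat n n" "T \<in> carrier_mat n n" "S * T = 1\<^sub>m n" "T * S = 1\<^sub>m n"
    "mat_Re A = S * mat_adjoint S" "mat_Re B = S * mat_diag n (\<lambda>i. complex_of_real (d i)) * mat_adjoint S"
    by (rule simultaneous_diagonalization[OF accretive_pd_Re[OF acc(1)] hermitian_mat_Re[OF c(2)]])
  \<comment> \<open>One congruence serves all three parts; they differ in the bound on the d i and
    in the means compared.\<close>
  interpret sectorial_pair n \<theta> A B S T d
    by unfold_locales (use th A B S in auto)
  have cos: "0 < cos \<theta>" by (rule cos_pos)
  have direct: "(1 + d i)\<^sup>2 / (4 * d i) \<le> K"
    if "loewner_le n (complex_of_real m \<cdot>\<^sub>m 1\<^sub>m n) (mat_Re A)" "loewner_le n (mat_Re A) (complex_of_real M \<cdot>\<^sub>m 1\<^sub>m n)"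
      "loewner_le n (complex_of_real m \<cdot>\<^sub>m 1\<^sub>m n) (mat_Re B)" "loewner_le n (mat_Re B) (complex_of_real M \<cdot>\<^sub>m 1\<^sub>m n)" "i < n" for i
    unfolding K_def
    by (rule pencil_bound[OF mM(1) that(5)])
      (use loewner_le_scalar(1)[OF c(1) _ that(1)] loewner_le_scalar(2)[OF c(1) _ that(2)]
        loewner_le_scalar(1)[OF c(2) _ that(3)] loewner_le_scalar(2)[OF c(2) _ that(4)] in auto)
  have inv: "(1 + d i)\<^sup>2 / (4 * d i) \<le> (1 / cos \<theta>)\<^sup>2 * K"
    if "loewner_le n (complex_of_real m \<cdot>\<^sub>m 1\<^sub>m n) (mat_Re (minv A))" "loewner_le n (mat_Re (minv A)) (complex_of_real M \<cdot>\<^sub>m 1\<^sub>m n)"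
      "loewner_le n (complex_of_real m \<cdot>\<^sub>m 1\<^sub>m n) (mat_Re (minv B))" "loewner_le n (mat_Re (minv B)) (complex_of_real M \<cdot>\<^sub>m 1\<^sub>m n)" "i < n" for i
  proof -
    have "(1 + d i)\<^sup>2 / (4 * d i) \<le> (1 / m + (cos \<theta>)\<^sup>2 / M)\<^sup>2 / (4 * ((cos \<theta>)\<^sup>2 / M) * (1 / m))"
      by (rule pencil_bound[OF _ that(5)])
        (use inverse_Re_bounds[OF th A mM that(1,2)] inverse_Re_bounds[OF th B mM that(3,4)] cos mM in auto)
    \<comment> \<open>Only the numerator is enlarged by cos^2 \<theta> \<le> 1; the cosine kept in
      the denominator becomes the factor sec^2 \<theta>.\<close>
    also have "\<dots> \<le> (1 / m + 1 / M)\<^sup>2 / (4 * ((cos \<theta>)\<^sup>2 / M) * (1 / m))"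
    proof (intro divide_right_mono power_mono add_left_mono)
      show "(cos \<theta>)\<^sup>2 \<le> 1" by (simp add: abs_square_le_1)
    qed (use mM in auto)
    also have "\<dots> = (1 / cos \<theta>)\<^sup>2 * K"
    proof -
      have "1 / m + 1 / M = (M + m) / (m * M)" using mM by (simp add: field_simps)
      then show ?thesis unfolding K_def using mM cos by (simp add: power_divide power_mult_distrib power2_eq_square)
    qed
    finally show ?thesis .
  qed
  show ?thesis
  proof (intro conjI allI impI; (elim conjE)?)
    fix g g1 g2
    assume g: "op_mean_fun g" "op_mean_fun g1" "op_mean_fun g2"
      and le: "\<forall>t>0. 1 / g (1 / t) \<le> g1 t \<and> g1 t \<le> g t \<and> 1 / g (1 / t) \<le> g2 t \<and> g2 t \<le> g t"
    {
      assume b: "loewner_le n (complex_of_real m \<cdot>\<^sub>m 1\<^sub>m n) (mat_Re A)" "loewner_le n (mat_Re A) (complex_of_real M \<cdot>\<^sub>m 1\<^sub>m n)"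
        "loewner_le n (complex_of_real m \<cdot>\<^sub>m 1\<^sub>m n) (mat_Re B)" "loewner_le n (mat_Re B) (complex_of_real M \<cdot>\<^sub>m 1\<^sub>m n)"
      show "cmod (det (mean_app g1 A B)) \<le> (1 / cos \<theta>) ^ (3 * n) * K ^ n * cmod (det (mean_app g2 A B))"
        by (rule det_means_compare[OF g _ _ direct[OF b]]) (use le in auto)
    next
      assume b: "loewner_le n (complex_of_real m \<cdot>\<^sub>m 1\<^sub>m n) (mat_Re (minv A))" "loewner_le n (mat_Re (minv A)) (complex_of_real M \<cdot>\<^sub>m 1\<^sub>m n)"
        "loewner_le n (complex_of_real m \<cdot>\<^sub>m 1\<^sub>m n) (mat_Re (minv B))" "loewner_le n (mat_Re (minv B)) (complex_of_real M \<cdot>\<^sub>m 1\<^sub>m n)"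
      have "cmod (det (mean_app g1 A B)) \<le> (1 / cos \<theta>) ^ (3 * n) * ((1 / cos \<theta>)\<^sup>2 * K) ^ n * cmod (det (mean_app g2 A B))"
        by (rule det_means_compare[OF g _ _ inv[OF b]]) (use le in auto)
      \<comment> \<open>The n-th power of sec^2 \<theta> raises the exponent from 3n to 5n.\<close>
      also have "(1 / cos \<theta>) ^ (3 * n) * ((1 / cos \<theta>)\<^sup>2 * K) ^ n = (1 / cos \<theta>) ^ (5 * n) * K ^ n"
        unfolding power_mult_distrib[of "(1 / cos \<theta>)\<^sup>2"] power_mult[symmetric] mult.assoc[symmetric] power_add[symmetric] by simp
      finally show "cmod (det (mean_app g1 A B)) \<le> (1 / cos \<theta>) ^ (5 * n) * K ^ n * cmod (det (mean_app g2 A B))" .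
    }
  next
    fix v h
    assume v: "0 \<le> v" "v \<le> 1" and h: "op_mean_fun h"
      and le: "\<forall>t>0. 1 / (v + (1 - v) / t) \<le> h t \<and> h t \<le> v + (1 - v) * t"
      and b: "loewner_le n (complex_of_real m \<cdot>\<^sub>m 1\<^sub>m n) (mat_Re A)" "loewner_le n (mat_Re A) (complex_of_real M \<cdot>\<^sub>m 1\<^sub>m n)"
        "loewner_le n (complex_of_real m \<cdot>\<^sub>m 1\<^sub>m n) (mat_Re B)" "loewner_le n (mat_Re B) (complex_of_real M \<cdot>\<^sub>m 1\<^sub>m n)"
    show "cmod (det (complex_of_real v \<cdot>\<^sub>m A + complex_of_real (1 - v) \<cdot>\<^sub>m B))
        \<le> (1 / cos \<theta>) ^ n * K ^ n * cmod (det (mean_app h A B))"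
      by (rule det_arith_compare[OF v h _ direct[OF b]]) (use le in auto)
  qed
qed

end
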